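(* Let $K_\nu$ be the completion of an algebraic number field at a place $\nu$, with normalized absolute value $|\cdot|$, self-dual Haar measure $dy$ and Fourier transform $\mathcal{F}\varphi(x)=\int_{K_\nu}\varphi(y)\lambda(-xy)\,dy$. Let $A$ be multiplication by $\log|y|$, $B=\mathcal{F}^{-1}M\mathcal{F}$ with $M$ multiplication by $\log|x|$, and $H=A+B$ the conductor operator, defined on Schwartz–Bruhat functions. Then $H$ is bounded below: there is a real constant $c$ with $\langle H f,f\rangle\ge c\|f\|^2$ for all such $f$, in $L^2(K_\nu,dy)$.
   Context: At a finite place $\lambda(x)=\exp(2\pi i\,\mathrm{Tr}(x))$ (trace to $\mathbb{Q}_p$, $p$-adic fractional part), at an archimedean place $\lambda(x)=\exp(-2\pi i\,\mathrm{Tr}(x))$; $dy$ is self-dual for $\lambda$; for $K_\nu=\mathbb{C}$, $|z|=z\overline z$. *)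

theory Defs
  imports "HOL-Analysis.Analysis" "HOL-Computational_Algebra.Primes"
begin

section \<open>Number fields, places and completions\<close>

definition number_field :: "'k::field_char_0 itself \<Rightarrow> bool" where
  "number_field _ \<longleftrightarrow>
     (\<exists>B. finite_dimensional_vector_space (\<lambda>(r::rat) (x::'k). of_rat r * x) B)"

definition absolute_value :: "('a::field \<Rightarrow> real) \<Rightarrow> bool" where
  "absolute_value v \<longleftrightarrow>
     (\<forall>x. 0 \<le> v x) \<and> (\<forall>x. v x = 0 \<longleftrightarrow> x = 0) \<and>
     (\<forall>x y. v (x * y) = v x * v y) \<and> (\<forall>x y. v (x + y) \<le> v x + v y)"

text \<open>A place is the equivalence class of a nontrivial absolute value \<open>v\<close>; everything defined
  below depends only on this class, not on the chosen representative.\<close>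

definition represents_place :: "('a::field \<Rightarrow> real) \<Rightarrow> bool" where
  "represents_place v \<longleftrightarrow> absolute_value v \<and> (\<exists>x. x \<noteq> 0 \<and> v x \<noteq> 1)"

text \<open>The completion is described by its universal characterization: a complete valued field
  together with a dense embedding that extends \<open>v\<close>. Completeness of the metric is part of the
  class \<open>complete_space\<close>, and \<open>\<lambda>x. dist x 0\<close> is the extension of \<open>v\<close>; it need not be the
  normalized absolute value.\<close>

definition is_completion ::
  "('k::field_char_0 \<Rightarrow> real) \<Rightarrow> ('k \<Rightarrow> 'v::{field_char_0,complete_space}) \<Rightarrow> bool" where
  "is_completion v \<iota> \<longleftrightarrow>
     absolute_value (\<lambda>x::'v. dist x 0) \<and>
     (\<forall>x y::'v. dist x y = dist (x - y) 0) \<and>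
     \<iota> 1 = 1 \<and> (\<forall>a b. \<iota> (a + b) = \<iota> a + \<iota> b) \<and> (\<forall>a b. \<iota> (a * b) = \<iota> a * \<iota> b) \<and>
     (\<forall>a. dist (\<iota> a) 0 = v a) \<and>
     closure (range \<iota>) = UNIV"

definition finite_place :: "'v::{field_char_0,complete_space} itself \<Rightarrow> bool" where
  "finite_place _ \<longleftrightarrow> (\<forall>x y::'v. dist (x + y) 0 \<le> max (dist x 0) (dist y 0))"

definition topological_field_iso ::
  "('a::{field,topological_space} \<Rightarrow> 'b::{field,topological_space}) \<Rightarrow> bool" where
  "topological_field_iso \<phi> \<longleftrightarrow>
     bij \<phi> \<and> (\<forall>x y. \<phi> (x + y) = \<phi> x + \<phi> y) \<and> (\<forall>x y. \<phi> (x * y) = \<phi> x * \<phi> y) \<and>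
     homeomorphism UNIV UNIV \<phi> (inv \<phi>)"

section \<open>The normalized absolute value\<close>

definition residue_card :: "'v::{field_char_0,complete_space} itself \<Rightarrow> nat" where
  "residue_card _ =
     card ({x::'v. dist x 0 \<le> 1} //
           {(x, y). dist x 0 \<le> 1 \<and> dist y 0 \<le> 1 \<and> dist (x - y) 0 < 1})"

definition uniformizer :: "'v::{field_char_0,complete_space} \<Rightarrow> bool" where
  "uniformizer \<pi> \<longleftrightarrow>
     \<pi> \<noteq> 0 \<and> dist \<pi> 0 < 1 \<and> (\<forall>x::'v. dist x 0 < 1 \<longrightarrow> dist x 0 \<le> dist \<pi> 0)"

definition valuation :: "'v::{field_char_0,complete_space} \<Rightarrow> int" where
  "valuation x = (THE n. \<exists>\<pi>::'v. uniformizer \<pi> \<and> dist x 0 = dist \<pi> 0 powi n)"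

text \<open>At an archimedean place the completion is isomorphic to the reals or to the complex numbers,
  never to both; the value does not depend on the isomorphism.\<close>

definition nabs :: "'v::{field_char_0,complete_space} \<Rightarrow> real" where
  "nabs x =
     (if finite_place TYPE('v)
      then (if x = 0 then 0 else real (residue_card TYPE('v)) powi (- valuation x))
      else (THE r. (\<exists>\<phi>::'v \<Rightarrow> real. topological_field_iso \<phi> \<and> r = \<bar>\<phi> x\<bar>) \<or>
                   (\<exists>\<phi>::'v \<Rightarrow> complex. topological_field_iso \<phi> \<and>
                      complex_of_real r = \<phi> x * cnj (\<phi> x))))"

section \<open>The additive character\<close>

definition finite_basis_over :: "'a::field set \<Rightarrow> 'a set \<Rightarrow> bool" where
  "finite_basis_over F B \<longleftrightarrow>
     finite B \<and> (\<forall>x. \<exists>!c. c \<in> B \<rightarrow>\<^sub>E F \<and> x = (\<Sum>b\<in>B. c b * b))"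

definition coords :: "'a::field set \<Rightarrow> 'a set \<Rightarrow> 'a \<Rightarrow> 'a \<Rightarrow> 'a" where
  "coords F B x = (THE c. c \<in> B \<rightarrow>\<^sub>E F \<and> x = (\<Sum>b\<in>B. c b * b))"

text \<open>Trace of the \<open>F\<close>-linear map \<open>y \<mapsto> x * y\<close>, for a subfield \<open>F\<close> of finite index; it does not
  depend on the basis.\<close>

definition field_trace :: "'a::field set \<Rightarrow> 'a \<Rightarrow> 'a" where
  "field_trace F x =
     (let B = (SOME B. finite_basis_over F B) in \<Sum>b\<in>B. coords F B (x * b) b)"

text \<open>The closure of the rationals in the completion is the completion of the rationals at the
  place below: \<open>\<rat>\<^sub>p\<close> at a finite place, the reals at an archimedean one.\<close>

definition base_field :: "'v::{field_char_0,complete_space} set" where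
  "base_field = closure \<rat>"

definition residue_char :: "'v::{field_char_0,complete_space} itself \<Rightarrow> nat" where
  "residue_char _ = (THE p. prime p \<and> dist (of_nat p :: 'v) 0 < 1)"

definition padic_frac :: "'v::{field_char_0,complete_space} \<Rightarrow> rat" where
  "padic_frac x =
     (THE r. 0 \<le> r \<and> r < 1 \<and> (\<exists>n. r * of_nat (residue_char TYPE('v)) ^ n \<in> \<int>) \<and>
             dist (x - of_rat r) 0 \<le> 1)"

text \<open>The real number corresponding to an element of the closure of the rationals at an
  archimedean place.\<close>

definition base_to_real :: "'v::{field_char_0,complete_space} \<Rightarrow> real" where
  "base_to_real x =
     (THE t. \<exists>r::nat \<Rightarrow> rat. (\<lambda>n. of_rat (r n) :: 'v) \<longlonglongrightarrow> x \<and> (\<lambda>n. of_rat (r n) :: real) \<longlonglongrightarrow> t)"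

definition add_char :: "'v::{field_char_0,complete_space} \<Rightarrow> complex" where
  "add_char x =
     (let t = field_trace base_field x in
      if finite_place TYPE('v)
      then exp (2 * complex_of_real pi * \<i> * of_rat (padic_frac t))
      else exp (- 2 * complex_of_real pi * \<i> * complex_of_real (base_to_real t)))"

section \<open>Schwartz--Bruhat functions\<close>

text \<open>\<open>D [h\<^sub>1, \<dots>, h\<^sub>n] x\<close> is the iterated directional derivative of \<open>f\<close> at \<open>x\<close>.\<close>

definition schwartz :: "('a::euclidean_space \<Rightarrow> complex) \<Rightarrow> bool" where
  "schwartz f \<longleftrightarrow>
     (\<exists>D :: 'a list \<Rightarrow> 'a \<Rightarrow> complex.
        D [] = f \<and>
        (\<forall>hs x. (D hs has_derivative (\<lambda>h. D (h # hs) x)) (at x)) \<and>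
        (\<forall>hs k. bounded (range (\<lambda>x. norm x ^ k *\<^sub>R D hs x))))"

definition schwartz_bruhat :: "('v::{field_char_0,complete_space} \<Rightarrow> complex) \<Rightarrow> bool" where
  "schwartz_bruhat f \<longleftrightarrow>
     (if finite_place TYPE('v)
      then (\<forall>x. \<forall>\<^sub>F y in nhds x. f y = f x) \<and> compact (closure {x. f x \<noteq> 0})
      else (\<exists>\<phi>::'v \<Rightarrow> real. topological_field_iso \<phi> \<and> schwartz (f \<circ> inv \<phi>)) \<or>
           (\<exists>\<phi>::'v \<Rightarrow> complex. topological_field_iso \<phi> \<and> schwartz (f \<circ> inv \<phi>)))"

section \<open>Self-dual Haar measure and the Fourier transform\<close>

definition haar_measure :: "'v::{field_char_0,complete_space} measure \<Rightarrow> bool" where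
  "haar_measure \<mu> \<longleftrightarrow>
     sets \<mu> = sets borel \<and> (\<forall>a. distr \<mu> borel (\<lambda>x. a + x) = \<mu>) \<and>
     (\<forall>C. compact C \<longrightarrow> emeasure \<mu> C < \<infinity>) \<and> emeasure \<mu> UNIV \<noteq> 0"

definition fourier ::
  "'v::{field_char_0,complete_space} measure \<Rightarrow> ('v \<Rightarrow> complex) \<Rightarrow> 'v \<Rightarrow> complex" where
  "fourier \<mu> f x = (LINT y|\<mu>. f y * add_char (- (x * y)))"

definition inverse_fourier ::
  "'v::{field_char_0,complete_space} measure \<Rightarrow> ('v \<Rightarrow> complex) \<Rightarrow> 'v \<Rightarrow> complex" where
  "inverse_fourier \<mu> g y = (LINT x|\<mu>. g x * add_char (x * y))"

definition self_dual_haar :: "'v::{field_char_0,complete_space} measure \<Rightarrow> bool" where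
  "self_dual_haar \<mu> \<longleftrightarrow>
     haar_measure \<mu> \<and>
     (\<forall>f. schwartz_bruhat f \<longrightarrow> inverse_fourier \<mu> (fourier \<mu> f) = f)"

section \<open>The conductor operator\<close>

text \<open>The junk value \<open>ln 0 = 0\<close> only matters at the origin, which is a null set.\<close>

definition log_mult ::
  "('v::{field_char_0,complete_space} \<Rightarrow> complex) \<Rightarrow> 'v \<Rightarrow> complex" where
  "log_mult f y = complex_of_real (ln (nabs y)) * f y"

text \<open>For a Schwartz--Bruhat function \<open>f\<close>, \<open>log_mult (fourier \<mu> f)\<close> is integrable as well as square
  integrable, so the inverse Fourier transform is given by the integral.\<close>

definition conductor_op ::
  "'v::{field_char_0,complete_space} measure \<Rightarrow> ('v \<Rightarrow> complex) \<Rightarrow> 'v \<Rightarrow> complex" where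
  "conductor_op \<mu> f y = log_mult f y + inverse_fourier \<mu> (log_mult (fourier \<mu> f)) y"

definition l2_inner :: "'a measure \<Rightarrow> ('a \<Rightarrow> complex) \<Rightarrow> ('a \<Rightarrow> complex) \<Rightarrow> complex" where
  "l2_inner \<mu> f g = (LINT y|\<mu>. f y * cnj (g y))"

definition l2_norm :: "'a measure \<Rightarrow> ('a \<Rightarrow> complex) \<Rightarrow> real" where
  "l2_norm \<mu> f = sqrt (LINT y|\<mu>. (cmod (f y))\<^sup>2)"

end

theory Submission
  imports Defs
begin

text \<open>With \<open>\<phi> = \<F> f\<close> the claim is
  \<open>\<integral> log |y| |f y|\<^sup>2 dy + \<integral> log |x| |\<phi> x|\<^sup>2 dx \<ge> c \<parallel>f\<parallel>\<^sup>2\<close>. Fix \<open>q > 1\<close> with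
  \<open>\<mu> {|x| \<le> q\<^sup>k} \<le> M q\<^sup>k\<close> for all integers \<open>k\<close>, put \<open>t = q\<^sup>k\<close>, and let \<open>m\<^sub>t\<close> be a cutoff
  adapted to \<open>|y| \<le> 1/t\<close> that preserves Schwartz--Bruhat functions: the indicator of a ball at a finite
  place, a Gaussian at an archimedean one. Split \<open>\<phi> = u + v\<close> with \<open>u = \<F> ((1 - m\<^sub>t) f)\<close> and
  \<open>v = \<F> (m\<^sub>t f)\<close>. For \<open>w = (|x|/t)\<^bsup>1/2\<^esup>\<close> one has
  \<open>(1 - w) |\<phi>|\<^sup>2 \<le> |u|\<^sup>2 + |v|\<^sup>2 / w\<close>; integrate this over \<open>|x| \<le> t\<close>, using Plancherel for \<open>u\<close> and
  \<open>|v| \<le> \<integral> m\<^sub>t |f|\<close> with Cauchy--Schwarz for \<open>v\<close>. The result is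
  \<open>\<integral>\<^bsub>|x| \<le> t\<^esub> (1 - w) |\<phi>|\<^sup>2 \<le> \<integral> (1 - m\<^sub>t)\<^sup>2 |f|\<^sup>2 + C \<integral> (t |y|)\<^bsup>1/2\<^esup> m\<^sub>t |f|\<^sup>2\<close>.
  Summing over \<open>-n \<le> k < n\<close>, the left side becomes \<open>\<integral> (n - log\<^sub>q |x|) |\<phi>|\<^sup>2\<close> and the first
  term on the right \<open>\<integral> (n + log\<^sub>q |y|) |f|\<^sup>2\<close>, with the logarithms clipped to \<open>[-n, n]\<close> and up
  to \<open>O(\<parallel>f\<parallel>\<^sup>2)\<close>, while the last term is \<open>O(\<parallel>f\<parallel>\<^sup>2)\<close>; let \<open>n \<rightarrow> \<infinity>\<close>.\<close>

section \<open>A logarithmic uncertainty inequality\<close>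

text \<open>The obstacle is that about \<open>2 * n\<close> scales are added while the final
  constant must not depend on \<open>n\<close>. Losing a fixed fraction of the squared norm of
  \<open>f\<close> at each scale would be fatal, so the crude bound of \<open>|u + v|^2\<close> by
  \<open>2 |u|^2 + 2 |v|^2\<close> is useless: the main terms of size \<open>n\<close> on the two
  sides cancel only if \<open>|u|^2\<close> keeps the coefficient 1. The weight \<open>1 - w\<close>
  achieves this. Its deviation from 1, the deviation of the cutoff from a sharp one, and the
  contribution of \<open>v\<close> all decay geometrically in the logarithmic distance of a point
  from the scale, and such errors have a sum bounded uniformly in \<open>n\<close>. The exponent 1/2
  in \<open>w\<close> is a compromise: \<open>w\<close> must become small inside the ball, while
  \<open>1 / w\<close> must stay integrable at the origin. Of Fourier analysis only the inversion
  formula on Schwartz--Bruhat functions is given. Plancherel, the integrability of transforms and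
  the nontriviality of the character at finite places are all extracted from it.\<close>

text \<open>This bounds the total of the errors independently of the number of scales. Replacing
  \<open>s\<close> by its floor costs one factor \<open>b\<close>; the integers on either side of
  the floor then give one geometric series each.\<close>

lemma sum_powr_abs_diff_le:
  fixes b s :: real
  assumes b: "1 < b" and "finite A"
  shows "(\<Sum>k\<in>A. b powr (- \<bar>s - real_of_int k\<bar>)) \<le> 2 * b / (1 - 1 / b)"
proof -
  define a where "a = 1 / b"
  have a: "0 < a" "a < 1" using b by (auto simp: a_def)
  define i where "i = \<lfloor>s\<rfloor>"
  have geo: "(\<Sum>k\<in>B. a ^ g k) \<le> 1 / (1 - a)"
    if "finite B" "inj_on g B" for B :: "int set" and g :: "int \<Rightarrow> nat"
  proof -
    have "(\<Sum>k\<in>B. a ^ g k) = (\<Sum>j\<in>g ` B. a ^ j)"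
      using that by (simp add: sum.reindex)
    also have "\<dots> \<le> (\<Sum>j. a ^ j)"
      using a that by (intro sum_le_suminf summable_geometric) auto
    finally show ?thesis using a by (simp add: suminf_geometric)
  qed
  have le_pow: "b powr (- \<bar>s - real_of_int k\<bar>) \<le> b * a ^ nat \<bar>i - k\<bar>" for k
  proof -
    have "real_of_int \<bar>i - k\<bar> - 1 \<le> \<bar>s - real_of_int k\<bar>"
      unfolding i_def by linarith
    then have "b powr (- \<bar>s - real_of_int k\<bar>) \<le> b powr (1 - real (nat \<bar>i - k\<bar>))"
      using b by (intro powr_mono) auto
    also have "\<dots> = b * a ^ nat \<bar>i - k\<bar>"
      using b powr_realpow[of b "nat \<bar>i - k\<bar>"]
      by (simp del: of_nat_nat add: powr_diff a_def power_one_over)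
    finally show ?thesis .
  qed
  have "(\<Sum>k\<in>A. b powr (- \<bar>s - real_of_int k\<bar>)) \<le> b * (\<Sum>k\<in>A. a ^ nat \<bar>i - k\<bar>)"
    unfolding sum_distrib_left by (intro sum_mono le_pow)
  also have "(\<Sum>k\<in>A. a ^ nat \<bar>i - k\<bar>) =
      (\<Sum>k\<in>A \<inter> {..i}. a ^ nat \<bar>i - k\<bar>) + (\<Sum>k\<in>A \<inter> - {..i}. a ^ nat \<bar>i - k\<bar>)"
    using sum.Int_Diff[OF \<open>finite A\<close>, of "\<lambda>k. a ^ nat \<bar>i - k\<bar>" "{..i}"]
    by (simp add: Diff_eq)
  also have "\<dots> \<le> 1 / (1 - a) + 1 / (1 - a)"
    using \<open>finite A\<close> by (intro add_mono geo) (auto simp: inj_on_def)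
  finally show ?thesis using b by (simp add: a_def mult.commute)
qed

section \<open>Telescoping of clipped logarithms and pointwise inequalities\<close>

definition clamp01 :: "real \<Rightarrow> real" where "clamp01 d = max 0 (min 1 d)"

definition clip :: "nat \<Rightarrow> real \<Rightarrow> real" where "clip n s = max (- real n) (min (real n) s)"

text \<open>A layer-cake identity: the term for \<open>k\<close> is the length of the part of the
  interval from \<open>k\<close> to \<open>k + 1\<close> that lies below \<open>s\<close>, so the
  terms add up to the distance from \<open>- n\<close> to the clipped point.\<close>

lemma clip_telescope: "(\<Sum>k\<in>{- int n..<int n}. clamp01 (s - real_of_int k)) = real n + clip n s"
proof (induction n)
  case 0 then show ?case by (simp add: clip_def)
next
  case (Suc n)
  have "{- int (Suc n)..<int (Suc n)} = insert (- int n - 1) (insert (int n) {- int n..<int n})"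
    by auto
  then show ?case using Suc by (simp add: clip_def clamp01_def) (simp add: max_def min_def)
qed

text \<open>The same sum under the reflection \<open>- 1 - k\<close> of the index. This form fits
  the side of \<open>f\<close>, where the scale enters as \<open>ell y + k\<close> instead of
  \<open>ell x - k\<close>.\<close>

lemma clip_telescope':
  "(\<Sum>k\<in>{- int n..<int n}. clamp01 (s + real_of_int k + 1)) = real n + clip n s"
proof -
  have "(\<Sum>k\<in>{- int n..<int n}. clamp01 (s + real_of_int k + 1)) =
        (\<Sum>k\<in>{- int n..<int n}. clamp01 (s - real_of_int k))"
    by (rule sum.reindex_bij_witness[of _ "\<lambda>k. - 1 - k" "\<lambda>k. - 1 - k"]) (auto simp: algebra_simps)
  then show ?thesis by (simp add: clip_telescope)
qed

lemma clip_tendsto: "(\<lambda>n. clip n s) \<longlonglongrightarrow> s"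
proof (rule tendsto_eventually)
  obtain n0 :: nat where "\<bar>s\<bar> \<le> real n0" using real_arch_simple by blast
  then show "\<forall>\<^sub>F n in sequentially. clip n s = s"
    by (intro eventually_sequentiallyI[of n0]) (auto simp: clip_def)
qed

lemma abs_clip_le: "\<bar>clip n s\<bar> \<le> \<bar>s\<bar>"
  by (auto simp: clip_def)

text \<open>With \<open>d = ell x - k\<close>, the weight \<open>1 - w\<close> of the one-scale
  inequality is \<open>max 0 (1 - b powr d)\<close>. It falls short of the telescoping weight by at
  most an error summable over the scales.\<close>

lemma one_minus_clamp01_le:
  fixes b :: real assumes "1 < b"
  shows "1 - clamp01 d \<le> max 0 (1 - b powr d) + b * b powr (- \<bar>d\<bar>)"
proof -
  have pos: "0 \<le> b * b powr (- \<bar>d\<bar>)" using assms by simp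
  consider "d \<ge> 1" | "0 < d" "d < 1" | "d \<le> 0" by linarith
  then show ?thesis
  proof cases
    case 1 then show ?thesis using pos by (simp add: clamp01_def)
  next
    case 2
    have "b powr 0 \<le> b powr (1 - d)" using assms 2 by (intro powr_mono) auto
    then have "1 \<le> b * b powr (- d)" using assms by (simp add: powr_diff powr_minus field_simps)
    then show ?thesis using 2 by (simp add: clamp01_def)
  next
    case 3
    have "b powr d \<le> b * b powr d" using assms by simp
    then show ?thesis using 3 by (simp add: clamp01_def)
  qed
qed

text \<open>The counterpart for \<open>f\<close>: with \<open>d = ell y + k\<close> the left side
  will bound \<open>(1 - m k y)^2\<close>, and again the excess over the telescoping weight is
  summable.\<close>

lemma min_powr_le_clamp01:
  fixes b :: real assumes "1 < b"
  shows "min 1 (b powr (2 * d)) \<le> clamp01 (d + 1) + b powr (- \<bar>d\<bar>)"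
proof (cases "d \<ge> 0")
  case True then show ?thesis by (simp add: clamp01_def min_le_iff_disj)
next
  case False
  have "b powr (2 * d) \<le> b powr d" using assms False by (intro powr_mono) auto
  moreover have "0 \<le> clamp01 (d + 1)" by (simp add: clamp01_def)
  ultimately show ?thesis using False by (simp add: min_le_iff_disj)
qed

text \<open>The hypotheses say that \<open>m\<close> is at most 1 and at most
  \<open>b powr (- 2 * d)\<close>; the former is used for \<open>d \<le> 0\<close>, the latter for
  \<open>d > 0\<close>. Hence the weight of the error term is concentrated near the scale.\<close>

lemma powr_mult_cutoff_le:
  fixes b m :: real assumes "1 < b" "0 \<le> m" "m \<le> 1" "m * b powr (2 * d) \<le> 1"
  shows "b powr d * m \<le> b powr (- \<bar>d\<bar>)"
proof (cases "d \<le> 0")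
  case True
  have "b powr d * m \<le> b powr d * 1" using assms by (intro mult_left_mono) auto
  then show ?thesis using True by simp
next
  case False
  have "b powr d * m = b powr (-d) * (m * b powr (2 * d))"
    by (simp add: powr_add[symmetric])
  also have "\<dots> \<le> b powr (-d) * 1" using assms by (intro mult_left_mono) auto
  finally show ?thesis using False by simp
qed

text \<open>Weighted AM-GM for the mixed term produces exactly the factor \<open>1 + w\<close>, and
  \<open>(1 - w) * (1 + w) \<le> 1\<close> absorbs it. For \<open>w > 1\<close> the left side
  vanishes.\<close>

lemma norm_add_sq_weighted:
  fixes u v :: complex and w :: real
  assumes "0 < w"
  shows "max 0 (1 - w) * (cmod (u + v))\<^sup>2 \<le> (cmod u)\<^sup>2 + (cmod v)\<^sup>2 / w"
proof -
  have "(cmod (u + v))\<^sup>2 \<le> (cmod u + cmod v)\<^sup>2"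
    by (intro power_mono norm_triangle_ineq) auto
  also have "\<dots> = (cmod u)\<^sup>2 + (cmod v)\<^sup>2 + 2 * (cmod u * cmod v)"
    by (simp add: power2_sum)
  also have "2 * (cmod u * cmod v) \<le> w * (cmod u)\<^sup>2 + (cmod v)\<^sup>2 / w"
  proof -
    have "0 \<le> (w * cmod u - cmod v)\<^sup>2 / w" using assms by simp
    also have "\<dots> = w * (cmod u)\<^sup>2 + (cmod v)\<^sup>2 / w - 2 * (cmod u * cmod v)"
      using assms by (simp add: field_simps power2_eq_square)
    finally show ?thesis by simp
  qed
  finally have "(cmod (u + v))\<^sup>2 \<le> (1 + w) * ((cmod u)\<^sup>2 + (cmod v)\<^sup>2 / w)"
    using assms by (simp add: field_simps)
  moreover have "max 0 (1 - w) * (1 + w) \<le> 1"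
  proof (cases "w \<le> 1")
    case True
    have "(1 - w) * (1 + w) = 1 - w\<^sup>2" by (simp add: algebra_simps power2_eq_square)
    then show ?thesis using True by simp
  qed simp
  ultimately have "max 0 (1 - w) * (cmod (u + v))\<^sup>2
      \<le> max 0 (1 - w) * ((1 + w) * ((cmod u)\<^sup>2 + (cmod v)\<^sup>2 / w))"
    by (intro mult_left_mono) auto
  also have "\<dots> \<le> 1 * ((cmod u)\<^sup>2 + (cmod v)\<^sup>2 / w)"
    unfolding mult.assoc[symmetric] using assms \<open>max 0 (1 - w) * (1 + w) \<le> 1\<close>
    by (intro mult_right_mono) auto
  finally show ?thesis by simp
qed

section \<open>Fourier transforms with a unimodular symmetric kernel\<close>

lemma borel_measurable_cnj [measurable]:
  "f \<in> borel_measurable M \<Longrightarrow> (\<lambda>x. cnj (f x)) \<in> borel_measurable M"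
  by (rule borel_measurable_continuous_on[OF continuous_on_cnj[OF continuous_on_id]])

text \<open>The modulus is \<open>N\<close> and the base \<open>q\<close> of the scales is \<open>b\<^sup>2\<close>, which keeps square roots of scales
  of the form \<open>b powr d\<close>.\<close>

locale log_fourier =
  fixes \<mu> :: "'a measure" and N :: "'a \<Rightarrow> real" and e :: "'a \<Rightarrow> 'a \<Rightarrow> complex"
    and b M :: real
  assumes space_eq: "space \<mu> = UNIV"
    and N_measurable [measurable]: "N \<in> borel_measurable \<mu>"
    and N_nonneg: "0 \<le> N x"
    and b_gt_1: "1 < b"
    and ball_le: "emeasure \<mu> {x. N x \<le> b powr (2 * real_of_int k)} \<le> ennreal (M * b powr (2 * real_of_int k))"
    and e_measurable [measurable]: "case_prod e \<in> borel_measurable (\<mu> \<Otimes>\<^sub>M \<mu>)"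
    and norm_e: "cmod (e x y) = 1"
    and e_sym: "e x y = e y x"
begin

definition Fo :: "('a \<Rightarrow> complex) \<Rightarrow> 'a \<Rightarrow> complex" where
  "Fo f x = (LINT y|\<mu>. f y * cnj (e x y))"

definition Fi :: "('a \<Rightarrow> complex) \<Rightarrow> 'a \<Rightarrow> complex" where
  "Fi g y = (LINT x|\<mu>. g x * e x y)"

text \<open>Inversion is imposed function by function, because the kernel carries no duality of its
  own; for Schwartz--Bruhat functions \<open>self_dual_haar\<close> provides it. The equation holds
  at every point, which makes such functions bounded.\<close>

definition invertible_fn :: "('a \<Rightarrow> complex) \<Rightarrow> bool" where
  "invertible_fn f \<longleftrightarrow> integrable \<mu> f \<and> Fi (Fo f) = f"

lemma ball_finite: "emeasure \<mu> {x. N x \<le> b powr (2 * real_of_int k)} < \<infinity>"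
  using ball_le[of k] by (rule order.strict_trans1) simp

lemma ball_sets [measurable]: "{x. N x \<le> r} \<in> sets \<mu>"
proof -
  have "{x \<in> space \<mu>. N x \<le> r} \<in> sets \<mu>" by measurable
  then show ?thesis by (simp add: space_eq)
qed

lemma sigma_finite: "sigma_finite_measure \<mu>"
proof
  have "\<exists>i::nat. N x \<le> b powr (2 * real_of_int (int i))" for x
  proof -
    obtain i where "N x < b ^ i" using real_arch_pow[OF b_gt_1] by blast
    moreover have "b ^ i \<le> b powr (2 * real i)"
      using b_gt_1 by (subst powr_realpow[symmetric]) (auto intro: powr_mono)
    ultimately show ?thesis by (intro exI[of _ i]) simp
  qed
  then have "(\<Union>i::nat. {x. N x \<le> b powr (2 * real_of_int (int i))}) = space \<mu>"
    unfolding space_eq by blast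
  moreover have "emeasure \<mu> {x. N x \<le> b powr (2 * real_of_int (int i))} \<noteq> \<infinity>" for i :: nat
    using ball_finite[of "int i"] by (simp only: less_top)
  ultimately show "\<exists>A. countable A \<and> A \<subseteq> sets \<mu> \<and> \<Union> A = space \<mu> \<and> (\<forall>a\<in>A. emeasure \<mu> a \<noteq> \<infinity>)"
    using ball_sets
    by (intro exI[of _ "range (\<lambda>i::nat. {x. N x \<le> b powr (2 * real_of_int (int i))})"]) blast
qed

sublocale sigma_finite_measure \<mu> by (rule sigma_finite)
sublocale pair_sigma_finite \<mu> \<mu> ..

lemma e_measurable1 [measurable]: "(\<lambda>y. e x y) \<in> borel_measurable \<mu>"
  using measurable_compose[OF measurable_Pair1'[of x \<mu> \<mu>] e_measurable] space_eq by simp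

lemma e_measurable2 [measurable]: "(\<lambda>x. e x y) \<in> borel_measurable \<mu>"
  using e_measurable1[of y] by (simp add: e_sym[of _ y])

text \<open>The exceptional set lies in balls of arbitrarily small radius, whose measures tend to 0.
  Almost everywhere the modulus can therefore be written as a power of \<open>b\<close>.\<close>

lemma AE_N_pos: "AE x in \<mu>. 0 < N x"
proof (rule AE_I)
  show "{x \<in> space \<mu>. \<not> 0 < N x} \<subseteq> {x. N x \<le> 0}" by auto
  have "emeasure \<mu> {x. N x \<le> 0} \<le> ennreal (M * b powr (2 * real_of_int (- int n)))" for n
  proof -
    have "emeasure \<mu> {x. N x \<le> 0} \<le> emeasure \<mu> {x. N x \<le> b powr (2 * real_of_int (- int n))}"
    proof (intro emeasure_mono)
      show "{x. N x \<le> 0} \<subseteq> {x. N x \<le> b powr (2 * real_of_int (- int n))}"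
        by (auto intro: order_trans[OF _ powr_ge_zero])
    qed (rule ball_sets)
    then show ?thesis using ball_le order_trans by blast
  qed
  moreover have "(\<lambda>n. ennreal (M * b powr (2 * real_of_int (- int n)))) \<longlonglongrightarrow> ennreal (M * 0)"
  proof (intro tendsto_ennrealI tendsto_mult tendsto_const)
    have "(\<lambda>n. (inverse (b\<^sup>2)) ^ n) \<longlonglongrightarrow> 0"
      using b_gt_1 by (intro LIMSEQ_power_zero) (simp add: inverse_less_1_iff one_less_power)
    moreover have "b powr (2 * real_of_int (- int n)) = (inverse (b\<^sup>2)) ^ n" for n
      using b_gt_1 powr_realpow[of b "2 * n"] by (simp add: powr_minus power_mult power_inverse)
    ultimately show "(\<lambda>n. b powr (2 * real_of_int (- int n))) \<longlonglongrightarrow> 0" by simp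
  qed
  ultimately have "emeasure \<mu> {x. N x \<le> 0} \<le> ennreal (M * 0)"
    by (intro LIMSEQ_le_const) auto
  then show "emeasure \<mu> {x. N x \<le> 0} = 0" by simp
qed (rule ball_sets)

lemma integrable_mult_e:
  "integrable \<mu> (\<lambda>x. g x * e x y) \<longleftrightarrow> integrable \<mu> g"
proof
  assume "integrable \<mu> g"
  then show "integrable \<mu> (\<lambda>x. g x * e x y)"
    by (rule Bochner_Integration.integrable_bound)
       (use \<open>integrable \<mu> g\<close> in \<open>auto simp: norm_mult norm_e\<close>)
next
  assume *: "integrable \<mu> (\<lambda>x. g x * e x y)"
  have "e x y * cnj (e x y) = 1" for x
    using complex_norm_square[of "e x y"] by (simp add: norm_e)
  then have "g = (\<lambda>x. (g x * e x y) * cnj (e x y))" by (simp add: mult.assoc)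
  moreover have "integrable \<mu> (\<lambda>x. (g x * e x y) * cnj (e x y))"
    by (rule Bochner_Integration.integrable_bound[OF *])
       (use * in \<open>auto simp: norm_mult norm_e\<close>)
  ultimately show "integrable \<mu> g" by simp
qed

lemma integrable_mult_cnj_e: "integrable \<mu> f \<Longrightarrow> integrable \<mu> (\<lambda>y. f y * cnj (e x y))"
  by (rule Bochner_Integration.integrable_bound) (auto simp: norm_mult norm_e)

lemma Fo_measurable [measurable]:
  assumes [measurable]: "f \<in> borel_measurable \<mu>"
  shows "Fo f \<in> borel_measurable \<mu>"
  unfolding Fo_def by measurable

lemma Fi_measurable [measurable]:
  assumes [measurable]: "f \<in> borel_measurable \<mu>"
  shows "Fi f \<in> borel_measurable \<mu>"
proof -
  have "Fi f = (\<lambda>y. LINT x|\<mu>. f x * e y x)" by (simp add: Fi_def e_sym[of _ "_ :: 'a"] fun_eq_iff)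
  then show ?thesis by simp
qed

lemma norm_Fo_le: "cmod (Fo f x) \<le> (LINT y|\<mu>. cmod (f y))"
  unfolding Fo_def by (rule order_trans[OF integral_norm_bound]) (simp add: norm_mult norm_e)

lemma norm_Fi_le: "cmod (Fi f x) \<le> (LINT y|\<mu>. cmod (f y))"
  unfolding Fi_def by (rule order_trans[OF integral_norm_bound]) (simp add: norm_mult norm_e)

text \<open>If the transform of \<open>f\<close> were not integrable, the Bochner integrals in \<open>Fi (Fo f)\<close> would all
  take the junk value \<open>0\<close>, so that \<open>f = 0\<close>.\<close>

lemma invertible_fn_integrable_Fo:
  assumes "invertible_fn f"
  shows "integrable \<mu> (Fo f)"
proof (rule ccontr)
  assume "\<not> integrable \<mu> (Fo f)"
  then have "Fi (Fo f) = (\<lambda>y. 0)"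
    unfolding Fi_def by (intro ext not_integrable_integral_eq) (simp add: integrable_mult_e)
  then have "f = (\<lambda>y. 0)" using assms by (simp add: invertible_fn_def)
  then have "Fo f = (\<lambda>y. 0)" by (simp add: Fo_def fun_eq_iff)
  then show False using \<open>\<not> integrable \<mu> (Fo f)\<close> by simp
qed

lemma Fo_diff:
  assumes "integrable \<mu> f" "integrable \<mu> g"
  shows "Fo (\<lambda>x. f x - g x) = (\<lambda>x. Fo f x - Fo g x)"
  unfolding Fo_def
  by (simp add: left_diff_distrib Bochner_Integration.integral_diff integrable_mult_cnj_e assms)

lemma invertible_fn_diff:
  assumes "invertible_fn f" "invertible_fn g"
  shows "invertible_fn (\<lambda>x. f x - g x)"
proof -
  have "Fi (\<lambda>x. Fo f x - Fo g x) y = Fi (Fo f) y - Fi (Fo g) y" for y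
    unfolding Fi_def
    by (simp add: left_diff_distrib Bochner_Integration.integral_diff integrable_mult_e
        invertible_fn_integrable_Fo assms)
  moreover have "integrable \<mu> f" "integrable \<mu> g" "Fi (Fo f) = f" "Fi (Fo g) = g"
    using assms by (auto simp: invertible_fn_def)
  ultimately show ?thesis
    by (auto simp: invertible_fn_def Fo_diff)
qed

lemma invertible_fn_bounded:
  assumes "invertible_fn f"
  shows "cmod (f y) \<le> (LINT x|\<mu>. cmod (Fo f x))"
proof -
  have "f y = Fi (Fo f) y" using assms by (simp add: invertible_fn_def)
  then show ?thesis using norm_Fi_le by metis
qed

lemma integrable_mult_bounded:
  fixes f g :: "'a \<Rightarrow> complex"
  assumes "integrable \<mu> f" "g \<in> borel_measurable \<mu>" "\<And>x. cmod (g x) \<le> K"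
  shows "integrable \<mu> (\<lambda>x. f x * g x)"
proof (rule Bochner_Integration.integrable_bound)
  show "integrable \<mu> (\<lambda>x. K * cmod (f x))" using assms by auto
  show "AE x in \<mu>. cmod (f x * g x) \<le> norm (K * cmod (f x))"
  proof (rule AE_I2)
    fix x
    have "cmod (f x) * cmod (g x) \<le> cmod (f x) * \<bar>K\<bar>"
      using assms(3)[of x] by (intro mult_left_mono) auto
    then show "cmod (f x * g x) \<le> norm (K * cmod (f x))"
      by (simp add: norm_mult abs_mult mult.commute)
  qed
qed (use assms in auto)

text \<open>Fubini, since the product of \<open>|h|\<close> and \<open>|f|\<close> is integrable on
  the product space. Keeping \<open>h\<close> independent of \<open>f\<close> lets the identity
  serve twice: \<open>h = Fo f\<close> gives Plancherel, and \<open>h\<close> equal to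
  \<open>ln N\<close> times \<open>Fo f\<close> moves the operator \<open>B\<close> to the Fourier
  side.\<close>

lemma parseval:
  assumes f: "integrable \<mu> f" and h: "integrable \<mu> h"
  shows "(LINT y|\<mu>. Fi h y * cnj (f y)) = (LINT x|\<mu>. h x * cnj (Fo f x))"
proof -
  have [measurable]: "f \<in> borel_measurable \<mu>" "h \<in> borel_measurable \<mu>" using f h by auto
  have int: "integrable (\<mu> \<Otimes>\<^sub>M \<mu>) (\<lambda>(x, y). h x * e x y * cnj (f y))"
  proof (rule Fubini_integrable)
    show "(\<lambda>(x, y). h x * e x y * cnj (f y)) \<in> borel_measurable (\<mu> \<Otimes>\<^sub>M \<mu>)" by measurable
    have "integrable \<mu> (\<lambda>x. cmod (h x) * (LINT y|\<mu>. cmod (f y)))" using h by auto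
    then show "integrable \<mu> (\<lambda>x. LINT y|\<mu>. cmod (case (x, y) of (x, y) \<Rightarrow> h x * e x y * cnj (f y)))"
      by (simp add: norm_mult norm_e)
    show "AE x in \<mu>. integrable \<mu> (\<lambda>y. case (x, y) of (x, y) \<Rightarrow> h x * e x y * cnj (f y))"
    proof (rule AE_I2)
      fix x
      show "integrable \<mu> (\<lambda>y. case (x, y) of (x, y) \<Rightarrow> h x * e x y * cnj (f y))"
        by (rule Bochner_Integration.integrable_bound[of _ "\<lambda>y. cmod (h x) * cmod (f y)"])
           (use f in \<open>auto simp: norm_mult norm_e\<close>)
    qed
  qed
  have "(LINT y|\<mu>. Fi h y * cnj (f y)) = (LINT y|\<mu>. (LINT x|\<mu>. h x * e x y * cnj (f y)))"
    unfolding Fi_def by simp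
  also have "\<dots> = (LINT x|\<mu>. (LINT y|\<mu>. h x * e x y * cnj (f y)))"
    using Fubini_integral[OF int] by simp
  also have "\<dots> = (LINT x|\<mu>. h x * cnj (Fo f x))"
  proof (rule Bochner_Integration.integral_cong)
    fix x
    have "(LINT y|\<mu>. h x * e x y * cnj (f y)) = h x * (LINT y|\<mu>. cnj (f y * cnj (e x y)))"
      unfolding integral_mult_right_zero[symmetric] by (simp add: ac_simps)
    also have "(LINT y|\<mu>. cnj (f y * cnj (e x y))) = cnj (Fo f x)"
      unfolding Fo_def by (rule Bochner_Integration.integral_cnj)
    finally show "(LINT y|\<mu>. h x * e x y * cnj (f y)) = h x * cnj (Fo f x)" .
  qed simp
  finally show ?thesis .
qed

lemma complex_of_real_norm_sq: "complex_of_real ((cmod z)\<^sup>2) = z * cnj z"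
  by (simp only: complex_norm_square)

lemma plancherel:
  assumes "invertible_fn f"
  shows "(LINT x|\<mu>. (cmod (Fo f x))\<^sup>2) = (LINT y|\<mu>. (cmod (f y))\<^sup>2)"
proof -
  have "(LINT x|\<mu>. Fo f x * cnj (Fo f x)) = (LINT y|\<mu>. Fi (Fo f) y * cnj (f y))"
    using assms by (intro parseval[symmetric] invertible_fn_integrable_Fo)
                   (auto simp: invertible_fn_def)
  also have "\<dots> = (LINT y|\<mu>. f y * cnj (f y))" using assms by (simp add: invertible_fn_def)
  finally have "complex_of_real (LINT x|\<mu>. (cmod (Fo f x))\<^sup>2) = complex_of_real (LINT y|\<mu>. (cmod (f y))\<^sup>2)"
    by (simp add: integral_complex_of_real[symmetric] complex_of_real_norm_sq del: of_real_power)
  then show ?thesis by (simp only: of_real_eq_iff)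
qed

lemma integrable_norm_sq:
  assumes "integrable \<mu> f" "\<And>x. cmod (f x) \<le> K"
  shows "integrable \<mu> (\<lambda>x. (cmod (f x))\<^sup>2)"
proof -
  have "integrable \<mu> (\<lambda>x. f x * cnj (f x))"
    by (rule integrable_mult_bounded[of _ _ K]) (use assms in auto)
  then have "integrable \<mu> (\<lambda>x. complex_of_real ((cmod (f x))\<^sup>2))"
    by (simp add: complex_of_real_norm_sq del: of_real_power)
  then show ?thesis by (simp only: complex_of_real_integrable_eq)
qed

end

section \<open>Cauchy--Schwarz and an integrable weight\<close>

text \<open>Cauchy--Schwarz can thus be obtained by integrating a pointwise AM-GM inequality with a
  free parameter \<open>l\<close> and optimizing afterwards.\<close>

lemma square_le_mult_from_AM_GM:
  fixes A P Q :: real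
  assumes "0 \<le> A" "0 \<le> P" "0 \<le> Q" and le: "\<And>l. 0 < l \<Longrightarrow> 2 * A \<le> l * P + Q / l"
  shows "A\<^sup>2 \<le> P * Q"
proof (cases "A = 0 \<or> P = 0")
  case True
  moreover have False if "P = 0" "A \<noteq> 0"
  proof -
    have "A > 0" using assms that by simp
    \<comment> \<open>For \<open>P = 0\<close> the parameter may grow freely; this value already
      makes \<open>Q / l\<close> at most \<open>A\<close>.\<close>
    have "2 * A \<le> Q / (Q / A + 1)"
      using le[of "Q / A + 1"] \<open>A > 0\<close> \<open>0 \<le> Q\<close> that by (simp add: add_nonneg_pos)
    also have "\<dots> \<le> A"
    proof -
      have "0 < Q / A + 1" using \<open>A > 0\<close> \<open>0 \<le> Q\<close> by (simp add: add_nonneg_pos)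
      then show ?thesis using \<open>A > 0\<close> by (simp add: divide_le_eq ring_distribs)
    qed
    finally show False using \<open>A > 0\<close> by simp
  qed
  ultimately have "A = 0" by blast
  then show ?thesis using assms by simp
next
  case False
  then have "A > 0" "P > 0" using assms by auto
  \<comment> \<open>The value \<open>l = A / P\<close> turns the first summand into
    \<open>A\<close>.\<close>
  have "2 * A \<le> A + Q * P / A" using le[of "A / P"] \<open>A > 0\<close> \<open>P > 0\<close> by simp
  then have "A \<le> Q * P / A" by simp
  then have "A * A \<le> Q * P" using \<open>A > 0\<close> by (simp only: pos_le_divide_eq)
  then show ?thesis by (simp add: power2_eq_square mult.commute)
qed

context log_fourier
begin

text \<open>The logarithm of the modulus to the base \<open>q = b^2\<close>; thus
  \<open>b powr ell x\<close> is the square root of the modulus wherever the latter is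
  positive.\<close>

definition ell :: "'a \<Rightarrow> real" where "ell x = ln (N x) / (2 * ln b)"

text \<open>If \<open>r = b powr (2 * d)\<close>, then \<open>V d\<close> is the minimum of \<open>r powr (-1/2)\<close> and \<open>r powr (-3/2)\<close>, a
  function of the modulus that is integrable both near the origin and near infinity.\<close>

definition V :: "real \<Rightarrow> real" where "V d = min (b powr (- d)) (b powr (- (3 * d)))"

text \<open>The value of the geometric series of ratio \<open>1 / b\<close> in
  \<open>nn_integral_V\<close>: the summand \<open>b\<close> stems from the shells inside the scale,
  \<open>b^2\<close> from those outside. The maximum with 0 is taken because \<open>M\<close>
  carries no sign hypothesis.\<close>

definition C_V :: real where "C_V = max 0 M * (b + b\<^sup>2) / (1 - 1 / b)"

lemma C_V_nonneg: "0 \<le> C_V"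
  unfolding C_V_def using b_gt_1 by (intro divide_nonneg_pos mult_nonneg_nonneg) auto

lemma ell_measurable [measurable]: "ell \<in> borel_measurable \<mu>"
  unfolding ell_def by measurable

lemma V_measurable [measurable]: "V \<in> borel_measurable borel"
  unfolding V_def by measurable

lemma V_nonneg: "0 \<le> V d" by (simp add: V_def)

lemma N_eq: "0 < N x \<Longrightarrow> N x = b powr (2 * ell x)"
  using b_gt_1 by (simp add: ell_def powr_def)

lemma ball_le': "emeasure \<mu> {x. N x \<le> b powr (2 * real_of_int k)} \<le> ennreal (max 0 M * b powr (2 * real_of_int k))"
  by (rule order_trans[OF ball_le]) (auto intro!: ennreal_leI mult_right_mono)

text \<open>A single term of the series suffices, namely that of the unit interval containing the
  absolute value of \<open>ell x + k\<close>. The indicators are those of whole balls, not of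
  shells, because only measures of balls are controlled.\<close>

lemma V_le_shells:
  fixes k :: int
  assumes "0 < N x"
  shows "ennreal (V (ell x + k)) \<le> (\<Sum>j. ennreal (b powr (real j + 1)) * indicator {x. N x \<le> b powr (2 * real_of_int (- int j - k))} x
     + ennreal (b powr (- 3 * real j)) * indicator {x. N x \<le> b powr (2 * real_of_int (int j + 1 - k))} x)"
    (is "_ \<le> (\<Sum>j. ?t j)")
proof -
  let ?d = "ell x + k"
  have "\<exists>j. ennreal (V ?d) \<le> ?t j"
  proof (cases "?d \<le> 0")
    case True
    define j where "j = nat \<lfloor>- ?d\<rfloor>"
    have j: "real j \<le> - ?d" "- ?d < real j + 1" using True unfolding j_def by linarith+
    have "V ?d \<le> b powr (real j + 1)"
      unfolding V_def using b_gt_1 j by (intro min.coboundedI1 powr_mono) auto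
    moreover have "N x \<le> b powr (2 * real_of_int (- int j - k))"
      unfolding N_eq[OF assms] using b_gt_1 j by (intro powr_mono) auto
    ultimately show ?thesis by (intro exI[of _ j]) (auto intro!: add_increasing2 ennreal_leI)
  next
    case False
    define j where "j = nat (\<lceil>?d\<rceil> - 1)"
    have j: "real j < ?d" "?d \<le> real j + 1" using False unfolding j_def by linarith+
    have "V ?d \<le> b powr (- 3 * real j)"
      unfolding V_def using b_gt_1 j by (intro min.coboundedI2 powr_mono) auto
    moreover have "N x \<le> b powr (2 * real_of_int (int j + 1 - k))"
      unfolding N_eq[OF assms] using b_gt_1 j by (intro powr_mono) auto
    ultimately show ?thesis by (intro exI[of _ j]) (auto intro!: add_increasing ennreal_leI)
  qed
  then obtain j where "ennreal (V ?d) \<le> ?t j" ..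
  also have "?t j \<le> (\<Sum>j. ?t j)"
    using sum_le_suminf[of ?t "{j}"] by simp
  finally show ?thesis .
qed

text \<open>The measure of balls grows like the modulus, and the exponents -1/2 and -3/2 of
  \<open>V\<close> lie on the two sides of -1, so the inner and the outer shells both give a series
  of ratio \<open>1 / b\<close>. Shifting \<open>ell\<close> by \<open>k\<close> rescales all balls
  by \<open>b powr (- 2 * k)\<close>.\<close>

lemma nn_integral_V:
  fixes k :: int
  shows "(\<integral>\<^sup>+x. ennreal (V (ell x + k)) \<partial>\<mu>) \<le> ennreal (C_V * b powr (- 2 * real_of_int k))"
proof -
  let ?A = "\<lambda>j::nat. {x. N x \<le> b powr (2 * real_of_int (- int j - k))}"
  let ?B = "\<lambda>j::nat. {x. N x \<le> b powr (2 * real_of_int (int j + 1 - k))}"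
  let ?c = "\<lambda>j::nat. max 0 M * b powr (- 2 * real_of_int k) * (b + b\<^sup>2) * (1 / b) ^ j"
  have "(\<integral>\<^sup>+x. ennreal (V (ell x + k)) \<partial>\<mu>) \<le> (\<integral>\<^sup>+x. (\<Sum>j. ennreal (b powr (real j + 1)) * indicator (?A j) x
     + ennreal (b powr (- 3 * real j)) * indicator (?B j) x) \<partial>\<mu>)"
    by (intro nn_integral_mono_AE eventually_mono[OF AE_N_pos] V_le_shells)
  also have "\<dots> = (\<Sum>j. (\<integral>\<^sup>+x. ennreal (b powr (real j + 1)) * indicator (?A j) x
     + ennreal (b powr (- 3 * real j)) * indicator (?B j) x \<partial>\<mu>))"
    by (rule nn_integral_suminf) measurable
  also have "\<dots> = (\<Sum>j. ennreal (b powr (real j + 1)) * emeasure \<mu> (?A j) + ennreal (b powr (- 3 * real j)) * emeasure \<mu> (?B j))"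
    by (subst nn_integral_add) (auto simp: nn_integral_cmult_indicator)
  also have "\<dots> \<le> (\<Sum>j. ennreal (?c j))"
  proof (intro suminf_le summableI)
    fix j :: nat
    have powj: "b powr (- real j) = (1 / b) ^ j"
      using b_gt_1 by (simp add: powr_minus powr_realpow power_one_over inverse_eq_divide)
    have b2: "b powr 2 = b\<^sup>2" using b_gt_1 powr_realpow[of b 2] by simp
    have "ennreal (b powr (real j + 1)) * emeasure \<mu> (?A j) \<le>
        ennreal (b powr (real j + 1)) * ennreal (max 0 M * b powr (2 * real_of_int (- int j - k)))"
      by (intro mult_left_mono ball_le') auto
    also have "\<dots> = ennreal (b powr (real j + 1) * (max 0 M * b powr (2 * real_of_int (- int j - k))))"
      by (simp add: ennreal_mult)
    also have "b powr (real j + 1) * (max 0 M * b powr (2 * real_of_int (- int j - k))) =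
        max 0 M * (b powr (real j + 1) * b powr (2 * real_of_int (- int j - k)))" by simp
    also have "b powr (real j + 1) * b powr (2 * real_of_int (- int j - k)) = b powr (- 2 * real_of_int k) * b powr 1 * b powr (- real j)"
      unfolding powr_add[symmetric] by (rule arg_cong[of _ _ "\<lambda>z. b powr z"]) simp
    finally have 1: "ennreal (b powr (real j + 1)) * emeasure \<mu> (?A j) \<le>
       ennreal (max 0 M * (b powr (- 2 * real_of_int k) * b powr 1 * b powr (- real j)))" .
    have "ennreal (b powr (- 3 * real j)) * emeasure \<mu> (?B j) \<le>
        ennreal (b powr (- 3 * real j)) * ennreal (max 0 M * b powr (2 * real_of_int (int j + 1 - k)))"
      by (intro mult_left_mono ball_le') auto
    also have "\<dots> = ennreal (b powr (- 3 * real j) * (max 0 M * b powr (2 * real_of_int (int j + 1 - k))))"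
      by (simp add: ennreal_mult)
    also have "b powr (- 3 * real j) * (max 0 M * b powr (2 * real_of_int (int j + 1 - k))) =
        max 0 M * (b powr (- 3 * real j) * b powr (2 * real_of_int (int j + 1 - k)))" by simp
    also have "b powr (- 3 * real j) * b powr (2 * real_of_int (int j + 1 - k)) = b powr (- 2 * real_of_int k) * b powr 2 * b powr (- real j)"
      unfolding powr_add[symmetric] by (rule arg_cong[of _ _ "\<lambda>z. b powr z"]) simp
    finally have 2: "ennreal (b powr (- 3 * real j)) * emeasure \<mu> (?B j) \<le>
       ennreal (max 0 M * (b powr (- 2 * real_of_int k) * b powr 2 * b powr (- real j)))" .
    have "ennreal (b powr (real j + 1)) * emeasure \<mu> (?A j) + ennreal (b powr (- 3 * real j)) * emeasure \<mu> (?B j)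
      \<le> ennreal (max 0 M * (b powr (- 2 * real_of_int k) * b powr 1 * b powr (- real j))) +
        ennreal (max 0 M * (b powr (- 2 * real_of_int k) * b powr 2 * b powr (- real j)))"
      by (rule add_mono[OF 1 2])
    also have "\<dots> = ennreal (max 0 M * (b powr (- 2 * real_of_int k) * b powr 1 * b powr (- real j)) +
        max 0 M * (b powr (- 2 * real_of_int k) * b powr 2 * b powr (- real j)))"
      by (intro ennreal_plus[symmetric]) auto
    also have "\<dots> = ennreal (?c j)"
      unfolding powj b2 using b_gt_1 by (simp add: algebra_simps)
    finally show "ennreal (b powr (real j + 1)) * emeasure \<mu> (?A j) + ennreal (b powr (- 3 * real j)) * emeasure \<mu> (?B j) \<le> ennreal (?c j)" .
  qed
  also have "\<dots> = ennreal (\<Sum>j. ?c j)"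
    using b_gt_1 by (intro suminf_ennreal2 summable_mult summable_geometric) auto
  also have "(\<Sum>j. ?c j) = C_V * b powr (- 2 * real_of_int k)"
    using b_gt_1 by (subst suminf_mult) (auto simp: summable_geometric suminf_geometric C_V_def)
  finally show ?thesis .
qed

lemma integrable_V: "integrable \<mu> (\<lambda>x. V (ell x + real_of_int k))"
  by (rule integrableI_nonneg) (use nn_integral_V[of k] in \<open>auto simp: V_nonneg order.strict_trans1\<close>)

lemma integral_V: "(LINT x|\<mu>. V (ell x + real_of_int k)) \<le> C_V * b powr (- 2 * real_of_int k)"
proof -
  have "ennreal (LINT x|\<mu>. V (ell x + real_of_int k)) = (\<integral>\<^sup>+x. ennreal (V (ell x + k)) \<partial>\<mu>)"
    by (intro nn_integral_eq_integral[symmetric] integrable_V) (auto simp: V_nonneg)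
  then show ?thesis using nn_integral_V[of k] C_V_nonneg
    by (metis ennreal_le_iff mult_nonneg_nonneg powr_ge_zero)
qed

section \<open>The inequality at one scale and its sum over the scales\<close>

text \<open>Here \<open>t = b powr (2 * k)\<close> and \<open>w = b powr (ell x - k)\<close>. The
  weight \<open>V\<close> is integrated twice, over \<open>x\<close> at scale \<open>t\<close> and
  over \<open>y\<close> at scale \<open>1 / t\<close>; the resulting factors
  \<open>b powr (2 * k)\<close> and \<open>b powr (- 2 * k)\<close> cancel, which is why the
  constant \<open>C_V^2\<close> is the same for all \<open>k\<close>.\<close>

lemma cutoff_step:
  fixes k :: int and m :: "'a \<Rightarrow> real"
  assumes f: "invertible_fn f" and mf: "invertible_fn (\<lambda>y. complex_of_real (m y) * f y)"
    and m_meas [measurable]: "m \<in> borel_measurable \<mu>"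
    and m: "\<And>y. 0 \<le> m y" "\<And>y. m y \<le> 1" "\<And>y. m y * (b powr (2 * real_of_int k) * N y) \<le> 1"
  shows "(LINT x|\<mu>. max 0 (1 - b powr (ell x - real_of_int k)) * (cmod (Fo f x))\<^sup>2)
    \<le> (LINT y|\<mu>. (1 - m y)\<^sup>2 * (cmod (f y))\<^sup>2) + C_V\<^sup>2 * (LINT y|\<mu>. (b powr (ell y + k) * m y) * (cmod (f y))\<^sup>2)"
proof -
  let ?g = "\<lambda>y. complex_of_real (m y) * f y"
  define u where "u = Fo (\<lambda>y. f y - ?g y)"
  define v where "v = Fo ?g"
  define A where "A = (LINT y|\<mu>. cmod (?g y))"
  define P where "P = (LINT y|\<mu>. (b powr (ell y + k) * m y) * (cmod (f y))\<^sup>2)"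
  define Q where "Q = (LINT y|\<mu>. V (ell y + k))"
  have fi: "integrable \<mu> f" and gi: "integrable \<mu> ?g" using f mf by (auto simp: invertible_fn_def)
  have [measurable]: "f \<in> borel_measurable \<mu>" using fi by simp
  have inv_diff: "invertible_fn (\<lambda>y. f y - ?g y)" by (rule invertible_fn_diff[OF f mf])
  have split: "Fo f x = u x + v x" for x by (simp add: u_def v_def Fo_diff[OF fi gi])
  have [measurable]: "u \<in> borel_measurable \<mu>" "v \<in> borel_measurable \<mu>"
    unfolding u_def v_def by measurable
  have vA: "cmod (v x) \<le> A" for x unfolding v_def A_def by (rule norm_Fo_le)
  have f2: "integrable \<mu> (\<lambda>x. (cmod (f x))\<^sup>2)"
    by (rule integrable_norm_sq[OF fi invertible_fn_bounded[OF f]])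
  have u2: "integrable \<mu> (\<lambda>x. (cmod (u x))\<^sup>2)"
    unfolding u_def by (rule integrable_norm_sq[OF invertible_fn_integrable_Fo[OF inv_diff] norm_Fo_le])
  have phi2: "integrable \<mu> (\<lambda>x. (cmod (Fo f x))\<^sup>2)"
    by (rule integrable_norm_sq[OF invertible_fn_integrable_Fo[OF f] norm_Fo_le])
  have Vk: "integrable \<mu> (\<lambda>x. V (ell x - real_of_int k))"
    using integrable_V[of "- k"] by simp
  have "(LINT x|\<mu>. max 0 (1 - b powr (ell x - real_of_int k)) * (cmod (Fo f x))\<^sup>2)
     \<le> (LINT x|\<mu>. (cmod (u x))\<^sup>2 + A\<^sup>2 * V (ell x - k))"
  proof (rule integral_mono)
    show "integrable \<mu> (\<lambda>x. max 0 (1 - b powr (ell x - real_of_int k)) * (cmod (Fo f x))\<^sup>2)"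
      by (rule Bochner_Integration.integrable_bound[OF phi2])
         (auto simp: abs_mult intro!: mult_left_le_one_le)
    show "integrable \<mu> (\<lambda>x. (cmod (u x))\<^sup>2 + A\<^sup>2 * V (ell x - k))" using u2 Vk by auto
    fix x
    let ?w = "b powr (ell x - real_of_int k)"
    \<comment> \<open>Inside the ball \<open>V\<close> is exactly \<open>1 / w\<close>. Outside it
      the left side is zero, and \<open>V\<close> is nonnegative.\<close>
    have "max 0 (1 - ?w) * (cmod (Fo f x))\<^sup>2 \<le> (cmod (u x))\<^sup>2 + (cmod (v x))\<^sup>2 * V (ell x - k)"
    proof (cases "ell x - k \<le> 0")
      case True
      have "b powr (- (ell x - k)) \<le> b powr (- (3 * (ell x - k)))"
        using True b_gt_1 by (intro powr_mono) auto
      then have "V (ell x - k) = 1 / ?w"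
        by (simp add: V_def min_def powr_minus_divide[symmetric])
      then show ?thesis using norm_add_sq_weighted[of ?w "u x" "v x"] b_gt_1 by (simp add: split)
    next
      case False
      then have "b powr 0 \<le> ?w" using b_gt_1 by (intro powr_mono) auto
      then have "max 0 (1 - ?w) = 0" using b_gt_1 by simp
      then show ?thesis by (simp add: V_nonneg)
    qed
    also have "\<dots> \<le> (cmod (u x))\<^sup>2 + A\<^sup>2 * V (ell x - k)"
      using vA by (intro add_mono mult_right_mono power_mono V_nonneg) auto
    finally show "max 0 (1 - ?w) * (cmod (Fo f x))\<^sup>2 \<le> (cmod (u x))\<^sup>2 + A\<^sup>2 * V (ell x - k)" .
  qed
  also have "\<dots> = (LINT x|\<mu>. (cmod (u x))\<^sup>2) + A\<^sup>2 * (LINT x|\<mu>. V (ell x - k))"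
    using u2 Vk by simp
  also have "(LINT x|\<mu>. (cmod (u x))\<^sup>2) = (LINT y|\<mu>. (1 - m y)\<^sup>2 * (cmod (f y))\<^sup>2)"
  proof -
    have "cmod (f y - ?g y) = \<bar>1 - m y\<bar> * cmod (f y)" for y
    proof -
      have "f y - ?g y = complex_of_real (1 - m y) * f y" by (simp add: algebra_simps)
      then show ?thesis by (simp only: norm_mult norm_of_real)
    qed
    then have "(LINT y|\<mu>. (cmod (f y - ?g y))\<^sup>2) = (LINT y|\<mu>. (1 - m y)\<^sup>2 * (cmod (f y))\<^sup>2)"
      by (simp add: power_mult_distrib)
    then show ?thesis unfolding u_def plancherel[OF inv_diff] .
  qed
  also have "A\<^sup>2 * (LINT x|\<mu>. V (ell x - k)) \<le> C_V\<^sup>2 * P"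
  proof -
    have "A\<^sup>2 \<le> P * Q"
    proof (rule square_le_mult_from_AM_GM)
      show "0 \<le> A" unfolding A_def by simp
      show "0 \<le> P" unfolding P_def using m by (intro integral_nonneg_AE) auto
      show "0 \<le> Q" unfolding Q_def by (intro integral_nonneg_AE) (auto simp: V_nonneg)
      fix l :: real assume l: "0 < l"
      let ?p = "\<lambda>y. (b powr (ell y + k) * m y) * (cmod (f y))\<^sup>2"
      have cut: "AE y in \<mu>. m y * b powr (2 * (ell y + k)) \<le> 1"
        using AE_N_pos
      proof eventually_elim
        case (elim y)
        have "b powr (2 * (ell y + k)) = b powr (2 * real_of_int k) * N y"
          using N_eq[OF elim] by (simp add: powr_add[symmetric] algebra_simps)
        then show ?case using m(3)[of y] by simp
      qed
      have pi: "integrable \<mu> ?p"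
      proof (rule Bochner_Integration.integrable_bound[OF f2])
        show "AE y in \<mu>. norm (?p y) \<le> norm ((cmod (f y))\<^sup>2)"
          using cut
        proof eventually_elim
          case (elim y)
          have "b powr (ell y + k) * m y \<le> b powr (- \<bar>ell y + k\<bar>)"
            using b_gt_1 m elim by (intro powr_mult_cutoff_le) auto
          also have "\<dots> \<le> b powr 0" using b_gt_1 by (intro powr_mono) auto
          finally show ?case using m b_gt_1
            by (simp add: abs_mult mult_left_le_one_le)
        qed
      qed measurable
      have "2 * A = (LINT y|\<mu>. 2 * cmod (?g y))" by (simp add: A_def)
      also have "\<dots> \<le> (LINT y|\<mu>. l * ?p y + V (ell y + k) / l)"
      proof (rule integral_mono_AE)
        show "integrable \<mu> (\<lambda>y. 2 * cmod (?g y))" using gi by auto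
        show "integrable \<mu> (\<lambda>y. l * ?p y + V (ell y + k) / l)" using pi integrable_V[of k] by auto
        show "AE y in \<mu>. 2 * cmod (?g y) \<le> l * ?p y + V (ell y + k) / l"
          using cut
        proof eventually_elim
          case (elim y)
          let ?B = "b powr (ell y + k)"
          have B: "0 < ?B" using b_gt_1 by simp
          \<comment> \<open>Since \<open>?B\<close> is the square root of \<open>t * N y\<close>,
            the bounds 1 and \<open>1 / (t * N y)\<close> for \<open>m y\<close> give the two
            branches of \<open>V\<close> after division by \<open>?B\<close>.\<close>
          have "m y / ?B \<le> V (ell y + k)"
          proof -
            have "m y / ?B \<le> b powr (- (ell y + k))"
              unfolding powr_minus_divide using m(2)[of y] B by (intro divide_right_mono) auto
            moreover have "m y / ?B = (m y * b powr (2 * (ell y + k))) * b powr (- (3 * (ell y + k)))"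
            proof -
              have "b powr (2 * (ell y + k)) * b powr (- (3 * (ell y + k))) = b powr (- (ell y + k))"
                by (simp add: powr_add[symmetric])
              then have "(m y * b powr (2 * (ell y + k))) * b powr (- (3 * (ell y + k))) = m y * b powr (- (ell y + k))"
                by (simp only: mult.assoc)
              then show ?thesis unfolding powr_minus_divide[of b "ell y + k"] by simp
            qed
            moreover have "\<dots> \<le> 1 * b powr (- (3 * (ell y + k)))"
              using elim by (intro mult_right_mono) auto
            ultimately show ?thesis by (simp add: V_def)
          qed
          then have V': "m y / ?B / l \<le> V (ell y + k) / l" using l by (intro divide_right_mono) auto
          \<comment> \<open>Weighted AM-GM as a completed square. Its integral is the one-parameter
            family of bounds from which Cauchy--Schwarz is recovered.\<close>
          have "0 \<le> m y * (l * ?B * cmod (f y) - 1)\<^sup>2 / (l * ?B)" using m l B by simp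
          also have "\<dots> = l * ?p y + m y / ?B / l - 2 * (m y * cmod (f y))"
            using l B by (simp add: field_simps power2_eq_square)
          finally show ?case using V' m by (simp add: norm_mult)
        qed
      qed
      also have "\<dots> = l * P + Q / l" using pi integrable_V[of k] by (simp add: P_def Q_def)
      finally show "2 * A \<le> l * P + Q / l" .
    qed
    moreover have "0 \<le> P" unfolding P_def using m by (intro integral_nonneg_AE) auto
    moreover have "Q \<le> C_V * b powr (- 2 * real_of_int k)" unfolding Q_def by (rule integral_V)
    ultimately have "A\<^sup>2 \<le> P * (C_V * b powr (- 2 * real_of_int k))"
      by (meson mult_left_mono order_trans)
    moreover have "(LINT x|\<mu>. V (ell x - k)) \<le> C_V * b powr (2 * real_of_int k)"
      using integral_V[of "- k"] by simp
    ultimately have "A\<^sup>2 * (LINT x|\<mu>. V (ell x - k))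
        \<le> (P * (C_V * b powr (- 2 * real_of_int k))) * (C_V * b powr (2 * real_of_int k))"
      using C_V_nonneg \<open>0 \<le> P\<close> by (intro mult_mono) (auto intro!: integral_nonneg_AE simp: V_nonneg)
    also have "\<dots> = C_V\<^sup>2 * P * (b powr (- 2 * real_of_int k) * b powr (2 * real_of_int k))"
      by (simp add: power2_eq_square)
    also have "b powr (- 2 * real_of_int k) * b powr (2 * real_of_int k) = 1"
      unfolding powr_add[symmetric] using b_gt_1 by simp
    finally show ?thesis by simp
  qed
  finally show ?thesis by (simp add: P_def)
qed

text \<open>\<open>b * G\<close> collects the errors of \<open>one_minus_clamp01_le\<close>,
  \<open>G\<close> those of \<open>min_powr_le_clamp01\<close>, and \<open>C_V^2 * G\<close> the
  weighted terms of \<open>cutoff_step\<close>. The last condition on \<open>m\<close> says that the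
  cutoff is close to 1 well inside its ball; it makes \<open>(1 - m k y)^2\<close> sum to the
  clipped logarithm up to \<open>G\<close>.\<close>

lemma cutoff_summed:
  fixes m :: "int \<Rightarrow> 'a \<Rightarrow> real" and n :: nat
  defines "G \<equiv> 2 * b / (1 - 1 / b)"
  assumes f: "invertible_fn f" and mf: "\<And>k. invertible_fn (\<lambda>y. complex_of_real (m k y) * f y)"
    and m_meas [measurable]: "\<And>k. m k \<in> borel_measurable \<mu>"
    and m: "\<And>k y. 0 \<le> m k y" "\<And>k y. m k y \<le> 1"
      "\<And>k y. m k y * (b powr (2 * real_of_int k) * N y) \<le> 1"
      "\<And>k y. 1 - m k y \<le> b powr (2 * real_of_int k) * N y"
  shows "(LINT x|\<mu>. (real n - clip n (ell x) - b * G) * (cmod (Fo f x))\<^sup>2)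
    \<le> (LINT y|\<mu>. (real n + clip n (ell y) + (1 + C_V\<^sup>2) * G) * (cmod (f y))\<^sup>2)"
proof -
  let ?S = "{- int n..<int n}"
  have fi: "integrable \<mu> f" using f by (auto simp: invertible_fn_def)
  have [measurable]: "f \<in> borel_measurable \<mu>" using fi by simp
  have f2: "integrable \<mu> (\<lambda>x. (cmod (f x))\<^sup>2)"
    by (rule integrable_norm_sq[OF fi invertible_fn_bounded[OF f]])
  have phi2: "integrable \<mu> (\<lambda>x. (cmod (Fo f x))\<^sup>2)"
    by (rule integrable_norm_sq[OF invertible_fn_integrable_Fo[OF f] norm_Fo_le])
  have G: "(\<Sum>k\<in>?S. b powr (- \<bar>s - real_of_int k\<bar>)) \<le> G" for s
    unfolding G_def by (rule sum_powr_abs_diff_le[OF b_gt_1]) simp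
  have G': "(\<Sum>k\<in>?S. b powr (- \<bar>s + real_of_int k\<bar>)) \<le> G" for s
  proof -
    have "(\<Sum>k\<in>?S. b powr (- \<bar>s + real_of_int k\<bar>)) = (\<Sum>k\<in>uminus ` ?S. b powr (- \<bar>s - real_of_int k\<bar>))"
      by (subst sum.reindex) (auto simp: inj_on_def)
    also have "\<dots> \<le> G" unfolding G_def by (rule sum_powr_abs_diff_le[OF b_gt_1]) simp
    finally show ?thesis .
  qed
  have clip_meas [measurable]: "(\<lambda>x. clip n (ell x)) \<in> borel_measurable \<mu>"
    unfolding clip_def by measurable
  have cut: "AE y in \<mu>. \<forall>k. m k y * b powr (2 * (ell y + real_of_int k)) \<le> 1 \<and> 1 - m k y \<le> b powr (2 * (ell y + real_of_int k))"
    using AE_N_pos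
  proof eventually_elim
    case (elim y)
    have "b powr (2 * (ell y + real_of_int k)) = b powr (2 * real_of_int k) * N y" for k
      using N_eq[OF elim] by (simp add: powr_add[symmetric] algebra_simps)
    then show ?case using m(3,4) by simp
  qed
  have int_h: "integrable \<mu> (\<lambda>x. max 0 (1 - b powr (ell x - real_of_int k)) * (cmod (Fo f x))\<^sup>2)" for k
    by (rule Bochner_Integration.integrable_bound[OF phi2])
       (auto simp: abs_mult intro!: mult_left_le_one_le)
  have int_1m: "integrable \<mu> (\<lambda>y. (1 - m k y)\<^sup>2 * (cmod (f y))\<^sup>2)" for k
    by (rule Bochner_Integration.integrable_bound[OF f2])
       (auto simp: abs_mult m intro!: mult_left_le_one_le power_le_one)
  have int_p: "integrable \<mu> (\<lambda>y. (b powr (ell y + real_of_int k) * m k y) * (cmod (f y))\<^sup>2)" for k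
  proof (rule Bochner_Integration.integrable_bound[OF f2])
    show "AE y in \<mu>. norm ((b powr (ell y + real_of_int k) * m k y) * (cmod (f y))\<^sup>2) \<le> norm ((cmod (f y))\<^sup>2)"
      using cut
    proof eventually_elim
      case (elim y)
      have "b powr (ell y + real_of_int k) * m k y \<le> b powr (- \<bar>ell y + real_of_int k\<bar>)"
        using b_gt_1 m elim by (intro powr_mult_cutoff_le) auto
      also have "\<dots> \<le> b powr 0" using b_gt_1 by (intro powr_mono) auto
      finally show ?case using m b_gt_1
        by (simp add: abs_mult mult_left_le_one_le)
    qed
  qed measurable
  have clip_int: "integrable \<mu> (\<lambda>x. (real n + c * clip n (ell x) + d) * h x)"
    if "integrable \<mu> h" for h :: "'a \<Rightarrow> real" and c d :: real
  proof (rule Bochner_Integration.integrable_bound)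
    show "integrable \<mu> (\<lambda>x. (real n + \<bar>c\<bar> * real n + \<bar>d\<bar>) * h x)" using that by simp
    show "AE x in \<mu>. norm ((real n + c * clip n (ell x) + d) * h x) \<le> norm ((real n + \<bar>c\<bar> * real n + \<bar>d\<bar>) * h x)"
    proof (rule AE_I2)
      fix x
      have "\<bar>clip n (ell x)\<bar> \<le> real n" by (auto simp: clip_def)
      then have "\<bar>c * clip n (ell x)\<bar> \<le> \<bar>c\<bar> * real n" by (simp add: abs_mult mult_left_mono)
      then have "\<bar>real n + c * clip n (ell x) + d\<bar> \<le> \<bar>real n + \<bar>c\<bar> * real n + \<bar>d\<bar>\<bar>" by linarith
      then show "norm ((real n + c * clip n (ell x) + d) * h x) \<le> norm ((real n + \<bar>c\<bar> * real n + \<bar>d\<bar>) * h x)"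
        by (simp add: abs_mult mult_right_mono)
    qed
  qed (use that in measurable)
  have "(LINT x|\<mu>. (real n - clip n (ell x) - b * G) * (cmod (Fo f x))\<^sup>2)
    \<le> (LINT x|\<mu>. (\<Sum>k\<in>?S. max 0 (1 - b powr (ell x - real_of_int k)) * (cmod (Fo f x))\<^sup>2))"
  proof (rule integral_mono)
    show "integrable \<mu> (\<lambda>x. (real n - clip n (ell x) - b * G) * (cmod (Fo f x))\<^sup>2)"
      using clip_int[OF phi2, of "- 1" "- (b * G)"] by simp
    show "integrable \<mu> (\<lambda>x. \<Sum>k\<in>?S. max 0 (1 - b powr (ell x - real_of_int k)) * (cmod (Fo f x))\<^sup>2)"
      by (intro Bochner_Integration.integrable_sum int_h)
    fix x
    have "(\<Sum>k\<in>?S. 1 - clamp01 (ell x - real_of_int k)) \<le>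
      (\<Sum>k\<in>?S. max 0 (1 - b powr (ell x - real_of_int k)) + b * b powr (- \<bar>ell x - real_of_int k\<bar>))"
      by (intro sum_mono one_minus_clamp01_le b_gt_1)
    moreover have "b * (\<Sum>k\<in>?S. b powr (- \<bar>ell x - real_of_int k\<bar>)) \<le> b * G"
      using b_gt_1 by (intro mult_left_mono G) auto
    ultimately have "real n - clip n (ell x) - b * G \<le> (\<Sum>k\<in>?S. max 0 (1 - b powr (ell x - real_of_int k)))"
      by (simp add: sum_subtractf clip_telescope sum.distrib sum_distrib_left[symmetric])
    then show "(real n - clip n (ell x) - b * G) * (cmod (Fo f x))\<^sup>2
       \<le> (\<Sum>k\<in>?S. max 0 (1 - b powr (ell x - real_of_int k)) * (cmod (Fo f x))\<^sup>2)"
      unfolding sum_distrib_right[symmetric] by (intro mult_right_mono) auto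
  qed
  also have "\<dots> = (\<Sum>k\<in>?S. LINT x|\<mu>. max 0 (1 - b powr (ell x - real_of_int k)) * (cmod (Fo f x))\<^sup>2)"
    by (intro Bochner_Integration.integral_sum int_h)
  also have "\<dots> \<le> (\<Sum>k\<in>?S. (LINT y|\<mu>. (1 - m k y)\<^sup>2 * (cmod (f y))\<^sup>2)
      + C_V\<^sup>2 * (LINT y|\<mu>. (b powr (ell y + k) * m k y) * (cmod (f y))\<^sup>2))"
    by (intro sum_mono cutoff_step f mf m m_meas)
  also have "\<dots> = (LINT y|\<mu>. (\<Sum>k\<in>?S. (1 - m k y)\<^sup>2 * (cmod (f y))\<^sup>2
      + C_V\<^sup>2 * ((b powr (ell y + k) * m k y) * (cmod (f y))\<^sup>2)))"
    using int_1m int_p by (subst Bochner_Integration.integral_sum) auto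
  also have "\<dots> \<le> (LINT y|\<mu>. (real n + clip n (ell y) + (1 + C_V\<^sup>2) * G) * (cmod (f y))\<^sup>2)"
  proof (rule integral_mono_AE)
    show "integrable \<mu> (\<lambda>y. \<Sum>k\<in>?S. (1 - m k y)\<^sup>2 * (cmod (f y))\<^sup>2
      + C_V\<^sup>2 * ((b powr (ell y + k) * m k y) * (cmod (f y))\<^sup>2))"
      using int_1m int_p by (intro Bochner_Integration.integrable_sum Bochner_Integration.integrable_add integrable_mult_right) auto
    show "integrable \<mu> (\<lambda>y. (real n + clip n (ell y) + (1 + C_V\<^sup>2) * G) * (cmod (f y))\<^sup>2)"
      using clip_int[OF f2, of 1] by simp
    show "AE y in \<mu>. (\<Sum>k\<in>?S. (1 - m k y)\<^sup>2 * (cmod (f y))\<^sup>2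
      + C_V\<^sup>2 * ((b powr (ell y + k) * m k y) * (cmod (f y))\<^sup>2)) \<le> (real n + clip n (ell y) + (1 + C_V\<^sup>2) * G) * (cmod (f y))\<^sup>2"
      using cut
    proof eventually_elim
      case (elim y)
      have "(1 - m k y)\<^sup>2 \<le> clamp01 (ell y + real_of_int k + 1) + b powr (- \<bar>ell y + real_of_int k\<bar>)" for k
      proof -
        have "(1 - m k y)\<^sup>2 \<le> 1 - m k y"
          using m(1,2)[of k y] by (simp add: power2_eq_square mult_left_le_one_le)
        also have "\<dots> \<le> min 1 (b powr (2 * (ell y + real_of_int k)))"
          using m(1)[of k y] elim by auto
        also have "\<dots> \<le> clamp01 (ell y + real_of_int k + 1) + b powr (- \<bar>ell y + real_of_int k\<bar>)"
          by (rule min_powr_le_clamp01[OF b_gt_1])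
        finally show ?thesis .
      qed
      moreover have "b powr (ell y + real_of_int k) * m k y \<le> b powr (- \<bar>ell y + real_of_int k\<bar>)" for k
        using b_gt_1 m elim by (intro powr_mult_cutoff_le) auto
      ultimately have "(\<Sum>k\<in>?S. (1 - m k y)\<^sup>2 + C_V\<^sup>2 * (b powr (ell y + real_of_int k) * m k y)) \<le>
        (\<Sum>k\<in>?S. (clamp01 (ell y + real_of_int k + 1) + b powr (- \<bar>ell y + real_of_int k\<bar>)) + C_V\<^sup>2 * b powr (- \<bar>ell y + real_of_int k\<bar>))"
        by (intro sum_mono add_mono mult_left_mono) auto
      also have "\<dots> = real n + clip n (ell y) + (1 + C_V\<^sup>2) * (\<Sum>k\<in>?S. b powr (- \<bar>ell y + real_of_int k\<bar>))"
        by (simp add: sum.distrib clip_telescope' sum_distrib_left[symmetric] ring_distribs)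
      also have "\<dots> \<le> real n + clip n (ell y) + (1 + C_V\<^sup>2) * G"
        by (intro add_left_mono mult_left_mono G') auto
      finally have "(\<Sum>k\<in>?S. (1 - m k y)\<^sup>2 + C_V\<^sup>2 * (b powr (ell y + real_of_int k) * m k y)) * (cmod (f y))\<^sup>2
         \<le> (real n + clip n (ell y) + (1 + C_V\<^sup>2) * G) * (cmod (f y))\<^sup>2"
        by (intro mult_right_mono) auto
      then show ?case by (simp add: sum_distrib_right ring_distribs mult.assoc)
    qed
  qed
  finally show ?thesis .
qed

lemma clip_integral_tendsto:
  fixes h :: "'a \<Rightarrow> real"
  assumes "integrable \<mu> (\<lambda>x. ell x * h x)" and [measurable]: "h \<in> borel_measurable \<mu>"
  shows "(\<lambda>n. LINT x|\<mu>. clip n (ell x) * h x) \<longlonglongrightarrow> (LINT x|\<mu>. ell x * h x)"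
proof (rule integral_dominated_convergence[of _ _ _ "\<lambda>x. \<bar>ell x * h x\<bar>"])
  show "AE x in \<mu>. (\<lambda>n. clip n (ell x) * h x) \<longlonglongrightarrow> ell x * h x"
    by (intro AE_I2 tendsto_mult clip_tendsto tendsto_const)
  show "AE x in \<mu>. norm (clip n (ell x) * h x) \<le> \<bar>ell x * h x\<bar>" for n
    by (intro AE_I2) (simp add: abs_mult mult_right_mono abs_clip_le)
  show "(\<lambda>x. clip n (ell x) * h x) \<in> borel_measurable \<mu>" for n
    unfolding clip_def by measurable
qed (use assms in auto)

text \<open>By Plancherel the main terms, \<open>n\<close> times the squared norm of
  \<open>f\<close>, are equal on the two sides and cancel. What remains for the clipped logarithms
  has a constant independent of \<open>n\<close>, and dominated convergence with the unclipped
  integrands as majorants removes the clipping.\<close>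

lemma log_uncertainty:
  fixes m :: "int \<Rightarrow> 'a \<Rightarrow> real"
  defines "G \<equiv> 2 * b / (1 - 1 / b)"
  assumes f: "invertible_fn f" and mf: "\<And>k. invertible_fn (\<lambda>y. complex_of_real (m k y) * f y)"
    and m_meas: "\<And>k. m k \<in> borel_measurable \<mu>"
    and m: "\<And>k y. 0 \<le> m k y" "\<And>k y. m k y \<le> 1"
      "\<And>k y. m k y * (b powr (2 * real_of_int k) * N y) \<le> 1"
      "\<And>k y. 1 - m k y \<le> b powr (2 * real_of_int k) * N y"
    and ell_f: "integrable \<mu> (\<lambda>y. ell y * (cmod (f y))\<^sup>2)"
    and ell_Fo: "integrable \<mu> (\<lambda>x. ell x * (cmod (Fo f x))\<^sup>2)"
  shows "- (b + 1 + C_V\<^sup>2) * G * (LINT y|\<mu>. (cmod (f y))\<^sup>2)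
    \<le> (LINT y|\<mu>. ell y * (cmod (f y))\<^sup>2) + (LINT x|\<mu>. ell x * (cmod (Fo f x))\<^sup>2)"
proof -
  have fi: "integrable \<mu> f" using f by (auto simp: invertible_fn_def)
  have [measurable]: "f \<in> borel_measurable \<mu>" using fi by simp
  have f2: "integrable \<mu> (\<lambda>x. (cmod (f x))\<^sup>2)"
    by (rule integrable_norm_sq[OF fi invertible_fn_bounded[OF f]])
  have phi2: "integrable \<mu> (\<lambda>x. (cmod (Fo f x))\<^sup>2)"
    by (rule integrable_norm_sq[OF invertible_fn_integrable_Fo[OF f] norm_Fo_le])
  have clip_int: "integrable \<mu> (\<lambda>x. clip n (ell x) * h x)"
    if "integrable \<mu> (\<lambda>x. ell x * h x)" "h \<in> borel_measurable \<mu>" for n and h :: "'a \<Rightarrow> real"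
  proof (rule Bochner_Integration.integrable_bound[OF that(1)])
    show "(\<lambda>x. clip n (ell x) * h x) \<in> borel_measurable \<mu>"
      unfolding clip_def using that(2) by measurable
    show "AE x in \<mu>. norm (clip n (ell x) * h x) \<le> norm (ell x * h x)"
      by (intro AE_I2) (simp add: abs_mult mult_right_mono abs_clip_le)
  qed
  let ?I = "LINT y|\<mu>. (cmod (f y))\<^sup>2"
  let ?a = "\<lambda>n. LINT y|\<mu>. clip n (ell y) * (cmod (f y))\<^sup>2"
  let ?b = "\<lambda>n. LINT x|\<mu>. clip n (ell x) * (cmod (Fo f x))\<^sup>2"
  have "- (b + 1 + C_V\<^sup>2) * G * ?I \<le> ?a n + ?b n" for n
  proof -
    have ia: "integrable \<mu> (\<lambda>y. clip n (ell y) * (cmod (f y))\<^sup>2)" by (rule clip_int[OF ell_f]) simp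
    have ib: "integrable \<mu> (\<lambda>x. clip n (ell x) * (cmod (Fo f x))\<^sup>2)" by (rule clip_int[OF ell_Fo]) simp
    have "(LINT x|\<mu>. (real n - clip n (ell x) - b * G) * (cmod (Fo f x))\<^sup>2) =
        (LINT x|\<mu>. (real n - b * G) * (cmod (Fo f x))\<^sup>2 - clip n (ell x) * (cmod (Fo f x))\<^sup>2)"
      by (intro Bochner_Integration.integral_cong) (auto simp: algebra_simps)
    also have "\<dots> = (real n - b * G) * ?I - ?b n"
      using phi2 ib by (simp add: plancherel[OF f])
    finally have 1: "(LINT x|\<mu>. (real n - clip n (ell x) - b * G) * (cmod (Fo f x))\<^sup>2) = (real n - b * G) * ?I - ?b n" .
    have "(LINT y|\<mu>. (real n + clip n (ell y) + (1 + C_V\<^sup>2) * G) * (cmod (f y))\<^sup>2) =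
        (LINT y|\<mu>. (real n + (1 + C_V\<^sup>2) * G) * (cmod (f y))\<^sup>2 + clip n (ell y) * (cmod (f y))\<^sup>2)"
      by (intro Bochner_Integration.integral_cong) (auto simp: algebra_simps)
    also have "\<dots> = (real n + (1 + C_V\<^sup>2) * G) * ?I + ?a n"
      using f2 ia by simp
    finally show ?thesis
      using cutoff_summed[OF f mf m_meas m, of n] unfolding G_def[symmetric] 1
      by (simp add: algebra_simps)
  qed
  moreover have "(\<lambda>n. ?a n + ?b n) \<longlonglongrightarrow> (LINT y|\<mu>. ell y * (cmod (f y))\<^sup>2) + (LINT x|\<mu>. ell x * (cmod (Fo f x))\<^sup>2)"
    by (intro tendsto_add clip_integral_tendsto ell_f ell_Fo) measurable
  ultimately show ?thesis by (intro LIMSEQ_le_const) auto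
qed

text \<open>The constant depends on \<open>b\<close> and \<open>M\<close> only, so it is chosen
  before \<open>f\<close> and the cutoffs; the factor \<open>2 * ln b\<close> in it converts
  \<open>ell\<close> back to \<open>ln N\<close>. The form is real because both of its parts become
  integrals of real functions. The cutoffs appear as data for each \<open>f\<close>, as every
  truncated function must be invertible too.\<close>

theorem log_operator_bounded_below:
  "\<exists>c. \<forall>f m. invertible_fn f \<and> integrable \<mu> (\<lambda>y. complex_of_real (ln (N y)) * f y) \<and>
     integrable \<mu> (\<lambda>x. complex_of_real (ln (N x)) * Fo f x) \<and>
     (\<forall>k::int. m k \<in> borel_measurable \<mu> \<and> invertible_fn (\<lambda>y. complex_of_real (m k y) * f y) \<and>
       (\<forall>y. 0 \<le> m k y \<and> m k y \<le> 1 \<and> m k y * (b powr (2 * real_of_int k) * N y) \<le> 1 \<and>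
            1 - m k y \<le> b powr (2 * real_of_int k) * N y)) \<longrightarrow>
     (let I = LINT y|\<mu>. (complex_of_real (ln (N y)) * f y
               + Fi (\<lambda>x. complex_of_real (ln (N x)) * Fo f x) y) * cnj (f y)
      in I \<in> \<real> \<and> c * (LINT y|\<mu>. (cmod (f y))\<^sup>2) \<le> Re I)"
proof -
  let ?G = "2 * b / (1 - 1 / b)"
  let ?c = "2 * ln b * (- (b + 1 + C_V\<^sup>2) * ?G)"
  have "(let I = LINT y|\<mu>. (complex_of_real (ln (N y)) * f y
               + Fi (\<lambda>x. complex_of_real (ln (N x)) * Fo f x) y) * cnj (f y)
      in I \<in> \<real> \<and> ?c * (LINT y|\<mu>. (cmod (f y))\<^sup>2) \<le> Re I)"
    if f: "invertible_fn f" and lf: "integrable \<mu> (\<lambda>y. complex_of_real (ln (N y)) * f y)"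
      and lF: "integrable \<mu> (\<lambda>x. complex_of_real (ln (N x)) * Fo f x)"
      and m: "\<forall>k::int. m k \<in> borel_measurable \<mu> \<and> invertible_fn (\<lambda>y. complex_of_real (m k y) * f y) \<and>
       (\<forall>y. 0 \<le> m k y \<and> m k y \<le> 1 \<and> m k y * (b powr (2 * real_of_int k) * N y) \<le> 1 \<and>
            1 - m k y \<le> b powr (2 * real_of_int k) * N y)" for f m
  proof -
    have fi: "integrable \<mu> f" using f by (auto simp: invertible_fn_def)
    have [measurable]: "f \<in> borel_measurable \<mu>" using fi by simp
    have ln_eq: "ln (N x) = 2 * ln b * ell x" for x using b_gt_1 by (simp add: ell_def)
    have ell_int: "integrable \<mu> (\<lambda>x. ell x * (cmod (h x))\<^sup>2) \<and>
        (LINT x|\<mu>. complex_of_real (ln (N x)) * h x * cnj (h x)) = complex_of_real (2 * ln b * (LINT x|\<mu>. ell x * (cmod (h x))\<^sup>2))"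
      if "integrable \<mu> (\<lambda>x. complex_of_real (ln (N x)) * h x)" "h \<in> borel_measurable \<mu>" "\<And>x. cmod (h x) \<le> K"
      for h :: "'a \<Rightarrow> complex" and K
    proof -
      have eq: "complex_of_real (ln (N x)) * h x * cnj (h x) = complex_of_real (2 * ln b * (ell x * (cmod (h x))\<^sup>2))" for x
        using complex_of_real_norm_sq[of "h x"] by (simp add: ln_eq mult.assoc)
      have "integrable \<mu> (\<lambda>x. complex_of_real (ln (N x)) * h x * cnj (h x))"
        by (rule integrable_mult_bounded[OF that(1), of _ K]) (use that in auto)
      then have "integrable \<mu> (\<lambda>x. 2 * ln b * (ell x * (cmod (h x))\<^sup>2))"
        unfolding eq by (simp only: complex_of_real_integrable_eq)
      then have "integrable \<mu> (\<lambda>x. ell x * (cmod (h x))\<^sup>2)"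
        using b_gt_1 by (subst (asm) integrable_mult_left_iff) auto
      then show ?thesis unfolding eq by (simp add: integral_complex_of_real del: of_real_mult)
    qed
    note ef = ell_int[OF lf _ invertible_fn_bounded[OF f]] and eF = ell_int[OF lF _ norm_Fo_le]
    let ?J = "(LINT y|\<mu>. ell y * (cmod (f y))\<^sup>2) + (LINT x|\<mu>. ell x * (cmod (Fo f x))\<^sup>2)"
    let ?g = "Fi (\<lambda>x. complex_of_real (ln (N x)) * Fo f x)"
    have g_int: "integrable \<mu> (\<lambda>y. ?g y * cnj (f y))"
    proof -
      have "integrable \<mu> (\<lambda>y. cnj (f y) * ?g y)"
        by (rule integrable_mult_bounded[OF _ _ norm_Fi_le]) (use fi in auto)
      then show ?thesis by (simp add: mult.commute)
    qed
    have "(LINT y|\<mu>. (complex_of_real (ln (N y)) * f y + ?g y) * cnj (f y)) =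
       (LINT y|\<mu>. complex_of_real (ln (N y)) * f y * cnj (f y)) + (LINT y|\<mu>. ?g y * cnj (f y))"
      unfolding distrib_right
      by (intro Bochner_Integration.integral_add g_int integrable_mult_bounded[OF lf, of _ "LINT x|\<mu>. cmod (Fo f x)"])
         (use invertible_fn_bounded[OF f] in auto)
    \<comment> \<open>Parseval replaces the summand of \<open>B\<close> by the logarithm integrated
      against the squared modulus of the transform.\<close>
    also have "(LINT y|\<mu>. ?g y * cnj (f y)) = (LINT x|\<mu>. complex_of_real (ln (N x)) * Fo f x * cnj (Fo f x))"
      by (rule parseval[OF fi lF])
    also have "(LINT y|\<mu>. complex_of_real (ln (N y)) * f y * cnj (f y)) + \<dots> = complex_of_real (2 * ln b * ?J)"
      using ef eF by (simp add: ring_distribs)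
    finally have I: "(LINT y|\<mu>. (complex_of_real (ln (N y)) * f y + ?g y) * cnj (f y)) = complex_of_real (2 * ln b * ?J)" .
    have "- (b + 1 + C_V\<^sup>2) * ?G * (LINT y|\<mu>. (cmod (f y))\<^sup>2) \<le> ?J"
      by (rule log_uncertainty[of f m]) (use f m ef eF in auto)
    then have "2 * ln b * (- (b + 1 + C_V\<^sup>2) * ?G * (LINT y|\<mu>. (cmod (f y))\<^sup>2)) \<le> 2 * ln b * ?J"
      using b_gt_1 by (intro mult_left_mono) auto
    then show ?thesis unfolding I Let_def by (simp add: mult.assoc)
  qed
  then show ?thesis by blast
qed

end

section \<open>Completions of number fields\<close>

text \<open>The type of the completion has no second countable topology by its class, so continuity on
  the product does not immediately give measurability for the product sigma-algebra.\<close>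

lemma borel_measurable_pair_separable:
  fixes g :: "'a::metric_space \<Rightarrow> 'a \<Rightarrow> complex" and D :: "'a set"
  assumes D: "countable D" "closure D = UNIV"
    and meas: "\<And>y. (\<lambda>x. g x y) \<in> borel_measurable borel"
    and cont: "\<And>x. continuous_on UNIV (g x)"
  shows "case_prod g \<in> borel_measurable (borel \<Otimes>\<^sub>M borel)"
proof -
  have "D \<noteq> {}" using D(2) by auto
  define d :: "nat \<Rightarrow> 'a" where "d = from_nat_into D"
  have range_d: "range d = D" unfolding d_def by (rule range_from_nat_into) fact+
  \<comment> \<open>\<open>d (k n y)\<close> rounds \<open>y\<close> to the first enumerated point
    at distance less than \<open>1 / (n + 1)\<close>. It takes countably many values, so
    measurability of \<open>g\<close> in the first argument suffices for the approximants, and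
    continuity in the second gives convergence to \<open>g\<close>.\<close>
  define k :: "nat \<Rightarrow> 'a \<Rightarrow> nat" where "k n y = (LEAST i. dist y (d i) < 1 / real (Suc n))" for n y
  have k: "dist y (d (k n y)) < 1 / real (Suc n)" for n y
  proof -
    have "y \<in> closure D" using D by simp
    moreover have "0 < 1 / real (Suc n)" by simp
    ultimately obtain x where x: "x \<in> D" "dist x y < 1 / real (Suc n)"
      unfolding closure_approachable by blast
    obtain i where "x = d i" using x(1) range_d by blast
    then have "dist y (d i) < 1 / real (Suc n)" using x(2) by (simp only: dist_commute[of y])
    then show ?thesis unfolding k_def by (rule LeastI)
  qed
  have [measurable]: "(\<lambda>y. dist y z) \<in> borel_measurable borel" for z :: 'a
    by (intro borel_measurable_continuous_onI continuous_intros)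
  have k_meas [measurable]: "k n \<in> measurable borel (count_space UNIV)" for n
    unfolding k_def by measurable
  show ?thesis
  proof (rule borel_measurable_LIMSEQ_metric)
    fix n
    have "(\<lambda>p. g (fst p) (d (k n (snd p)))) \<in> borel_measurable (borel \<Otimes>\<^sub>M borel)"
    proof (rule measurable_compose_countable)
      show "(\<lambda>p. k n (snd p)) \<in> measurable (borel \<Otimes>\<^sub>M borel) (count_space UNIV)" by measurable
      show "(\<lambda>p. g (fst p) (d i)) \<in> borel_measurable (borel \<Otimes>\<^sub>M borel)" for i
        by (rule measurable_compose[OF measurable_fst meas])
    qed
    then show "(\<lambda>p. g (fst p) (d (k n (snd p)))) \<in> borel_measurable (borel \<Otimes>\<^sub>M borel)" .
  next
    fix p :: "'a \<times> 'a"
    have "(\<lambda>n. d (k n (snd p))) \<longlonglongrightarrow> snd p"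
    proof (rule metric_tendsto_imp_tendsto)
      show "(\<lambda>n. 1 / real (Suc n)) \<longlonglongrightarrow> 0" by (rule LIMSEQ_Suc[OF lim_1_over_n])
      show "\<forall>\<^sub>F n in sequentially. dist (d (k n (snd p))) (snd p) \<le> dist (1 / real (Suc n)) 0"
        using k by (intro always_eventually allI) (simp add: dist_commute less_imp_le)
    qed
    then have "(\<lambda>n. g (fst p) (d (k n (snd p)))) \<longlonglongrightarrow> g (fst p) (snd p)"
      using cont[of "fst p"] by (intro continuous_on_tendsto_compose[of UNIV "g (fst p)"]) auto
    then show "(\<lambda>n. g (fst p) (d (k n (snd p)))) \<longlonglongrightarrow> case_prod g p"
      by (simp add: case_prod_unfold)
  qed
qed

text \<open>Countability provides a countable dense subset of the completion, needed for
  measurability on the product; the finite spanning set over the rationals will span the completion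
  over its base field.\<close>

lemma countable_number_field:
  assumes "number_field TYPE('k::field_char_0)"
  shows "countable (UNIV :: 'k set)"
    and "\<exists>B::'k set. finite B \<and> (\<forall>x. \<exists>u. x = (\<Sum>b\<in>B. of_rat (u b) * b))"
proof -
  obtain B :: "'k set" where "finite_dimensional_vector_space (\<lambda>(r::rat) (x::'k). of_rat r * x) B"
    using assms unfolding number_field_def by blast
  then interpret fd: finite_dimensional_vector_space "\<lambda>(r::rat) (x::'k). of_rat r * x" B .
  have span: "range (\<lambda>u. \<Sum>b\<in>B. of_rat (u b) * b) = UNIV"
    using fd.span_finite[OF fd.finite_Basis] fd.span_Basis by simp
  then show "\<exists>B::'k set. finite B \<and> (\<forall>x. \<exists>u. x = (\<Sum>b\<in>B. of_rat (u b) * b))"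
  proof (intro exI[of _ B] conjI allI)
    fix x
    have "x \<in> range (\<lambda>u. \<Sum>b\<in>B. of_rat (u b) * b)" using span by simp
    then show "\<exists>u. x = (\<Sum>b\<in>B. of_rat (u b) * b)" by blast
  qed (rule fd.finite_Basis)
  have "x \<in> (\<lambda>u. \<Sum>b\<in>B. of_rat (u b) * b) ` (B \<rightarrow>\<^sub>E UNIV)" for x
  proof -
    have "x \<in> range (\<lambda>u. \<Sum>b\<in>B. of_rat (u b) * b)" using span by simp
    then obtain u where "x = (\<Sum>b\<in>B. of_rat (u b) * b)" by blast
    then have "x = (\<Sum>b\<in>B. of_rat (restrict u B b) * b)" by simp
    then show ?thesis by (intro image_eqI[of _ _ "restrict u B"]) auto
  qed
  then have eq: "UNIV = (\<lambda>u. \<Sum>b\<in>B. of_rat (u b) * b) ` (B \<rightarrow>\<^sub>E UNIV)"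
    by (intro subset_antisym subsetI) simp_all
  have "countable (B \<rightarrow>\<^sub>E (UNIV :: rat set))"
    by (intro countable_PiE fd.finite_Basis) auto
  then show "countable (UNIV :: 'k set)" by (subst eq) (rule countable_image)
qed

section \<open>Continuity of the field operations\<close>

text \<open>The type class puts a field structure and a complete metric on the same type without
  relating them; the two assumptions tie them together, and continuity of the operations is derived
  from them.\<close>

locale valued_field =
  fixes ty :: "'v::{field_char_0,complete_space} itself"
  assumes absv: "absolute_value (\<lambda>x::'v. dist x 0)"
    and dist_diff: "\<And>x y :: 'v. dist x y = dist (x - y) 0"
begin

abbreviation vn :: "'v \<Rightarrow> real" where "vn x \<equiv> dist x 0"

lemma vn_mult: "vn (x * y) = vn x * vn y"
  and vn_add: "vn (x + y) \<le> vn x + vn y"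
  using absv by (simp_all add: absolute_value_def)

lemma vn_one: "vn 1 = 1"
proof -
  have "vn 1 * vn 1 = vn 1" using vn_mult[of 1 1] by simp
  then show ?thesis by (simp del: dist_eq_0_iff)
qed

lemma vn_minus: "vn (- x) = vn x"
  using dist_diff[of 0 x] by (simp add: dist_commute)

lemma vn_inverse: "vn (inverse x) = inverse (vn x)"
proof (cases "x = 0")
  case False
  then have "vn (inverse x) * vn x = 1" by (simp add: vn_mult[symmetric] vn_one)
  then show ?thesis by (metis inverse_unique mult.commute)
qed simp

lemma vn_divide: "vn (x / y) = vn x / vn y"
  by (simp add: divide_inverse vn_mult vn_inverse)

lemma vn_power: "vn (x ^ n) = vn x ^ n"
  by (induction n) (simp_all add: vn_one vn_mult)

lemma vn_powi: "vn (x powi n) = vn x powi n"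
  by (simp add: power_int_def vn_power vn_inverse)

lemma tendsto_vn_iff: "(f \<longlongrightarrow> a) F \<longleftrightarrow> ((\<lambda>x. vn (f x - a)) \<longlongrightarrow> 0) F"
  by (subst tendsto_dist_iff) (subst dist_diff, rule refl)

lemma tendsto_vadd:
  assumes "(f \<longlongrightarrow> a) F" "(g \<longlongrightarrow> c) F"
  shows "((\<lambda>x. f x + g x) \<longlongrightarrow> (a + c :: 'v)) F"
  unfolding tendsto_vn_iff
proof (rule tendsto_sandwich[of "\<lambda>_. 0"])
  show "((\<lambda>x. vn (f x - a) + vn (g x - c)) \<longlongrightarrow> 0) F"
    using assms unfolding tendsto_vn_iff by (rule tendsto_add_zero)
  show "\<forall>\<^sub>F x in F. vn (f x + g x - (a + c)) \<le> vn (f x - a) + vn (g x - c)"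
    using vn_add[of "f _ - a" "g _ - c"] by (intro always_eventually) (simp add: algebra_simps)
qed auto

lemma tendsto_vmult:
  assumes "(f \<longlongrightarrow> a) F" "(g \<longlongrightarrow> c) F"
  shows "((\<lambda>x. f x * g x) \<longlongrightarrow> (a * c :: 'v)) F"
  unfolding tendsto_vn_iff
proof (rule tendsto_sandwich[of "\<lambda>_. 0"])
  have "((\<lambda>x. vn (g x)) \<longlongrightarrow> vn c) F" by (intro tendsto_dist assms tendsto_const)
  then have "((\<lambda>x. vn (f x - a) * vn (g x) + vn a * vn (g x - c)) \<longlongrightarrow> 0 * vn c + vn a * 0) F"
    using assms unfolding tendsto_vn_iff by (intro tendsto_add tendsto_mult tendsto_const)
  then show "((\<lambda>x. vn (f x - a) * vn (g x) + vn a * vn (g x - c)) \<longlongrightarrow> 0) F" by simp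
  show "\<forall>\<^sub>F x in F. vn (f x * g x - a * c) \<le> vn (f x - a) * vn (g x) + vn a * vn (g x - c)"
  proof (intro always_eventually allI)
    fix x
    have "f x * g x - a * c = (f x - a) * g x + a * (g x - c)" by (simp add: algebra_simps)
    then show "vn (f x * g x - a * c) \<le> vn (f x - a) * vn (g x) + vn a * vn (g x - c)"
      using vn_add vn_mult by metis
  qed
qed auto

lemma tendsto_vinverse:
  assumes f: "(f \<longlongrightarrow> a) F" and "a \<noteq> 0"
  shows "((\<lambda>x. inverse (f x)) \<longlongrightarrow> (inverse a :: 'v)) F"
  unfolding tendsto_vn_iff
proof -
  have vf: "((\<lambda>x. vn (f x)) \<longlongrightarrow> vn a) F" by (intro tendsto_dist f tendsto_const)
  then have "((\<lambda>x. vn (f x - a) / (vn (f x) * vn a)) \<longlongrightarrow> 0 / (vn a * vn a)) F"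
    using f \<open>a \<noteq> 0\<close> unfolding tendsto_vn_iff by (intro tendsto_divide tendsto_mult tendsto_const) auto
  then have lim: "((\<lambda>x. vn (f x - a) / (vn (f x) * vn a)) \<longlongrightarrow> 0) F" by simp
  have "\<forall>\<^sub>F x in F. vn (f x) > 0"
    using order_tendstoD(1)[OF vf, of 0] \<open>a \<noteq> 0\<close> by simp
  then have "\<forall>\<^sub>F x in F. vn (f x - a) / (vn (f x) * vn a) = vn (inverse (f x) - inverse a)"
  proof eventually_elim
    case (elim x)
    then have "f x \<noteq> 0" by auto
    then have "inverse (f x) - inverse a = - (f x - a) / (f x * a)"
      using \<open>a \<noteq> 0\<close> by (simp add: field_simps)
    then show ?case by (simp only: vn_divide vn_minus vn_mult)
  qed
  then show "((\<lambda>x. vn (inverse (f x) - inverse a)) \<longlongrightarrow> 0) F"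
    using lim by (rule Lim_transform_eventually[rotated])
qed

lemma continuous_vadd: "continuous_on UNIV (\<lambda>x. a + x :: 'v)"
  unfolding continuous_on_def by (intro ballI tendsto_vadd tendsto_const tendsto_ident_at)

lemma continuous_vmult: "continuous_on UNIV (\<lambda>x. a * x :: 'v)"
  unfolding continuous_on_def by (intro ballI tendsto_vmult tendsto_const tendsto_ident_at)

lemma tendsto_vminus: "(f \<longlongrightarrow> a) F \<Longrightarrow> ((\<lambda>x. - f x) \<longlongrightarrow> (- a :: 'v)) F"
  using tendsto_vmult[OF tendsto_const[of "- 1"]] by force

lemma tendsto_vdiff:
  "(f \<longlongrightarrow> a) F \<Longrightarrow> (g \<longlongrightarrow> c) F \<Longrightarrow> ((\<lambda>x. f x - g x) \<longlongrightarrow> (a - c :: 'v)) F"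
  using tendsto_vadd[OF _ tendsto_vminus] by fastforce

section \<open>The base field and its finite-dimensional spans\<close>

abbreviation BF :: "'v set" where "BF \<equiv> base_field"

lemma base_field_closed: "closed BF" by (simp add: base_field_def)

lemma Rats_base_field: "r \<in> \<rat> \<Longrightarrow> r \<in> BF"
  using closure_subset[of \<rat>] by (auto simp: base_field_def)

lemma base_field_seq: "x \<in> BF \<longleftrightarrow> (\<exists>s. (\<forall>n. s n \<in> \<rat>) \<and> s \<longlonglongrightarrow> x)"
  by (simp add: base_field_def closure_sequential)

lemma base_field_add: assumes "x \<in> BF" "y \<in> BF" shows "x + y \<in> BF"
proof -
  obtain s t where "\<forall>n. s n \<in> \<rat>" "s \<longlonglongrightarrow> x" "\<forall>n. t n \<in> \<rat>" "t \<longlonglongrightarrow> y"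
    using assms unfolding base_field_seq by blast
  then show ?thesis unfolding base_field_seq by (intro exI[of _ "\<lambda>n. s n + t n"]) (auto intro: tendsto_vadd)
qed

lemma base_field_mult: assumes "x \<in> BF" "y \<in> BF" shows "x * y \<in> BF"
proof -
  obtain s t where "\<forall>n. s n \<in> \<rat>" "s \<longlonglongrightarrow> x" "\<forall>n. t n \<in> \<rat>" "t \<longlonglongrightarrow> y"
    using assms unfolding base_field_seq by blast
  then show ?thesis unfolding base_field_seq by (intro exI[of _ "\<lambda>n. s n * t n"]) (auto intro: tendsto_vmult)
qed

lemma base_field_0: "0 \<in> BF" and base_field_1: "1 \<in> BF"
  by (auto intro: Rats_base_field)

lemma base_field_minus: "x \<in> BF \<Longrightarrow> - x \<in> BF"
  using base_field_mult[of "- 1" x] Rats_base_field[of "- 1"] by simp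

lemma base_field_diff: "x \<in> BF \<Longrightarrow> y \<in> BF \<Longrightarrow> x - y \<in> BF"
  using base_field_add[OF _ base_field_minus] by fastforce

lemma base_field_inverse: assumes "x \<in> BF" shows "inverse x \<in> BF"
proof (cases "x = 0")
  case True then show ?thesis by (simp add: base_field_0)
next
  case False
  obtain s where "\<forall>n. s n \<in> \<rat>" "s \<longlonglongrightarrow> x"
    using assms unfolding base_field_seq by blast
  then show ?thesis unfolding base_field_seq using False
    by (intro exI[of _ "\<lambda>n. inverse (s n)"]) (auto intro: tendsto_vinverse)
qed

lemma base_field_sum: "(\<And>a. a \<in> A \<Longrightarrow> f a \<in> BF) \<Longrightarrow> sum f A \<in> BF"
  by (induction A rule: infinite_finite_induct) (auto simp: base_field_0 base_field_add)

definition fspan :: "'v set \<Rightarrow> 'v set" where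
  "fspan A = {x. \<exists>c. (\<forall>a\<in>A. c a \<in> BF) \<and> x = (\<Sum>a\<in>A. c a * a)}"

lemma fspanI: "(\<And>a. a \<in> A \<Longrightarrow> c a \<in> BF) \<Longrightarrow> (\<Sum>a\<in>A. c a * a) \<in> fspan A"
  unfolding fspan_def by blast

lemma fspan_add: assumes "x \<in> fspan A" "y \<in> fspan A" shows "x + y \<in> fspan A"
proof -
  obtain c d where c: "\<forall>a\<in>A. c a \<in> BF" "x = (\<Sum>a\<in>A. c a * a)"
    and d: "\<forall>a\<in>A. d a \<in> BF" "y = (\<Sum>a\<in>A. d a * a)"
    using assms unfolding fspan_def by blast
  have "(\<Sum>a\<in>A. (c a + d a) * a) \<in> fspan A" using c d by (intro fspanI base_field_add) auto
  then show ?thesis using c d by (simp add: distrib_right sum.distrib)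
qed

lemma fspan_scale: assumes "x \<in> fspan A" "r \<in> BF" shows "r * x \<in> fspan A"
proof -
  obtain c where c: "\<forall>a\<in>A. c a \<in> BF" "x = (\<Sum>a\<in>A. c a * a)"
    using assms unfolding fspan_def by blast
  have "(\<Sum>a\<in>A. (r * c a) * a) \<in> fspan A" using c assms by (intro fspanI base_field_mult) auto
  then show ?thesis using c by (simp add: sum_distrib_left mult.assoc)
qed

lemma fspan_insert:
  assumes "finite A" "a \<notin> A"
  shows "fspan (insert a A) = {w + r * a | w r. w \<in> fspan A \<and> r \<in> BF}"
proof (intro set_eqI iffI)
  fix x assume "x \<in> fspan (insert a A)"
  then obtain c where c: "\<forall>z\<in>insert a A. c z \<in> BF" "x = (\<Sum>z\<in>insert a A. c z * z)"
    unfolding fspan_def by blast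
  then have "x = (\<Sum>z\<in>A. c z * z) + c a * a" using assms by (simp add: add.commute)
  then show "x \<in> {w + r * a | w r. w \<in> fspan A \<and> r \<in> BF}" using c fspanI[of A c] by blast
next
  fix x assume "x \<in> {w + r * a | w r. w \<in> fspan A \<and> r \<in> BF}"
  then obtain c r where c: "\<forall>z\<in>A. c z \<in> BF" "r \<in> BF" "x = (\<Sum>z\<in>A. c z * z) + r * a"
    unfolding fspan_def by blast
  have "(\<Sum>z\<in>insert a A. (c(a := r)) z * z) \<in> fspan (insert a A)"
    using c by (intro fspanI) auto
  also have "(\<Sum>z\<in>insert a A. (c(a := r)) z * z) = r * a + (\<Sum>z\<in>A. (c(a := r)) z * z)"
    using assms by simp
  also have "(\<Sum>z\<in>A. (c(a := r)) z * z) = (\<Sum>z\<in>A. c z * z)"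
    using assms by (intro sum.cong) auto
  finally show "x \<in> fspan (insert a A)" using c by (simp add: add.commute)
qed

text \<open>\<open>\<delta>\<close> is the radius of a ball about \<open>a\<close> that misses the
  closed span. Writing \<open>w + r * a\<close> as \<open>r\<close> times the difference of
  \<open>a\<close> and an element of the span gives the bound.\<close>

lemma coefficient_bound:
  assumes "closed (fspan A)" "a \<notin> fspan A"
  shows "\<exists>\<delta>>0. \<forall>w\<in>fspan A. \<forall>r\<in>BF. vn r * \<delta> \<le> vn (w + r * a)"
proof -
  have "open (- fspan A)" "a \<in> - fspan A" using assms by auto
  then obtain \<delta> where \<delta>: "\<delta> > 0" "ball a \<delta> \<subseteq> - fspan A" unfolding open_contains_ball by blast
  have "vn r * \<delta> \<le> vn (w + r * a)" if "w \<in> fspan A" "r \<in> BF" for w r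
  proof (cases "r = 0")
    case False
    have "(- inverse r) * w \<in> fspan A" using that by (intro fspan_scale base_field_minus base_field_inverse)
    then have "\<delta> \<le> dist a ((- inverse r) * w)" using \<delta>(2) by (force simp: not_less[symmetric])
    also have "\<dots> = vn (a - (- inverse r) * w)" by (rule dist_diff)
    finally have "vn r * \<delta> \<le> vn r * vn (a - (- inverse r) * w)" by (intro mult_left_mono) auto
    also have "\<dots> = vn (r * (a - (- inverse r) * w))" by (rule vn_mult[symmetric])
    also have "r * (a - (- inverse r) * w) = w + r * a" using False by (simp add: field_simps)
    finally show ?thesis .
  qed simp
  then show ?thesis using \<delta>(1) by blast
qed

text \<open>Induction on the generators. If the new one is not yet in the span,
  \<open>coefficient_bound\<close> makes its coefficients along a convergent sequence Cauchy; they
  converge in the closed base field, and subtracting their part leaves a convergent sequence in the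
  smaller span.\<close>

lemma closed_fspan: "finite A \<Longrightarrow> closed (fspan A)"
proof (induction A rule: finite_induct)
  case empty then show ?case by (simp add: fspan_def)
next
  case (insert a A)
  show ?case
  proof (cases "a \<in> fspan A")
    case True
    have "fspan (insert a A) = fspan A"
    proof -
      have "w + r * a \<in> fspan A" if "w \<in> fspan A" "r \<in> BF" for w r
        using that True by (intro fspan_add fspan_scale)
      moreover have "w \<in> {w + r * a | w r. w \<in> fspan A \<and> r \<in> BF}" if "w \<in> fspan A" for w
        using that base_field_0 by (intro CollectI exI[of _ w] exI[of _ 0]) simp
      ultimately show ?thesis unfolding fspan_insert[OF insert.hyps] by blast
    qed
    then show ?thesis using insert.IH by simp
  next
    case False
    obtain \<delta> where \<delta>: "\<delta> > 0" "\<And>w r. w \<in> fspan A \<Longrightarrow> r \<in> BF \<Longrightarrow> vn r * \<delta> \<le> vn (w + r * a)"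
      using coefficient_bound[OF insert.IH False] by blast
    show ?thesis unfolding closed_sequential_limits
    proof (intro allI impI, elim conjE)
      fix s z assume s: "\<forall>n. s n \<in> fspan (insert a A)" and lim: "s \<longlonglongrightarrow> z"
      have "\<forall>n. \<exists>w r. w \<in> fspan A \<and> r \<in> BF \<and> s n = w + r * a"
        using s unfolding fspan_insert[OF insert.hyps] by blast
      then obtain w r where wr: "\<And>n. w n \<in> fspan A" "\<And>n. r n \<in> BF" "\<And>n. s n = w n + r n * a"
        by metis
      have diff: "dist (r m) (r n) * \<delta> \<le> dist (s m) (s n)" for m n
      proof -
        have "w m + (- 1) * w n \<in> fspan A"
          using wr by (intro fspan_add fspan_scale base_field_minus base_field_1)
        then have "vn (r m - r n) * \<delta> \<le> vn (w m + (- 1) * w n + (r m - r n) * a)"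
          using wr by (intro \<delta>(2) base_field_diff)
        also have "w m + (- 1) * w n + (r m - r n) * a = s m - s n"
          using wr by (simp add: algebra_simps)
        finally show ?thesis by (simp only: dist_diff[of "r m"] dist_diff[of "s m"])
      qed
      have "Cauchy r"
      proof (rule metric_CauchyI)
        fix e :: real assume "0 < e"
        then obtain n0 where n0: "\<And>m n. m \<ge> n0 \<Longrightarrow> n \<ge> n0 \<Longrightarrow> dist (s m) (s n) < e * \<delta>"
          using LIMSEQ_imp_Cauchy[OF lim] \<delta>(1) unfolding Cauchy_def by (meson mult_pos_pos)
        have "dist (r m) (r n) < e" if "m \<ge> n0" "n \<ge> n0" for m n
        proof -
          have "dist (r m) (r n) * \<delta> < e * \<delta>" using diff[of m n] n0[OF that] by linarith
          then show ?thesis using \<delta>(1) by simp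
        qed
        then show "\<exists>M. \<forall>m\<ge>M. \<forall>n\<ge>M. dist (r m) (r n) < e" by blast
      qed
      then obtain r0 where r0: "r \<longlonglongrightarrow> r0" using Cauchy_convergent convergent_def by blast
      have "r0 \<in> BF" using closed_sequentially[OF base_field_closed _ r0] wr by blast
      have "(\<lambda>n. s n - r n * a) \<longlonglongrightarrow> z - r0 * a"
        by (intro tendsto_vdiff tendsto_vmult lim r0 tendsto_const)
      then have "w \<longlonglongrightarrow> z - r0 * a" using wr(3) by simp
      then have "z - r0 * a \<in> fspan A" using closed_sequentially[OF insert.IH] wr by blast
      then have "(z - r0 * a) + r0 * a \<in> fspan (insert a A)"
        unfolding fspan_insert[OF insert.hyps] using \<open>r0 \<in> BF\<close> by blast
      then show "z \<in> fspan (insert a A)" by simp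
    qed
  qed
qed

text \<open>A spanning set of least cardinality is a basis: a generator in the span of the others
  could be dropped, and two different coordinate vectors of one element would exhibit such a
  generator.\<close>

lemma finite_basis_from_spanning:
  assumes "finite A" "fspan A = UNIV"
  shows "\<exists>B. finite_basis_over BF B"
proof -
  define P where "P n \<longleftrightarrow> (\<exists>B. finite B \<and> fspan B = UNIV \<and> card B = n)" for n
  have "P (card A)" using assms unfolding P_def by blast
  then have "P (LEAST n. P n)" by (rule LeastI)
  then obtain B where B: "finite B" "fspan B = UNIV" "card B = (LEAST n. P n)" unfolding P_def by blast
  have notin: "b \<notin> fspan (B - {b})" if "b \<in> B" for b
  proof
    assume b: "b \<in> fspan (B - {b})"
    have "fspan B = fspan (insert b (B - {b}))" using that by (simp add: insert_absorb)
    also have "\<dots> = {w + r * b | w r. w \<in> fspan (B - {b}) \<and> r \<in> BF}"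
      using B by (intro fspan_insert) auto
    also have "\<dots> \<subseteq> fspan (B - {b})" using b fspan_add fspan_scale by blast
    finally have "P (card (B - {b}))" using B unfolding P_def by blast
    moreover have "card (B - {b}) < card B" using B that by (intro card_Diff1_less)
    ultimately show False using not_less_Least[of "card (B - {b})" P] B by simp
  qed
  have "\<exists>!c. c \<in> B \<rightarrow>\<^sub>E BF \<and> x = (\<Sum>b\<in>B. c b * b)" for x
  proof (rule ex_ex1I)
    have "x \<in> fspan B" using B by simp
    then obtain c where "\<forall>a\<in>B. c a \<in> BF" "x = (\<Sum>b\<in>B. c b * b)" unfolding fspan_def by blast
    then show "\<exists>c. c \<in> B \<rightarrow>\<^sub>E BF \<and> x = (\<Sum>b\<in>B. c b * b)" by (intro exI[of _ "restrict c B"]) auto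
  next
    fix c d assume c: "c \<in> B \<rightarrow>\<^sub>E BF \<and> x = (\<Sum>b\<in>B. c b * b)" and d: "d \<in> B \<rightarrow>\<^sub>E BF \<and> x = (\<Sum>b\<in>B. d b * b)"
    show "c = d"
    proof (rule ccontr)
      assume "c \<noteq> d"
      moreover have "c b = d b" if "b \<notin> B" for b using c d that by (auto simp: PiE_def extensional_def)
      ultimately obtain b where b: "b \<in> B" "c b \<noteq> d b" by blast
      have "(\<Sum>z\<in>B. (c z - d z) * z) = 0" using c d by (simp add: left_diff_distrib sum_subtractf)
      then have "(c b - d b) * b + (\<Sum>z\<in>B - {b}. (c z - d z) * z) = 0"
        using B b by (simp add: sum.remove)
      then have eq: "(d b - c b) * b = (\<Sum>z\<in>B - {b}. (c z - d z) * z)"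
        by (simp add: algebra_simps add_eq_0_iff)
      have "(\<Sum>z\<in>B - {b}. (c z - d z) * z) \<in> fspan (B - {b})"
        using c d by (intro fspanI base_field_diff) auto
      then have "inverse (d b - c b) * ((d b - c b) * b) \<in> fspan (B - {b})"
        unfolding eq using c d b by (intro fspan_scale base_field_inverse base_field_diff) auto
      then have "b \<in> fspan (B - {b})" using b by (simp add: mult.assoc[symmetric])
      then show False using notin b by blast
    qed
  qed
  then show ?thesis using B unfolding finite_basis_over_def by blast
qed

section \<open>Coordinates and the trace\<close>

lemma coords:
  assumes B: "finite_basis_over BF B"
  shows "coords BF B x \<in> B \<rightarrow>\<^sub>E BF" "(\<Sum>b\<in>B. coords BF B x b * b) = x"
proof -
  have "coords BF B x \<in> B \<rightarrow>\<^sub>E BF \<and> x = (\<Sum>b\<in>B. coords BF B x b * b)"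
    unfolding coords_def
    by (rule theI'[where P = "\<lambda>c. c \<in> B \<rightarrow>\<^sub>E BF \<and> x = (\<Sum>b\<in>B. c b * b)"])
       (use B in \<open>simp add: finite_basis_over_def\<close>)
  then show "coords BF B x \<in> B \<rightarrow>\<^sub>E BF" "(\<Sum>b\<in>B. coords BF B x b * b) = x" by auto
qed

lemma coords_unique:
  assumes B: "finite_basis_over BF B" and c: "\<And>b. b \<in> B \<Longrightarrow> c b \<in> BF" and x: "x = (\<Sum>b\<in>B. c b * b)"
    and b: "b \<in> B"
  shows "coords BF B x b = c b"
proof -
  have "coords BF B x = restrict c B"
  proof -
    have "\<exists>!c. c \<in> B \<rightarrow>\<^sub>E BF \<and> x = (\<Sum>b\<in>B. c b * b)"
      using B by (simp add: finite_basis_over_def)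
    moreover have "restrict c B \<in> B \<rightarrow>\<^sub>E BF \<and> x = (\<Sum>b\<in>B. restrict c B b * b)"
      using c x by simp
    ultimately show ?thesis unfolding coords_def
      by (rule the1_equality[where P = "\<lambda>c. c \<in> B \<rightarrow>\<^sub>E BF \<and> x = (\<Sum>b\<in>B. c b * b)"])
  qed
  then show ?thesis using b by simp
qed

lemma coords_basis:
  assumes B: "finite_basis_over BF B" and b: "b \<in> B"
  shows "coords BF B b b = 1"
proof -
  have "finite B" using B by (simp add: finite_basis_over_def)
  have "(\<Sum>a\<in>B. (if a = b then 1 else 0) * a) = (\<Sum>a\<in>B. if a = b then a else 0)"
    by (intro sum.cong) auto
  also have "\<dots> = b" using \<open>finite B\<close> b by simp
  finally have "coords BF B b b = (if b = b then 1 else 0)"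
    by (intro coords_unique[OF B, where c = "\<lambda>a. if a = b then 1 else 0"])
       (auto simp: base_field_0 base_field_1 b)
  then show ?thesis by simp
qed

text \<open>A basis element is outside the closed span of the others, so
  \<open>coefficient_bound\<close> applies and its radius gives the constant
  \<open>1 / \<delta>\<close>.\<close>

lemma coords_bounded:
  assumes B: "finite_basis_over BF B" and b: "b \<in> B"
  shows "\<exists>K\<ge>0. \<forall>x. vn (coords BF B x b) \<le> K * vn x"
proof -
  have fin: "finite B" using B by (simp add: finite_basis_over_def)
  have "b \<notin> fspan (B - {b})"
  proof
    assume "b \<in> fspan (B - {b})"
    then obtain c where c: "\<forall>a\<in>B - {b}. c a \<in> BF" "b = (\<Sum>a\<in>B - {b}. c a * a)"
      unfolding fspan_def by blast
    have "coords BF B b b = (c(b := 0)) b"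
    proof (rule coords_unique[OF B, where c = "c(b := 0)"])
      show "b = (\<Sum>a\<in>B. (c(b := 0)) a * a)"
      proof -
        have "(\<Sum>a\<in>B. (c(b := 0)) a * a) = (\<Sum>a\<in>B - {b}. (c(b := 0)) a * a)"
          unfolding sum.remove[OF fin b] by simp
        also have "\<dots> = (\<Sum>a\<in>B - {b}. c a * a)" by (intro sum.cong) auto
        finally show ?thesis using c(2) by simp
      qed
    qed (use b c base_field_0 in auto)
    then show False using coords_basis[OF B b] by simp
  qed
  then obtain \<delta> where \<delta>: "\<delta> > 0" "\<And>w r. w \<in> fspan (B - {b}) \<Longrightarrow> r \<in> BF \<Longrightarrow> vn r * \<delta> \<le> vn (w + r * b)"
    using coefficient_bound[OF closed_fspan[of "B - {b}"]] fin by blast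
  have "vn (coords BF B x b) \<le> (1 / \<delta>) * vn x" for x
  proof -
    have "vn (coords BF B x b) * \<delta> \<le> vn ((\<Sum>a\<in>B - {b}. coords BF B x a * a) + coords BF B x b * b)"
      using coords(1)[OF B, of x] b by (intro \<delta>(2) fspanI) auto
    also have "(\<Sum>a\<in>B - {b}. coords BF B x a * a) + coords BF B x b * b = x"
      using coords(2)[OF B, of x] unfolding sum.remove[OF fin b] by (simp add: add.commute)
    finally show ?thesis using \<delta>(1) by (simp add: field_simps)
  qed
  then show ?thesis using \<delta>(1) by (intro exI[of _ "1 / \<delta>"]) auto
qed

abbreviation Tr :: "'v \<Rightarrow> 'v" where "Tr x \<equiv> field_trace base_field x"

text \<open>Everything is computed in the basis picked by \<open>SOME\<close>. Boundedness comes
  from that of the coordinates and makes the character continuous; the trace of 1 is the number of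
  basis elements, nonzero in characteristic 0, and underlies the nondegeneracy at archimedean
  places.\<close>

lemma trace_properties:
  assumes "\<exists>B. finite_basis_over BF B"
  shows "Tr x \<in> BF" "Tr (x + y) = Tr x + Tr y" "r \<in> BF \<Longrightarrow> Tr (r * x) = r * Tr x"
    "\<exists>K\<ge>0. \<forall>x. vn (Tr x) \<le> K * vn x" "Tr 1 \<noteq> 0"
proof -
  define B where "B = (SOME B. finite_basis_over BF B)"
  have B: "finite_basis_over BF B" unfolding B_def using assms by (rule someI_ex)
  have fin: "finite B" using B by (simp add: finite_basis_over_def)
  have Tr: "Tr x = (\<Sum>b\<in>B. coords BF B (x * b) b)" for x
    by (simp add: field_trace_def B_def Let_def)
  have cB: "coords BF B x b \<in> BF" if "b \<in> B" for x b using coords(1)[OF B, of x] that by auto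
  show "Tr x \<in> BF" unfolding Tr by (intro base_field_sum cB)
  have add: "coords BF B (x + y) b = coords BF B x b + coords BF B y b" if "b \<in> B" for x y b
    by (rule coords_unique[OF B, where c = "\<lambda>b. coords BF B x b + coords BF B y b"])
       (use that in \<open>auto intro: base_field_add cB simp: distrib_right sum.distrib coords(2)[OF B]\<close>)
  show "Tr (x + y) = Tr x + Tr y" unfolding Tr by (simp add: distrib_right add sum.distrib)
  have scale: "coords BF B (r * x) b = r * coords BF B x b" if "b \<in> B" "r \<in> BF" for r x b
    by (rule coords_unique[OF B, where c = "\<lambda>b. r * coords BF B x b"])
       (use that in \<open>auto intro: base_field_mult cB simp: mult.assoc sum_distrib_left[symmetric] coords(2)[OF B]\<close>)
  show "Tr (r * x) = r * Tr x" if "r \<in> BF"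
    unfolding Tr using that by (simp add: mult.assoc scale sum_distrib_left)
  have "\<forall>b\<in>B. \<exists>K\<ge>0. \<forall>x. vn (coords BF B x b) \<le> K * vn x" using coords_bounded[OF B] by blast
  then obtain K where K: "\<And>b. b \<in> B \<Longrightarrow> 0 \<le> K b" "\<And>b x. b \<in> B \<Longrightarrow> vn (coords BF B x b) \<le> K b * vn x"
    by metis
  have vn_sum: "vn (sum f A) \<le> (\<Sum>a\<in>A. vn (f a))" for f :: "'v \<Rightarrow> 'v" and A
    by (induction A rule: infinite_finite_induct) (auto intro: order_trans[OF vn_add])
  have "vn (Tr x) \<le> (\<Sum>b\<in>B. K b * vn b) * vn x" for x
  proof -
    have "vn (Tr x) \<le> (\<Sum>b\<in>B. vn (coords BF B (x * b) b))" unfolding Tr by (rule vn_sum)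
    also have "\<dots> \<le> (\<Sum>b\<in>B. K b * vn (x * b))" by (intro sum_mono K)
    also have "\<dots> = (\<Sum>b\<in>B. K b * vn b) * vn x"
      unfolding sum_distrib_right by (intro sum.cong) (simp_all add: vn_mult)
    finally show ?thesis .
  qed
  moreover have "0 \<le> (\<Sum>b\<in>B. K b * vn b)" by (intro sum_nonneg mult_nonneg_nonneg K) auto
  ultimately show "\<exists>K\<ge>0. \<forall>x. vn (Tr x) \<le> K * vn x" by blast
  have "Tr 1 = of_nat (card B)" unfolding Tr by (simp add: coords_basis[OF B])
  moreover have "B \<noteq> {}" using coords(2)[OF B, of 1] by auto
  ultimately show "Tr 1 \<noteq> 0" using fin by simp
qed

end

section \<open>Completions as finite extensions of the base field\<close>

lemma completion_valued_field:
  assumes "is_completion v (\<iota> :: 'k::field_char_0 \<Rightarrow> 'v::{field_char_0,complete_space})"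
  shows "valued_field TYPE('v)"
  using assms unfolding is_completion_def by unfold_locales blast+

text \<open>The images of a spanning set over the rationals have a span over the base field that is
  closed and contains the dense image of \<open>\<iota>\<close>; hence it is everything.\<close>

lemma completion_finite_basis:
  fixes \<iota> :: "'k::field_char_0 \<Rightarrow> 'v::{field_char_0,complete_space}"
  assumes nf: "number_field TYPE('k)" and c: "is_completion v \<iota>"
  shows "\<exists>B. finite_basis_over (base_field :: 'v set) B"
proof -
  interpret valued_field "TYPE('v)" by (rule completion_valued_field[OF c])
  have add: "\<iota> (a + b) = \<iota> a + \<iota> b" and mult: "\<iota> (a * b) = \<iota> a * \<iota> b" and one: "\<iota> 1 = 1"
    and dense: "closure (range \<iota>) = UNIV" for a b
    using c unfolding is_completion_def by blast+
  have zero: "\<iota> 0 = 0" using add[of 0 0] by simp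
  have minus: "\<iota> (- a) = - \<iota> a" for a using add[of "- a" a] by (simp add: zero add_eq_0_iff2)
  have nat: "\<iota> (of_nat n) = of_nat n" for n by (induction n) (simp_all add: zero one add)
  have int: "\<iota> (of_int n) = of_int n" for n by (cases n rule: int_cases2) (simp_all add: nat minus)
  have rat: "\<iota> (of_rat q) = of_rat q" for q
  proof -
    obtain a b where q: "q = Fract a b" "b > 0" by (cases q) auto
    have "\<iota> (of_rat q) * of_int b = \<iota> (of_rat q * of_int b)" by (simp add: mult int)
    also have "of_rat q * of_int b = (of_int a :: 'k)" using q by (simp add: of_rat_rat)
    finally show ?thesis using q by (simp add: int of_rat_rat field_simps)
  qed
  have sum: "\<iota> (sum f A) = (\<Sum>a\<in>A. \<iota> (f a))" for f :: "'k \<Rightarrow> 'k" and A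
    by (induction A rule: infinite_finite_induct) (auto simp: zero add)
  have inj: "inj \<iota>"
  proof (rule injI)
    fix a b assume "\<iota> a = \<iota> b"
    then have z: "\<iota> (a - b) = 0" using add[of a "- b"] by (simp add: minus)
    show "a = b"
    proof (rule ccontr)
      assume "a \<noteq> b"
      then have "\<iota> ((a - b) * inverse (a - b)) = 1" by (simp add: one)
      then show False unfolding mult z by simp
    qed
  qed
  obtain B :: "'k set" where B: "finite B" "\<And>x. \<exists>u. x = (\<Sum>b\<in>B. of_rat (u b) * b)"
    using countable_number_field(2)[OF nf] by blast
  have "range \<iota> \<subseteq> fspan (\<iota> ` B)"
  proof clarify
    fix x
    obtain u where "x = (\<Sum>b\<in>B. of_rat (u b) * b)" using B(2) by blast
    then have "\<iota> x = (\<Sum>b\<in>B. of_rat (u b) * \<iota> b)" by (simp add: sum mult rat)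
    also have "\<dots> = (\<Sum>a\<in>\<iota> ` B. of_rat (u (inv \<iota> a)) * a)"
      using inj by (subst sum.reindex) (auto simp: inj_on_def)
    also have "\<dots> \<in> fspan (\<iota> ` B)" by (intro fspanI Rats_base_field) auto
    finally show "\<iota> x \<in> fspan (\<iota> ` B)" .
  qed
  then have "closure (range \<iota>) \<subseteq> fspan (\<iota> ` B)" using B by (intro closure_minimal closed_fspan) auto
  then show ?thesis using dense B by (intro finite_basis_from_spanning[of "\<iota> ` B"]) auto
qed

section \<open>Finite places\<close>

text \<open>Local compactness enters as one compact ball of positive radius. It will be read off
  from the support of a nonzero Schwartz--Bruhat function.\<close>

locale nonarch_field = valued_field ty for ty :: "'v::{field_char_0,complete_space} itself" +
  assumes ultra: "\<And>x y :: 'v. dist (x + y) 0 \<le> max (dist x 0) (dist y 0)"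
    and nontrivial: "\<exists>x::'v. x \<noteq> 0 \<and> dist x 0 \<noteq> 1"
    and some_compact_ball: "\<exists>(a::'v) r. 0 < r \<and> compact (cball a r)"
begin

lemma finite_place: "finite_place TYPE('v)"
  using ultra by (simp add: finite_place_def)

lemma ultra_diff: "vn (x - y) \<le> max (vn x) (vn y)"
  using ultra[of x "- y"] by (simp add: vn_minus)

lemma vn_diff_commute: "vn (x - y) = vn (y - x)"
  using vn_minus[of "x - y"] by simp

lemma exists_small: "\<exists>z. z \<noteq> 0 \<and> vn z < 1"
proof -
  obtain x :: 'v where "x \<noteq> 0" "vn x \<noteq> 1" using nontrivial by blast
  then consider "vn x < 1" | "vn (inverse x) < 1"
    by (cases "vn x < 1") (auto simp: vn_inverse inverse_less_1_iff)
  moreover have "inverse x \<noteq> 0" using \<open>x \<noteq> 0\<close> by simp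
  ultimately show ?thesis using \<open>x \<noteq> 0\<close> by blast
qed

text \<open>Multiplication by a high power of an element of absolute value below 1 shrinks the ball
  until a translate fits into the given compact ball; the inverse affine map is continuous.\<close>

lemma compact_vball: "compact {x. vn x \<le> R}"
proof -
  obtain a :: 'v and r where r: "0 < r" "compact (cball a r)" using some_compact_ball by blast
  obtain z where z: "z \<noteq> 0" "vn z < 1" using exists_small by blast
  have "\<exists>n. vn z ^ n * R \<le> r"
  proof -
    have "(\<lambda>n. vn z ^ n * R) \<longlonglongrightarrow> 0 * R"
      using z by (intro tendsto_mult LIMSEQ_power_zero tendsto_const) auto
    then have "\<forall>\<^sub>F n in sequentially. vn z ^ n * R < r"
      using r by (intro order_tendstoD(2)[of _ 0]) auto
    then show ?thesis using eventually_happens' sequentially_bot less_imp_le by blast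
  qed
  then obtain n where n: "vn z ^ n * R \<le> r" ..
  have "{x. vn x \<le> R} \<subseteq> (\<lambda>x. inverse (z ^ n) * x) ` (\<lambda>x. - a + x) ` cball a r"
  proof clarify
    fix x assume "vn x \<le> R"
    then have "vn (z ^ n * x) \<le> r"
      using n mult_left_mono[of "vn x" R "vn z ^ n"] by (simp add: vn_mult vn_power)
    then have "a + z ^ n * x \<in> cball a r"
      using dist_diff[of "a + z ^ n * x" a] by (simp add: dist_commute)
    moreover have "x = inverse (z ^ n) * (- a + (a + z ^ n * x))" using z by simp
    ultimately show "x \<in> (\<lambda>x. inverse (z ^ n) * x) ` (\<lambda>x. - a + x) ` cball a r" by blast
  qed
  moreover have "compact ((\<lambda>x. inverse (z ^ n) * x) ` (\<lambda>x. - a + x) ` cball a r)"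
    by (intro compact_continuous_image continuous_on_subset[OF continuous_vmult]
        continuous_on_subset[OF continuous_vadd] r) auto
  moreover have "closed {x. vn x \<le> R}"
    by (intro closed_Collect_le continuous_intros)
  ultimately show ?thesis using closed_subset compact_Int_closed[of _ "{x. vn x \<le> R}"]
    by (metis inf.absorb_iff2)
qed

section \<open>Uniformizers, residue classes and the normalized modulus\<close>

text \<open>By the ultrametric inequality the open unit ball is also closed, hence compact, and the
  absolute value attains its maximum there.\<close>

lemma uniformizer_exists: "\<exists>\<pi>::'v. uniformizer \<pi>"
proof -
  have "{x. vn x < 1} = {x. vn x \<le> 1} \<inter> {x. vn x < 1}" by auto
  moreover have "closed {x. vn x < 1}"
  proof -
    have "\<exists>T. open T \<and> x \<in> T \<and> T \<subseteq> - {x. vn x < 1}" if x: "x \<in> - {x. vn x < 1}" for x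
    proof (intro exI[of _ "ball x 1"] conjI subsetI ComplI)
      fix y assume "y \<in> ball x 1" "y \<in> {x. vn x < 1}"
      then have "vn (x - y) < 1" "vn y < 1" using dist_diff[of x y] by auto
      then have "vn x < 1" using ultra[of "x - y" y] by simp
      then show False using x by simp
    qed auto
    then have "open (- {x. vn x < 1})" by (subst open_subopen) blast
    then show ?thesis by (simp add: closed_def)
  qed
  ultimately have "compact {x. vn x < 1}" using compact_vball compact_Int_closed by metis
  moreover have "{x. vn x < 1} \<noteq> {}" using exists_small by blast
  moreover have "continuous_on {x. vn x < 1} vn" by (intro continuous_intros)
  ultimately have "\<exists>x\<in>{x. vn x < 1}. \<forall>y\<in>{x. vn x < 1}. vn y \<le> vn x"
    by (rule continuous_attains_sup)
  then obtain \<pi> where \<pi>: "vn \<pi> < 1" "\<And>x. vn x < 1 \<Longrightarrow> vn x \<le> vn \<pi>" by blast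
  have "\<pi> \<noteq> 0" using exists_small \<pi>(2) by force
  then have "uniformizer \<pi>" using \<pi> by (auto simp: uniformizer_def)
  then show ?thesis ..
qed

definition pi_v :: 'v where "pi_v = (SOME \<pi>. uniformizer \<pi>)"
definition \<rho> :: real where "\<rho> = vn pi_v"

lemma uniformizer_pi_v: "uniformizer pi_v"
  unfolding pi_v_def using uniformizer_exists by (rule someI_ex)

lemma rho: "0 < \<rho>" "\<rho> < 1" and rho_max: "vn x < 1 \<Longrightarrow> vn x \<le> \<rho>"
  using uniformizer_pi_v by (auto simp: uniformizer_def \<rho>_def)

lemma uniformizer_vn: "uniformizer \<pi> \<Longrightarrow> vn \<pi> = \<rho>" for \<pi> :: 'v
  using uniformizer_pi_v by (auto simp: uniformizer_def \<rho>_def intro: order_antisym)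

lemma rho_powi_less_iff: "\<rho> powi m < \<rho> powi n \<longleftrightarrow> n < m"
proof -
  have *: "\<rho> powi b < \<rho> powi a" if "a < b" for a b
  proof -
    have "\<rho> powi b = \<rho> powi a * \<rho> powi (b - a)" using rho by (simp add: power_int_add[symmetric])
    also have "\<rho> powi (b - a) < 1"
      using that rho by (simp add: power_int_def power_less_one_iff)
    finally show ?thesis using rho by simp
  qed
  show ?thesis using *[of m n] *[of n m] by (cases m n rule: linorder_cases) auto
qed

lemma rho_powi_le_iff: "\<rho> powi m \<le> \<rho> powi n \<longleftrightarrow> n \<le> m"
  using rho_powi_less_iff[of n m] by linarith

lemma rho_powi_eq_iff: "\<rho> powi m = \<rho> powi n \<longleftrightarrow> m = n"
  using rho_powi_le_iff[of n m] rho_powi_le_iff[of m n] by auto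

text \<open>The floor is chosen so that dividing \<open>x\<close> by \<open>pi_v powi n\<close>
  leaves an absolute value above \<open>\<rho>\<close> and at most 1. No value lies strictly between
  \<open>\<rho>\<close> and 1, so it equals 1.\<close>

lemma value_group: assumes "x \<noteq> 0" shows "\<exists>n. vn x = \<rho> powi n"
proof -
  have "0 < vn x" using assms by simp
  define n where "n = \<lfloor>ln (vn x) / ln \<rho>\<rfloor>"
  have ln_rho: "ln \<rho> < 0" using rho by simp
  have pw: "\<rho> powi m = exp (real_of_int m * ln \<rho>)" for m
    using rho by (simp add: powr_real_of_int'[symmetric] powr_def)
  have "real_of_int n \<le> ln (vn x) / ln \<rho>" "ln (vn x) / ln \<rho> < real_of_int (n + 1)"
    unfolding n_def by linarith+
  then have "ln (vn x) \<le> real_of_int n * ln \<rho>" "real_of_int (n + 1) * ln \<rho> < ln (vn x)"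
    using ln_rho by (simp_all add: neg_le_divide_eq neg_divide_less_eq)
  then have "vn x \<le> \<rho> powi n" "\<rho> powi (n + 1) < vn x"
    unfolding pw using \<open>0 < vn x\<close> by (metis exp_le_cancel_iff exp_ln, metis exp_less_cancel_iff exp_ln)
  moreover have "vn (x / pi_v powi n) = vn x / \<rho> powi n"
    by (simp add: vn_divide vn_powi \<rho>_def)
  ultimately have "vn (x / pi_v powi n) \<le> 1" "\<rho> < vn (x / pi_v powi n)"
    using rho by (simp_all add: divide_le_eq less_divide_eq power_int_add mult.commute)
  then have "vn (x / pi_v powi n) = 1" using rho_max[of "x / pi_v powi n"] by linarith
  then have "vn x / \<rho> powi n = 1" by (simp only: \<open>vn (x / pi_v powi n) = vn x / \<rho> powi n\<close>)
  then have "vn x = \<rho> powi n" by (simp add: divide_eq_1_iff)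
  then show ?thesis ..
qed

lemma vn_valuation: assumes "x \<noteq> 0" shows "vn x = \<rho> powi valuation x"
proof -
  obtain n where n: "vn x = \<rho> powi n" using value_group[OF assms] by blast
  have "valuation x = n" unfolding valuation_def
  proof (rule the_equality)
    show "\<exists>\<pi>::'v. uniformizer \<pi> \<and> vn x = vn \<pi> powi n"
      using uniformizer_pi_v n by (auto simp: \<rho>_def)
    fix m assume "\<exists>\<pi>::'v. uniformizer \<pi> \<and> vn x = vn \<pi> powi m"
    then show "m = n" using n uniformizer_vn rho_powi_eq_iff by metis
  qed
  then show ?thesis using n by simp
qed

abbreviation resid_rel :: "('v \<times> 'v) set" where
  "resid_rel \<equiv> {(x, y). vn x \<le> 1 \<and> vn y \<le> 1 \<and> vn (x - y) < 1}"
abbreviation resid :: "'v set set" where "resid \<equiv> {x. vn x \<le> 1} // resid_rel"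

lemma equiv_resid: "equiv {x. vn x \<le> 1} resid_rel"
proof (rule equivI)
  show "resid_rel \<subseteq> {x. vn x \<le> 1} \<times> {x. vn x \<le> 1}" by auto
  show "refl_on {x. vn x \<le> 1} resid_rel" by (auto simp: refl_on_def)
  show "sym resid_rel" by (rule symI) (auto simp: vn_diff_commute)
  show "trans resid_rel"
  proof (rule transI)
    fix x y z assume "(x, y) \<in> resid_rel" "(y, z) \<in> resid_rel"
    then show "(x, z) \<in> resid_rel" using ultra[of "x - y" "y - z"] by auto
  qed
qed

lemma resid_class: assumes "vn a \<le> 1" shows "resid_rel `` {a} = {y. vn (a - y) < 1}"
proof -
  have "vn y \<le> 1" if "vn (a - y) < 1" for y
    using ultra_diff[of a "a - y"] that assms by simp
  then show ?thesis using assms by auto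
qed

text \<open>An open ball of radius 1 about an integral element lies in a single residue class, so a
  finite subcover of the compact unit ball meets all classes.\<close>

lemma finite_resid: "finite resid"
proof -
  obtain T where T: "T \<subseteq> {x. vn x \<le> 1}" "finite T" "{x. vn x \<le> 1} \<subseteq> (\<Union>t\<in>T. ball t 1)"
    using compactE_image[OF compact_vball[of 1], of "{x. vn x \<le> 1}" "\<lambda>t. ball t 1"] by force
  have "resid \<subseteq> (\<lambda>t. resid_rel `` {t}) ` T"
  proof
    fix X assume "X \<in> resid"
    then obtain x where x: "vn x \<le> 1" "X = resid_rel `` {x}" by (auto elim: quotientE)
    then obtain t where t: "t \<in> T" "dist t x < 1" using T(3) by auto
    then have "(t, x) \<in> resid_rel" using x T(1) dist_diff[of t x] by auto
    then have "resid_rel `` {t} = X" using equiv_class_eq[OF equiv_resid] x by blast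
    then show "X \<in> (\<lambda>t. resid_rel `` {t}) ` T" using t by blast
  qed
  then show ?thesis using T(2) finite_surj by blast
qed

definition q :: nat where "q = residue_card TYPE('v)"

lemma q_ge_2: "2 \<le> q"
proof -
  have "resid_rel `` {0} \<in> resid" by (rule quotientI) simp
  moreover have "resid_rel `` {1} \<in> resid" by (rule quotientI) (simp add: vn_one)
  moreover have "resid_rel `` {0} \<noteq> resid_rel `` {1}"
    using vn_one by (subst (1 2) resid_class) (auto simp: set_eq_iff intro!: exI[of _ 0])
  ultimately have "card {resid_rel `` {0}, resid_rel `` {1}} \<le> card resid"
    by (intro card_mono finite_resid) auto
  then show ?thesis using \<open>resid_rel `` {0} \<noteq> resid_rel `` {1}\<close> by (simp add: q_def residue_card_def)
qed

lemma nabs_eq: "nabs x = (if x = 0 then 0 else real q powi (- valuation x))" for x :: 'v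
  using finite_place by (simp add: nabs_def q_def)

lemma q_powi_le_iff: "real q powi m \<le> real q powi n \<longleftrightarrow> m \<le> n"
  using q_ge_2 by (metis of_nat_1 of_nat_less_iff power_int_increasing power_int_strict_increasing not_le less_imp_le Suc_1 Suc_le_eq)

text \<open>Indexed by valuation, so that the balls shrink as \<open>n\<close> grows; in terms of
  \<open>nabs\<close> the index changes sign.\<close>

definition vball :: "int \<Rightarrow> 'v set" where "vball n = {x. vn x \<le> \<rho> powi n}"

lemma nabs_le_iff: "nabs x \<le> real q powi k \<longleftrightarrow> x \<in> vball (- k)"
proof (cases "x = 0")
  case True then show ?thesis using rho q_ge_2 by (simp add: nabs_eq vball_def)
next
  case False
  then have "nabs x \<le> real q powi k \<longleftrightarrow> - valuation x \<le> k"
    by (simp add: nabs_eq q_powi_le_iff)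
  also have "\<dots> \<longleftrightarrow> x \<in> vball (- k)"
    unfolding vball_def mem_Collect_eq vn_valuation[OF False] rho_powi_le_iff by linarith
  finally show ?thesis .
qed

lemma compact_vball': "compact (vball n)"
  unfolding vball_def by (rule compact_vball)

text \<open>The exponent is determined by sending \<open>\<rho>\<close> to \<open>1 / q\<close>.
  Measurability and bounds thereby pass from the given absolute value to the normalized one.\<close>

lemma nabs_powr: "\<exists>s>0. \<forall>x::'v. nabs x = vn x powr s"
proof -
  define s where "s = ln (real q) / (- ln \<rho>)"
  have "s > 0" using q_ge_2 rho unfolding s_def by (intro divide_pos_pos) auto
  moreover have "nabs x = vn x powr s" for x :: 'v
  proof (cases "x = 0")
    case False
    have pw: "a powi m = exp (real_of_int m * ln a)" if "a > 0" for m and a :: real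
      using that by (simp add: powr_real_of_int'[symmetric] powr_def)
    have "vn x powr s = exp (s * ln (\<rho> powi valuation x))"
      using False vn_valuation[OF False] rho(1) by (simp add: powr_def)
    also have "ln (\<rho> powi valuation x) = real_of_int (valuation x) * ln \<rho>" using rho by (simp add: pw)
    also have "s * (real_of_int (valuation x) * ln \<rho>) = real_of_int (- valuation x) * ln (real q)"
      using rho by (simp add: s_def)
    also have "exp \<dots> = nabs x" using False q_ge_2 by (subst pw[symmetric]) (auto simp: nabs_eq)
    finally show ?thesis by simp
  qed (simp add: nabs_eq)
  ultimately show ?thesis by blast
qed

lemma nabs_measurable: "(nabs :: 'v \<Rightarrow> real) \<in> borel_measurable borel"
proof -
  obtain s where "\<forall>x::'v. nabs x = vn x powr s" using nabs_powr by blast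
  then have eq: "nabs = (\<lambda>x::'v. vn x powr s)" by auto
  have [measurable]: "vn \<in> borel_measurable borel"
    by (intro borel_measurable_continuous_onI continuous_intros)
  show ?thesis unfolding eq by measurable
qed

end

section \<open>Haar measure of balls\<close>

context valued_field
begin

lemma haar_space: "haar_measure \<mu> \<Longrightarrow> space \<mu> = (UNIV :: 'v set)"
  unfolding haar_measure_def by (metis sets_eq_imp_space_eq space_borel)

lemma haar_translate:
  assumes \<mu>: "haar_measure \<mu>" and S: "S \<in> sets (borel :: 'v measure)"
  shows "emeasure \<mu> ((\<lambda>x. a + x) ` S) = emeasure \<mu> S"
proof -
  have sets: "sets \<mu> = sets borel" using \<mu> by (simp add: haar_measure_def)
  have meas: "(\<lambda>x. - a + x) \<in> measurable \<mu> borel"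
    unfolding measurable_cong_sets[OF sets refl]
    by (rule borel_measurable_continuous_onI[OF continuous_vadd])
  have "distr \<mu> borel (\<lambda>x. - a + x) = \<mu>" using \<mu> unfolding haar_measure_def by blast
  then have "emeasure \<mu> S = emeasure (distr \<mu> borel (\<lambda>x. - a + x)) S" by (simp only:)
  also have "\<dots> = emeasure \<mu> ((\<lambda>x. - a + x) -` S \<inter> space \<mu>)"
    using meas S by (rule emeasure_distr)
  also have "(\<lambda>x. - a + x) -` S \<inter> space \<mu> = (\<lambda>x. a + x) ` S"
  proof (intro set_eqI iffI)
    fix x assume "x \<in> (\<lambda>x. - a + x) -` S \<inter> space \<mu>"
    then show "x \<in> (\<lambda>x. a + x) ` S" by (intro image_eqI[of _ _ "- a + x"]) auto
  qed (auto simp: haar_space[OF \<mu>])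
  finally show ?thesis by simp
qed

end

context nonarch_field
begin

lemma closed_vball: "closed (vball n)"
  using compact_vball' by (rule compact_imp_closed)

text \<open>Absolute value below 1 means at most \<open>\<rho>\<close>, so a residue class is a
  translate of the closed ball of radius \<open>\<rho>\<close>; scaling by
  \<open>pi_v powi n\<close> preserves this shape.\<close>

lemma scaled_class:
  assumes "vn a \<le> 1"
  shows "(\<lambda>x. pi_v powi n * x) ` (resid_rel `` {a}) = (\<lambda>x. pi_v powi n * a + x) ` vball (n + 1)"
proof -
  have pi0: "pi_v powi n \<noteq> 0" using rho(1) by (auto simp: \<rho>_def power_int_eq_0_iff)
  have pn: "vn (pi_v powi n) = \<rho> powi n" by (simp add: vn_powi \<rho>_def)
  have rn: "\<rho> powi n > 0" using rho by simp
  show ?thesis unfolding resid_class[OF assms]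
  proof (intro set_eqI iffI)
    fix z assume "z \<in> (\<lambda>x. pi_v powi n * x) ` {y. vn (a - y) < 1}"
    then obtain y where y: "vn (a - y) < 1" "z = pi_v powi n * y" by blast
    have "vn (y - a) \<le> \<rho>" using y rho_max vn_diff_commute by metis
    then have "\<rho> powi n * vn (y - a) \<le> \<rho> powi n * \<rho>" using rn by (intro mult_left_mono) auto
    then have "vn (pi_v powi n * (y - a)) \<le> \<rho> powi (n + 1)"
      using rho by (simp add: vn_mult pn power_int_add)
    then have "pi_v powi n * (y - a) \<in> vball (n + 1)" by (simp add: vball_def)
    moreover have "z = pi_v powi n * a + pi_v powi n * (y - a)" using y by (simp add: algebra_simps)
    ultimately show "z \<in> (\<lambda>x. pi_v powi n * a + x) ` vball (n + 1)" by blast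
  next
    fix z assume "z \<in> (\<lambda>x. pi_v powi n * a + x) ` vball (n + 1)"
    then obtain x where x: "vn x \<le> \<rho> powi (n + 1)" "z = pi_v powi n * a + x"
      unfolding vball_def by blast
    let ?y = "a + x / pi_v powi n"
    have "vn (a - ?y) = vn x / \<rho> powi n" by (simp add: vn_minus vn_divide pn)
    also have "\<dots> \<le> \<rho>" using x rn rho by (simp add: divide_le_eq power_int_add mult.commute)
    finally have "vn (a - ?y) < 1" using rho by simp
    moreover have "z = pi_v powi n * ?y" using x pi0 by (simp add: distrib_left)
    ultimately show "z \<in> (\<lambda>x. pi_v powi n * x) ` {y. vn (a - y) < 1}" by blast
  qed
qed

lemma vball_decomposition: "vball n = (\<Union>X\<in>resid. (\<lambda>x. pi_v powi n * x) ` X)"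
proof -
  have pi0: "pi_v powi n \<noteq> 0" using rho(1) by (auto simp: \<rho>_def power_int_eq_0_iff)
  have pn: "vn (pi_v powi n) = \<rho> powi n" by (simp add: vn_powi \<rho>_def)
  have rn: "\<rho> powi n > 0" using rho by simp
  have "(\<Union>X\<in>resid. (\<lambda>x. pi_v powi n * x) ` X) = (\<lambda>x. pi_v powi n * x) ` (\<Union>resid)" by blast
  also have "\<Union>resid = {x. vn x \<le> 1}" using equiv_resid by (rule Union_quotient)
  also have "(\<lambda>x. pi_v powi n * x) ` {x. vn x \<le> 1} = vball n"
  proof (intro set_eqI iffI)
    fix z assume "z \<in> (\<lambda>x. pi_v powi n * x) ` {x. vn x \<le> 1}"
    then obtain x where x: "vn x \<le> 1" "z = pi_v powi n * x" by blast
    then show "z \<in> vball n" using rn by (simp add: vball_def vn_mult pn mult_left_le)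
  next
    fix z assume "z \<in> vball n"
    then have "vn (z / pi_v powi n) \<le> 1" using rn by (simp add: vball_def vn_divide pn)
    moreover have "z = pi_v powi n * (z / pi_v powi n)" using pi0 by simp
    ultimately show "z \<in> (\<lambda>x. pi_v powi n * x) ` {x. vn x \<le> 1}" by blast
  qed
  finally show ?thesis by simp
qed

text \<open>The scaled residue classes split \<open>vball n\<close> into \<open>q\<close> disjoint
  translates of \<open>vball (n + 1)\<close>, and translation invariance does the rest.\<close>

lemma emeasure_vball_step:
  assumes \<mu>: "haar_measure \<mu>"
  shows "emeasure \<mu> (vball n) = of_nat q * emeasure \<mu> (vball (n + 1))"
proof -
  let ?S = "\<lambda>X. (\<lambda>x. pi_v powi n * x) ` X"
  have sets: "sets \<mu> = sets borel" using \<mu> by (simp add: haar_measure_def)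
  have S: "\<exists>a. ?S X = (\<lambda>x. a + x) ` vball (n + 1)" if X: "X \<in> resid" for X
  proof -
    obtain a where "X = resid_rel `` {a}" "vn a \<le> 1" using X by (auto elim!: quotientE)
    then show ?thesis using scaled_class by blast
  qed
  have S_sets: "?S X \<in> sets \<mu>" if X: "X \<in> resid" for X
  proof -
    obtain a where "?S X = (\<lambda>x. a + x) ` vball (n + 1)" using S[OF X] by blast
    then have "compact (?S X)"
      using compact_continuous_image[OF continuous_on_subset[OF continuous_vadd[of a]] compact_vball'] by simp
    then show ?thesis unfolding sets by (intro borel_closed compact_imp_closed)
  qed
  have S_meas: "emeasure \<mu> (?S X) = emeasure \<mu> (vball (n + 1))" if X: "X \<in> resid" for X
  proof -
    obtain a where "?S X = (\<lambda>x. a + x) ` vball (n + 1)" using S[OF X] by blast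
    then show ?thesis using haar_translate[OF \<mu>, of "vball (n + 1)" a] closed_vball by simp
  qed
  have disj: "disjoint_family_on ?S resid"
    unfolding disjoint_family_on_def
  proof (intro ballI impI)
    fix X Y assume XY: "X \<in> resid" "Y \<in> resid" "X \<noteq> Y"
    have "pi_v powi n \<noteq> 0" using rho(1) by (auto simp: \<rho>_def power_int_eq_0_iff)
    then have "inj (\<lambda>x. pi_v powi n * x)" by (intro injI) (metis mult_left_cancel)
    then have "?S X \<inter> ?S Y = ?S (X \<inter> Y)" by (rule image_Int[symmetric])
    also have "X \<inter> Y = {}" using quotient_disj[OF equiv_resid] XY by blast
    finally show "?S X \<inter> ?S Y = {}" by simp
  qed
  have "emeasure \<mu> (vball n) = (\<Sum>X\<in>resid. emeasure \<mu> (?S X))"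
    unfolding vball_decomposition using S_sets disj finite_resid
    by (intro sum_emeasure[symmetric]) auto
  also have "\<dots> = of_nat (card resid) * emeasure \<mu> (vball (n + 1))" using S_meas by simp
  also have "card resid = q" by (simp add: q_def residue_card_def)
  finally show ?thesis .
qed

lemma emeasure_vball:
  assumes \<mu>: "haar_measure \<mu>"
  shows "emeasure \<mu> (vball n) = ennreal (measure \<mu> (vball 0) * real q powi (- n))"
proof -
  have fin: "emeasure \<mu> (vball n) \<noteq> \<infinity>" for n
    using \<mu> compact_vball'[of n] unfolding haar_measure_def by (simp add: less_top)
  have step: "measure \<mu> (vball n) = real q * measure \<mu> (vball (n + 1))" for n
    unfolding measure_def emeasure_vball_step[OF \<mu>, of n] by (simp add: enn2real_mult)
  have q0: "real q \<noteq> 0" using q_ge_2 by simp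
  have "measure \<mu> (vball n) = measure \<mu> (vball 0) * real q powi (- n)"
  proof (induction n rule: int_induct[where k = 0])
    case base then show ?case by simp
  next
    case (step1 i)
    have "real q powi (- i) = real q * real q powi (- (i + 1))"
      using q0 power_int_add[of "real q" 1 "- (i + 1)"] by simp
    then show ?case using step[of i] step1 q0 by simp
  next
    case (step2 i)
    have "real q powi (- (i - 1)) = real q * real q powi (- i)"
      using q0 power_int_add[of "real q" 1 "- i"] by (simp add: algebra_simps)
    then show ?case using step[of "i - 1"] step2 q0 by simp
  qed
  then show ?thesis using fin[of n] emeasure_eq_ennreal_measure[of \<mu> "vball n"] by simp
qed

section \<open>The p-adic fractional part and the additive character\<close>

lemma vn_of_nat_le: "vn (of_nat n) \<le> 1"
proof (induction n)
  case (Suc n) then show ?case using ultra[of 1 "of_nat n"] by (simp add: vn_one)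
qed simp

lemma vn_of_int_le: "vn (of_int n) \<le> 1"
  by (cases n rule: int_cases2) (simp_all add: vn_of_nat_le vn_minus)

text \<open>Infinitely many natural numbers fall into finitely many residue classes, so some
  positive difference has absolute value below 1. A prime factor of absolute value 1 can be
  cancelled from it, and this descent ends at a prime of absolute value below 1.\<close>

lemma residue_char_exists: "\<exists>p. prime p \<and> vn (of_nat p) < 1"
proof -
  let ?c = "\<lambda>n::nat. resid_rel `` {of_nat n}"
  have "range ?c \<subseteq> resid"
    by (intro image_subsetI quotientI) (simp add: vn_of_nat_le)
  then have "finite (range ?c)" using finite_resid by (rule finite_subset)
  then have "\<not> inj ?c" using finite_imageD[of ?c UNIV] by auto
  then obtain i j where ij: "?c i = ?c j" "i \<noteq> j" unfolding inj_def by auto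
  define m n where "m = min i j" and "n = max i j"
  have mn: "m < n" "?c m = ?c n" using ij by (auto simp: m_def n_def min_def max_def)
  have "of_nat n \<in> ?c m" using mn equiv_resid by (auto simp: vn_of_nat_le)
  then have "vn (of_nat n - of_nat m) < 1" by (simp add: vn_diff_commute)
  then have "vn (of_nat (n - m)) < 1" using mn by (simp add: of_nat_diff)
  moreover have "0 < n - m" using mn by simp
  moreover have "\<exists>p. prime p \<and> vn (of_nat p) < 1" if "0 < k" "vn (of_nat k) < 1" for k
    using that
  proof (induction k rule: less_induct)
    case (less k)
    then have "k \<noteq> 1" using vn_one by auto
    then obtain p where p: "prime p" "p dvd k" using prime_factor_nat by blast
    then obtain m where m: "k = p * m" by blast
    show ?case
    proof (cases "vn (of_nat p) < 1")
      case False
      then have "vn (of_nat m) < 1"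
        using less.prems m vn_of_nat_le[of p] by (simp add: vn_mult)
      moreover have "0 < m" "m < k" using less.prems m prime_gt_1_nat[OF p(1)] by auto
      ultimately show ?thesis using less.IH by blast
    qed (use p in blast)
  qed
  ultimately show ?thesis by blast
qed

definition p :: nat where "p = residue_char TYPE('v)"

text \<open>Otherwise 1, as an integral combination of two elements of absolute value below 1, would
  itself have absolute value below 1.\<close>

lemma bezout_vn:
  fixes a b :: int
  assumes "coprime a b" "vn (of_int b) < 1"
  shows "vn (of_int a) = 1"
proof (rule ccontr)
  assume "vn (of_int a) \<noteq> 1"
  then have a: "vn (of_int a) < 1" using vn_of_int_le[of a] by simp
  obtain u v where "u * a + v * b = 1" using bezout_int[of a b] assms(1) by auto
  then have "of_int u * of_int a + of_int v * of_int b = (1 :: 'v)"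
    by (simp only: of_int_add[symmetric] of_int_mult[symmetric] of_int_1)
  moreover have "vn (of_int w * of_int c) < 1" if "vn (of_int c) < 1" for w c
  proof -
    have "vn (of_int w) * vn (of_int c) \<le> 1 * vn (of_int c)"
      by (intro mult_right_mono vn_of_int_le) auto
    then show ?thesis using that by (simp add: vn_mult)
  qed
  note this[OF a, of u] this[OF assms(2), of v]
  ultimately show False using ultra[of "of_int u * of_int a" "of_int v * of_int b"] vn_one by simp
qed

lemma prime_p: "prime p" and vn_p: "vn (of_nat p) < 1"
proof -
  have unique: "s = r" if "prime r" "vn (of_nat r) < 1" "prime s" "vn (of_nat s) < 1" for r s
  proof (rule ccontr)
    assume "s \<noteq> r"
    then have "coprime (int s) (int r)" using that by (simp add: primes_coprime)
    then have "vn (of_int (int s)) = 1" using that by (intro bezout_vn[where b = "int r"]) auto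
    then show False using that by simp
  qed
  have "prime p \<and> vn (of_nat p) < 1"
    unfolding p_def residue_char_def
  proof (rule theI')
    show "\<exists>!p. prime p \<and> vn (of_nat p) < 1"
      using residue_char_exists unique by (intro ex_ex1I) auto
  qed
  then show "prime p" "vn (of_nat p) < 1" by auto
qed

lemma vn_of_int_less_iff: "vn (of_int a) < 1 \<longleftrightarrow> int p dvd a"
proof
  assume "vn (of_int a) < 1"
  then show "int p dvd a"
    using bezout_vn[of "a" "int p"] prime_p vn_p prime_imp_coprime[of "int p" a]
    by (auto simp: coprime_commute)
next
  assume "int p dvd a"
  then obtain c where "a = int p * c" ..
  then have "vn (of_int a) = vn (of_nat p) * vn (of_int c)" by (simp add: vn_mult)
  also have "\<dots> \<le> vn (of_nat p) * 1" by (intro mult_left_mono vn_of_int_le) auto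
  finally show "vn (of_int a) < 1" using vn_p by simp
qed

text \<open>Membership in the ring Z[1/p].\<close>

definition p_integral_denom :: "rat \<Rightarrow> bool" where
  "p_integral_denom r \<longleftrightarrow> (\<exists>n. r * of_nat p ^ n \<in> \<int>)"

lemma p_integral_denom_diff:
  assumes "p_integral_denom r" "p_integral_denom s"
  shows "p_integral_denom (r - s)"
proof -
  obtain m n where "r * of_nat p ^ m \<in> \<int>" "s * of_nat p ^ n \<in> \<int>"
    using assms unfolding p_integral_denom_def by blast
  then have "(r * of_nat p ^ m) * of_nat p ^ n \<in> \<int>" "(s * of_nat p ^ n) * of_nat p ^ m \<in> \<int>"
    by (intro Ints_mult[of "_ * _"]; simp)+
  then have "(r * of_nat p ^ m) * of_nat p ^ n - (s * of_nat p ^ n) * of_nat p ^ m \<in> \<int>"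
    by (rule Ints_diff)
  then have "(r - s) * of_nat p ^ (m + n) \<in> \<int>" by (simp add: algebra_simps power_add)
  then show ?thesis unfolding p_integral_denom_def by blast
qed

text \<open>The numerator is divisible by \<open>p\<close> as long as a factor \<open>p\<close>
  remains in the denominator, because its absolute value is then below 1; so these factors cancel
  one after another.\<close>

lemma p_integral_denom_integral:
  assumes "p_integral_denom r" "vn (of_rat r) \<le> 1"
  shows "r \<in> \<int>"
proof -
  have "r * of_nat p ^ n \<in> \<int> \<Longrightarrow> r \<in> \<int>" for n
  proof (induction n)
    case (Suc n)
    obtain a where a: "r * of_nat p ^ Suc n = of_int a" using Suc.prems by (auto elim: Ints_cases)
    have "(of_int a :: 'v) = of_rat (r * of_nat p ^ Suc n)" unfolding a by simp
    also have "\<dots> = of_rat r * of_nat p ^ Suc n" by (simp add: of_rat_mult of_rat_power)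
    finally have "vn (of_int a) = vn (of_rat r) * (vn (of_nat p) * vn (of_nat p) ^ n)"
      by (simp add: vn_mult vn_power)
    also have "\<dots> \<le> 1 * (vn (of_nat p) * 1)"
      using assms vn_p by (intro mult_mono mult_left_mono power_le_one) auto
    finally have "int p dvd a" using vn_p by (simp add: vn_of_int_less_iff[symmetric])
    then obtain c where "a = int p * c" ..
    then have "r * of_nat p ^ n = of_int c" using a prime_gt_0_nat[OF prime_p] by simp
    then show ?case using Suc.IH by simp
  qed simp
  then show ?thesis using assms(1) unfolding p_integral_denom_def by blast
qed

text \<open>Partial fractions: with \<open>b = p^k * b'\<close> and
  \<open>u * b' + v * p^k = 1\<close>, the fraction \<open>a / b\<close> is the sum of
  \<open>a * u / p^k\<close> and \<open>a * v / b'\<close>. The second summand is p-adically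
  integral, and \<open>r\<close> is the ordinary fractional part of the first.\<close>

lemma rational_fractional_part:
  "\<exists>r. 0 \<le> r \<and> r < 1 \<and> p_integral_denom r \<and> vn (of_rat x - of_rat r) \<le> 1"
proof -
  obtain a b where ab: "x = Fract a b" "b > 0" by (cases x) auto
  then have x: "x = of_int a / of_int b" "b > 0" by (simp_all add: Fract_of_int_quotient)
  have "\<not> is_unit (int p)" using prime_p by auto
  then obtain b' where b': "b = int p ^ multiplicity (int p) b * b'" "\<not> int p dvd b'"
    using multiplicity_decompose'[of b "int p"] x by auto
  define k where "k = multiplicity (int p) b"
  have "coprime b' (int p ^ k)"
    using prime_imp_coprime[of "int p" b'] b' prime_p by (auto simp: coprime_commute)
  then obtain u v where uv: "u * b' + v * int p ^ k = 1" using bezout_int[of b' "int p ^ k"] by auto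
  define y :: rat where "y = of_int (a * u) / of_nat p ^ k"
  define r where "r = y - of_int \<lfloor>y\<rfloor>"
  have p0: "(of_nat p :: rat) \<noteq> 0" using prime_gt_0_nat[OF prime_p] by simp
  have b'0: "b' \<noteq> 0" using b' by auto
  have "r * of_nat p ^ k = of_int (a * u) - of_int \<lfloor>y\<rfloor> * of_nat p ^ k"
    using p0 by (simp add: r_def y_def left_diff_distrib)
  also have "\<dots> = of_int (a * u - \<lfloor>y\<rfloor> * int p ^ k)" by simp
  finally have "p_integral_denom r" unfolding p_integral_denom_def by (metis Ints_of_int)
  moreover have "0 \<le> r" "r < 1" unfolding r_def by linarith+
  moreover have "vn (of_rat x - of_rat r) \<le> 1"
  proof -
    have "(of_int b :: rat) = of_int (int p ^ k * b')" by (simp only: k_def b'(1)[symmetric])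
    then have b: "(of_int b :: rat) = of_nat p ^ k * of_int b'" by simp
    have one: "(1 :: rat) = of_int u * of_int b' + of_int v * of_nat p ^ k"
    proof -
      have "(1 :: rat) = of_int (u * b' + v * int p ^ k)" by (simp only: uv of_int_1)
      then show ?thesis by simp
    qed
    have "x = of_int a * (of_int u * of_int b' + of_int v * of_nat p ^ k) / (of_nat p ^ k * of_int b')"
      unfolding one[symmetric] using x b by simp
    also have "\<dots> = y + of_int (a * v) / of_int b'"
      using p0 b'0 by (simp add: y_def field_simps)
    finally have "x - r = of_int (a * v) / of_int b' + of_int \<lfloor>y\<rfloor>" by (simp add: r_def)
    then have "of_rat (x - r) = (of_int (a * v) / of_int b' + of_int \<lfloor>y\<rfloor> :: 'v)"
      by (simp add: of_rat_add of_rat_divide of_rat_mult)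
    then have eq: "of_rat x - of_rat r = (of_int (a * v) / of_int b' + of_int \<lfloor>y\<rfloor> :: 'v)"
      by (simp add: of_rat_diff)
    have "vn (of_int b') = 1" using b' vn_of_int_less_iff[of b'] vn_of_int_le[of b'] by simp
    then have "vn (of_int (a * v) / of_int b') \<le> 1"
      using vn_of_int_le[of "a * v"] by (simp only: vn_divide)
    then show ?thesis unfolding eq
      using ultra[of "of_int (a * v) / of_int b'" "of_int \<lfloor>y\<rfloor>"] vn_of_int_le[of "\<lfloor>y\<rfloor>"] by simp
  qed
  ultimately show ?thesis by blast
qed

text \<open>For existence, a rational at distance below 1 from \<open>t\<close> is used in place of
  \<open>t\<close>. For uniqueness, two candidates differ by an element of Z[1/p] of absolute value
  at most 1, that is, by an integer, and this integer lies strictly between -1 and 1.\<close>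

lemma padic_frac:
  assumes "t \<in> BF"
  shows "0 \<le> padic_frac t" "padic_frac t < 1" "p_integral_denom (padic_frac t)"
    "vn (t - of_rat (padic_frac t)) \<le> 1"
proof -
  let ?P = "\<lambda>r. 0 \<le> r \<and> r < 1 \<and> p_integral_denom r \<and> vn (t - of_rat r) \<le> 1"
  have "\<exists>s\<in>\<rat>. dist s t < 1"
    using assms unfolding base_field_def closure_approachable by simp
  then obtain x where "dist (of_rat x) t < 1" by (auto elim: Rats_cases)
  then have x: "vn (t - of_rat x) < 1" using dist_diff[of t] by (simp add: dist_commute)
  obtain r where r: "0 \<le> r" "r < 1" "p_integral_denom r" "vn (of_rat x - of_rat r) \<le> 1"
    using rational_fractional_part by blast
  have "vn (t - of_rat r) \<le> 1"
    using ultra[of "t - of_rat x" "of_rat x - of_rat r"] x r(4) by simp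
  then have ex: "\<exists>r. ?P r" using r by blast
  have unique: "s = r" if "?P r" "?P s" for r s
  proof -
    have "vn ((t - of_rat s) - (t - of_rat r)) \<le> 1"
      by (rule order_trans[OF ultra_diff]) (use that in simp)
    then have "vn (of_rat (r - s)) \<le> 1" by (simp add: of_rat_diff)
    then have "r - s \<in> \<int>" using that by (intro p_integral_denom_integral p_integral_denom_diff) auto
    then obtain n where n: "r - s = of_int n" by (auto elim: Ints_cases)
    then have "- 1 < (of_int n :: rat)" "(of_int n :: rat) < 1" using that by linarith+
    then have "n = 0" by linarith
    then show ?thesis using n by simp
  qed
  have "?P (padic_frac t)"
    unfolding padic_frac_def p_def[symmetric] p_integral_denom_def[symmetric]
  proof (rule theI')
    show "\<exists>!r. ?P r" using ex unique by (intro ex_ex1I) auto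
  qed
  then show "0 \<le> padic_frac t" "padic_frac t < 1" "p_integral_denom (padic_frac t)"
    "vn (t - of_rat (padic_frac t)) \<le> 1" by auto
qed

definition chi :: "rat \<Rightarrow> complex" where "chi r = exp (2 * complex_of_real pi * \<i> * of_rat r)"

lemma chi_add: "chi (r + s) = chi r * chi s"
  by (simp add: chi_def of_rat_add distrib_left exp_add)

lemma chi_int: "r \<in> \<int> \<Longrightarrow> chi r = 1"
proof (elim Ints_cases)
  fix n assume n: "r = of_int n"
  have "2 * complex_of_real pi * \<i> * of_rat r = complex_of_real (2 * real_of_int n * pi) * \<i>" by (simp add: n)
  then show "chi r = 1" unfolding chi_def using exp_integer_2pi[of "real_of_int n"] by (simp only: Ints_of_int)
qed

lemma norm_chi: "cmod (chi r) = 1"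
proof -
  obtain a b where "r = Fract a b" "b > 0" by (cases r) auto
  then have "(of_rat r :: complex) = complex_of_real (of_int a / of_int b)" by (simp add: of_rat_rat)
  then have "2 * complex_of_real pi * \<i> * of_rat r = \<i> * complex_of_real (2 * pi * (of_int a / of_int b))"
    by simp
  then show ?thesis unfolding chi_def by (simp only: norm_exp_i_times)
qed

lemma chi_cong:
  assumes "r - s \<in> \<int>" shows "chi r = chi s"
  using chi_add[of "r - s" s] chi_int[OF assms] by simp

lemma add_char_chi: "add_char x = chi (padic_frac (Tr x))" for x :: 'v
  using finite_place by (simp add: add_char_def chi_def Let_def)

text \<open>The defect of additivity of the fractional part lies in Z[1/p] and is also a combination
  of elements of absolute value at most 1; hence it is an integer, invisible to
  \<open>chi\<close>.\<close>

lemma chi_padic_frac_add: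
  assumes "s \<in> BF" "t \<in> BF"
  shows "chi (padic_frac (s + t)) = chi (padic_frac s) * chi (padic_frac t)"
proof -
  have st: "s + t \<in> BF" using assms by (rule base_field_add)
  let ?d = "padic_frac (s + t) - padic_frac s - padic_frac t"
  have "of_rat ?d = (s - of_rat (padic_frac s)) + (t - of_rat (padic_frac t)) - (s + t - of_rat (padic_frac (s + t)))"
    by (simp add: of_rat_diff)
  also have "vn \<dots> \<le> 1"
    by (rule order_trans[OF ultra_diff], rule max.boundedI, rule order_trans[OF ultra], rule max.boundedI)
       (intro padic_frac assms st)+
  finally have "?d \<in> \<int>"
    by (intro p_integral_denom_integral p_integral_denom_diff padic_frac assms st)
  then have "padic_frac (s + t) - (padic_frac s + padic_frac t) \<in> \<int>" by (simp add: algebra_simps)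
  then show ?thesis unfolding chi_add[symmetric] by (rule chi_cong)
qed

lemma chi_padic_frac_small:
  assumes "t \<in> BF" "vn t \<le> 1"
  shows "chi (padic_frac t) = 1"
proof (intro chi_int p_integral_denom_integral padic_frac assms)
  show "vn (of_rat (padic_frac t)) \<le> 1"
    using ultra_diff[of t "t - of_rat (padic_frac t)"] assms padic_frac(4)[OF assms(1)] by simp
qed

lemma add_char_nonarch:
  assumes B: "\<exists>B. finite_basis_over BF B"
  shows "add_char (x + y) = add_char x * add_char (y :: 'v)" "cmod (add_char x) = 1"
    "\<exists>\<delta>>0. \<forall>x::'v. vn x \<le> \<delta> \<longrightarrow> add_char x = 1"
proof -
  note T = trace_properties[OF B]
  show "add_char (x + y) = add_char x * add_char y"
    unfolding add_char_chi T(2) by (intro chi_padic_frac_add T(1))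
  show "cmod (add_char x) = 1" unfolding add_char_chi by (rule norm_chi)
  obtain K where K: "K \<ge> 0" "\<And>x. vn (Tr x) \<le> K * vn x" using T(4) by blast
  \<comment> \<open>On this ball the trace has absolute value at most 1. The summand 1 in the
    denominator covers the case \<open>K = 0\<close>.\<close>
  have "add_char x = 1" if "vn x \<le> 1 / (K + 1)" for x
  proof -
    have "K * vn x \<le> K * (1 / (K + 1))" using that K by (intro mult_left_mono) auto
    also have "\<dots> \<le> 1" using K by simp
    finally have "vn (Tr x) \<le> 1" using K(2)[of x] by simp
    then show ?thesis unfolding add_char_chi by (intro chi_padic_frac_small T(1))
  qed
  then show "\<exists>\<delta>>0. \<forall>x::'v. vn x \<le> \<delta> \<longrightarrow> add_char x = 1"
    using K by (intro exI[of _ "1 / (K + 1)"]) auto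
qed

end

section \<open>Reduction to integrability and cutoffs\<close>

context log_fourier
begin

lemma sqrt_scale:
  assumes "0 < N x"
  shows "\<exists>s>0. N x = s\<^sup>2 \<and> V (ell x) = min (1 / s) (1 / s ^ 3)"
proof (intro exI conjI)
  show "0 < b powr ell x" using b_gt_1 by simp
  show "N x = (b powr ell x)\<^sup>2"
    unfolding N_eq[OF assms] by (simp add: power2_eq_square powr_add[symmetric])
  have "b powr (3 * ell x) = (b powr ell x) ^ 3"
    by (simp add: power3_eq_cube powr_add[symmetric])
  then show "V (ell x) = min (1 / b powr ell x) (1 / (b powr ell x) ^ 3)"
    unfolding V_def powr_minus_divide by simp
qed

text \<open>With \<open>s\<close> the square root of the modulus, both \<open>s\<close> and
  \<open>s^3\<close> are at most \<open>(1 + s^2)^2\<close>. So \<open>V\<close>, whose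
  integrability is known, dominates every function of this decay.\<close>

lemma V_ge_decay:
  assumes "0 < N x"
  shows "1 / (1 + N x)\<^sup>2 \<le> V (ell x)"
proof -
  obtain s where s: "s > 0" "N x = s\<^sup>2" "V (ell x) = min (1 / s) (1 / s ^ 3)"
    using sqrt_scale[OF assms] by blast
  have "s \<le> 1 + s\<^sup>2"
    using zero_le_power2[of "s - 1"] s(1) by (simp add: power2_eq_square algebra_simps)
  moreover have "1 + s\<^sup>2 \<le> (1 + s\<^sup>2)\<^sup>2" by (rule self_le_power) auto
  ultimately have 1: "s \<le> (1 + s\<^sup>2)\<^sup>2" by linarith
  have "s ^ 3 = s * s\<^sup>2" by (simp add: power3_eq_cube power2_eq_square)
  also have "\<dots> \<le> (1 + s\<^sup>2) * (1 + s\<^sup>2)" using \<open>s \<le> 1 + s\<^sup>2\<close> s(1) by (intro mult_mono) auto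
  finally have 2: "s ^ 3 \<le> (1 + s\<^sup>2)\<^sup>2" by (simp add: power2_eq_square)
  have "1 / (1 + s\<^sup>2)\<^sup>2 \<le> 1 / s" "1 / (1 + s\<^sup>2)\<^sup>2 \<le> 1 / s ^ 3"
    using 1 2 s(1) by (auto intro!: divide_left_mono mult_pos_pos simp: add_pos_nonneg)
  then show ?thesis using s by simp
qed

text \<open>With the same \<open>s \<le> 1\<close>, the claim is that \<open>|ln s|\<close> is at
  most \<open>1 / s\<close>. The logarithmic singularity at the origin is thus dominated by
  \<open>V\<close> as well.\<close>

lemma abs_ln_le_V:
  assumes "0 < N x" "N x \<le> 1"
  shows "\<bar>ln (N x)\<bar> \<le> 2 * V (ell x)"
proof -
  obtain s where s: "s > 0" "N x = s\<^sup>2" "V (ell x) = min (1 / s) (1 / s ^ 3)"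
    using sqrt_scale[OF assms(1)] by blast
  have "s \<le> 1" using assms s by (simp add: power_le_one_iff power2_eq_square mult_le_one abs_square_le_1 flip: power2_eq_square)
  have "- ln s = ln (1 / s)" using s by (simp add: ln_div)
  also have "\<dots> \<le> 1 / s" using ln_le_minus_one[of "1 / s"] s(1) by simp
  finally have "\<bar>ln s\<bar> \<le> 1 / s" using s(1) \<open>s \<le> 1\<close> by (simp add: abs_of_nonpos)
  moreover have "s ^ 3 \<le> s" using s(1) \<open>s \<le> 1\<close> power_decreasing[of 1 3 s] by simp
  then have "1 / s \<le> 1 / s ^ 3" using s(1) by (intro divide_left_mono) auto
  ultimately show ?thesis using s by (simp add: ln_realpow)
qed

lemma integrable_V0: "integrable \<mu> (\<lambda>x. V (ell x))"
  using integrable_V[of 0] by simp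

lemma integrable_decay_sq:
  fixes g :: "'a \<Rightarrow> 'c::{banach, second_countable_topology}"
  assumes [measurable]: "g \<in> borel_measurable \<mu>" and g: "\<And>x. norm (g x) \<le> K / (1 + N x)\<^sup>2"
  shows "integrable \<mu> g"
proof (rule Bochner_Integration.integrable_bound)
  show "integrable \<mu> (\<lambda>x. \<bar>K\<bar> * V (ell x))" using integrable_V0 by simp
  show "AE x in \<mu>. norm (g x) \<le> norm (\<bar>K\<bar> * V (ell x))"
    using AE_N_pos
  proof eventually_elim
    case (elim x)
    have "K / (1 + N x)\<^sup>2 \<le> \<bar>K\<bar> * (1 / (1 + N x)\<^sup>2)"
      by (simp add: divide_right_mono)
    also have "\<dots> \<le> \<bar>K\<bar> * V (ell x)" by (intro mult_left_mono V_ge_decay elim) auto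
    finally show ?case using g[of x] by simp
  qed
qed measurable

text \<open>Where the modulus exceeds 1, one of the three powers of \<open>1 + N x\<close> pays for
  the logarithm; where it is at most 1, \<open>abs_ln_le_V\<close> does.\<close>

lemma integrable_decay:
  fixes g :: "'a \<Rightarrow> complex"
  assumes [measurable]: "g \<in> borel_measurable \<mu>" and g: "\<And>x. cmod (g x) \<le> K / (1 + N x) ^ 3"
  shows "integrable \<mu> g" "integrable \<mu> (\<lambda>x. complex_of_real (ln (N x)) * g x)"
proof -
  have K: "0 \<le> K"
  proof -
    have "0 \<le> K / (1 + N undefined) ^ 3" using g[of undefined] norm_ge_zero order_trans by blast
    then show ?thesis using N_nonneg[of undefined] by (simp add: zero_le_divide_iff)
  qed
  have sq: "K / (1 + N x) ^ 3 \<le> K / (1 + N x)\<^sup>2" for x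
    using K N_nonneg[of x] by (intro divide_left_mono power_increasing) (auto simp: add_pos_nonneg)
  show "integrable \<mu> g"
    by (rule integrable_decay_sq) (use g sq order_trans in \<open>auto, blast\<close>)
  show "integrable \<mu> (\<lambda>x. complex_of_real (ln (N x)) * g x)"
  proof (rule Bochner_Integration.integrable_bound)
    show "integrable \<mu> (\<lambda>x. 2 * K * V (ell x))" using integrable_V0 by simp
    show "AE x in \<mu>. cmod (complex_of_real (ln (N x)) * g x) \<le> norm (2 * K * V (ell x))"
      using AE_N_pos
    proof eventually_elim
      case (elim x)
      have "\<bar>ln (N x)\<bar> * (K / (1 + N x) ^ 3) \<le> 2 * K * V (ell x)"
      proof (cases "N x \<le> 1")
        case True
        have "K / (1 + N x) ^ 3 \<le> K"
          using K elim by (simp add: divide_le_eq mult_left_mono one_le_power mult_le_cancel_left1)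
        then have "\<bar>ln (N x)\<bar> * (K / (1 + N x) ^ 3) \<le> (2 * V (ell x)) * K"
          using abs_ln_le_V[OF elim True] K elim by (intro mult_mono) (auto simp: V_nonneg)
        then show ?thesis by (simp only: ac_simps)
      next
        case False
        have "\<bar>ln (N x)\<bar> \<le> 1 + N x" using ln_le_minus_one[of "N x"] elim False by simp
        then have "\<bar>ln (N x)\<bar> * (K / (1 + N x) ^ 3) \<le> (1 + N x) * (K / (1 + N x) ^ 3)"
          using K elim by (intro mult_right_mono) auto
        also have "\<dots> = K * (1 / (1 + N x)\<^sup>2)"
          using elim by (simp add: power3_eq_cube power2_eq_square)
        also have "\<dots> \<le> K * V (ell x)" by (intro mult_left_mono V_ge_decay elim K)
        also have "\<dots> \<le> 2 * K * V (ell x)" using K V_nonneg[of "ell x"] by simp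
        finally show ?thesis .
      qed
      moreover have "cmod (complex_of_real (ln (N x)) * g x) \<le> \<bar>ln (N x)\<bar> * (K / (1 + N x) ^ 3)"
        unfolding norm_mult norm_of_real by (intro mult_left_mono g) auto
      ultimately show ?case using K V_nonneg[of "ell x"] by simp
    qed
  qed measurable
qed

end

section \<open>From Haar measure to the abstract inequality\<close>

context valued_field
begin

lemma haar_integral_translate:
  fixes g :: "'v \<Rightarrow> complex"
  assumes \<mu>: "haar_measure \<mu>" and g: "g \<in> borel_measurable borel"
  shows "(LINT y|\<mu>. g (a + y)) = (LINT y|\<mu>. g y)"
proof -
  have sets: "sets \<mu> = sets borel" using \<mu> by (simp add: haar_measure_def)
  have meas: "(\<lambda>x. a + x) \<in> measurable \<mu> borel"
    unfolding measurable_cong_sets[OF sets refl]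
    by (rule borel_measurable_continuous_onI[OF continuous_vadd])
  have "distr \<mu> borel (\<lambda>x. a + x) = \<mu>" using \<mu> unfolding haar_measure_def by blast
  then have "(LINT y|\<mu>. g y) = (LINT y|distr \<mu> borel (\<lambda>x. a + x). g y)" by (simp only:)
  also have "\<dots> = (LINT y|\<mu>. g (a + y))" by (rule integral_distr[OF meas g])
  finally show ?thesis by simp
qed

lemma log_fourier_haar:
  fixes \<mu> :: "'v measure"
  assumes \<mu>: "haar_measure \<mu>" and D: "countable (D :: 'v set)" "closure D = UNIV"
    and nabs: "(nabs :: 'v \<Rightarrow> real) \<in> borel_measurable borel" "\<And>x::'v. 0 \<le> nabs x"
    and "1 < b"
    and "\<And>k. emeasure \<mu> {x. nabs x \<le> b powr (2 * real_of_int k)} \<le> ennreal (M * b powr (2 * real_of_int k))"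
    and cont: "continuous_on UNIV (add_char :: 'v \<Rightarrow> complex)" and norm: "\<And>x::'v. cmod (add_char x) = 1"
  shows "log_fourier \<mu> nabs (\<lambda>x y. add_char (x * y)) b M"
proof
  have sets: "sets \<mu> = sets borel" using \<mu> by (simp add: haar_measure_def)
  have cont2: "continuous_on UNIV (\<lambda>y. add_char (x * y))" for x :: 'v
    using continuous_on_compose2[OF cont continuous_vmult] by simp
  show "space \<mu> = UNIV" by (rule haar_space[OF \<mu>])
  show "nabs \<in> borel_measurable \<mu>" using nabs(1) unfolding measurable_cong_sets[OF sets refl] .
  have "case_prod (\<lambda>x y. add_char (x * y)) \<in> borel_measurable (borel \<Otimes>\<^sub>M (borel :: 'v measure))"
  proof (rule borel_measurable_pair_separable[OF D])
    show "(\<lambda>x. add_char (x * y)) \<in> borel_measurable borel" for y :: 'v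
      using borel_measurable_continuous_onI[OF cont2[of y]] by (simp add: mult.commute)
  qed (rule cont2)
  then show "case_prod (\<lambda>x y. add_char (x * y)) \<in> borel_measurable (\<mu> \<Otimes>\<^sub>M \<mu>)"
    unfolding measurable_cong_sets[OF sets_pair_measure_cong[OF sets sets] refl] .
qed (use assms in \<open>auto simp: mult.commute\<close>)

text \<open>Self-duality makes every Schwartz--Bruhat function invertible. The truncated functions
  \<open>m k * f\<close> must be invertible too, hence the demand that the cutoffs preserve the
  Schwartz--Bruhat class. Each kind of place then only has to supply three integrability facts and a
  family of cutoffs.\<close>

lemma conductor_bounded_below_criterion:
  fixes \<mu> :: "'v measure"
  assumes sd: "self_dual_haar \<mu>" and lf: "log_fourier \<mu> nabs (\<lambda>x y. add_char (x * y)) b M"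
    and char: "\<And>x::'v. add_char (- x) = cnj (add_char x)"
    and f: "\<And>f. schwartz_bruhat f \<Longrightarrow> integrable \<mu> f"
      "\<And>f. schwartz_bruhat f \<Longrightarrow> integrable \<mu> (\<lambda>x. complex_of_real (ln (nabs x)) * f x)"
      "\<And>f. schwartz_bruhat f \<Longrightarrow> integrable \<mu> (\<lambda>x. complex_of_real (ln (nabs x)) * fourier \<mu> f x)"
    and m: "\<And>k. m k \<in> borel_measurable \<mu>"
      "\<And>k f. schwartz_bruhat f \<Longrightarrow> schwartz_bruhat (\<lambda>y. complex_of_real (m k y) * f y)"
      "\<And>k y. 0 \<le> m k y" "\<And>k y. m k y \<le> 1"
      "\<And>k y. m k y * (b powr (2 * real_of_int k) * nabs y) \<le> 1"
      "\<And>k y. 1 - m k y \<le> b powr (2 * real_of_int k) * nabs y"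
  shows "\<exists>c::real. \<forall>f. schwartz_bruhat f \<longrightarrow>
           l2_inner \<mu> (conductor_op \<mu> f) f \<in> \<real> \<and>
           Re (l2_inner \<mu> (conductor_op \<mu> f) f) \<ge> c * (l2_norm \<mu> f)\<^sup>2"
proof -
  interpret log_fourier \<mu> nabs "\<lambda>x y. add_char (x * y)" b M by (rule lf)
  have Fo: "Fo f = fourier \<mu> f" for f by (simp add: fun_eq_iff Fo_def fourier_def char)
  have Fi: "Fi f = inverse_fourier \<mu> f" for f by (simp add: fun_eq_iff Fi_def inverse_fourier_def)
  have inv: "invertible_fn f" if "schwartz_bruhat f" for f
    using sd f(1)[OF that] that by (auto simp: invertible_fn_def Fo Fi self_dual_haar_def)
  obtain c where c: "\<And>f m. invertible_fn f \<and> integrable \<mu> (\<lambda>y. complex_of_real (ln (nabs y)) * f y) \<and>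
     integrable \<mu> (\<lambda>x. complex_of_real (ln (nabs x)) * Fo f x) \<and>
     (\<forall>k::int. m k \<in> borel_measurable \<mu> \<and> invertible_fn (\<lambda>y. complex_of_real (m k y) * f y) \<and>
       (\<forall>y. 0 \<le> m k y \<and> m k y \<le> 1 \<and> m k y * (b powr (2 * real_of_int k) * nabs y) \<le> 1 \<and>
            1 - m k y \<le> b powr (2 * real_of_int k) * nabs y)) \<Longrightarrow>
     (let I = LINT y|\<mu>. (complex_of_real (ln (nabs y)) * f y
               + Fi (\<lambda>x. complex_of_real (ln (nabs x)) * Fo f x) y) * cnj (f y)
      in I \<in> \<real> \<and> c * (LINT y|\<mu>. (cmod (f y))\<^sup>2) \<le> Re I)"
    using log_operator_bounded_below by blast
  have "l2_inner \<mu> (conductor_op \<mu> f) f \<in> \<real> \<and>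
           Re (l2_inner \<mu> (conductor_op \<mu> f) f) \<ge> c * (l2_norm \<mu> f)\<^sup>2" if sb: "schwartz_bruhat f" for f
  proof -
    have op: "conductor_op \<mu> f = (\<lambda>y. complex_of_real (ln (nabs y)) * f y
               + Fi (\<lambda>x. complex_of_real (ln (nabs x)) * Fo f x) y)"
      unfolding conductor_op_def Fo Fi log_mult_def ..
    have "(l2_norm \<mu> f)\<^sup>2 = (LINT y|\<mu>. (cmod (f y))\<^sup>2)"
      unfolding l2_norm_def by (intro real_sqrt_pow2 integral_nonneg_AE) auto
    moreover have "invertible_fn f \<and> integrable \<mu> (\<lambda>y. complex_of_real (ln (nabs y)) * f y) \<and>
     integrable \<mu> (\<lambda>x. complex_of_real (ln (nabs x)) * Fo f x) \<and>
     (\<forall>k::int. m k \<in> borel_measurable \<mu> \<and> invertible_fn (\<lambda>y. complex_of_real (m k y) * f y) \<and>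
       (\<forall>y. 0 \<le> m k y \<and> m k y \<le> 1 \<and> m k y * (b powr (2 * real_of_int k) * nabs y) \<le> 1 \<and>
            1 - m k y \<le> b powr (2 * real_of_int k) * nabs y))"
      unfolding Fo by (intro conjI allI inv f sb m)
    ultimately show ?thesis using c[of f m] by (simp add: Let_def l2_inner_def op)
  qed
  then show ?thesis by blast
qed

end

section \<open>The bound at finite places\<close>

context nonarch_field
begin

lemma ball_vn: "ball x r = {y. vn (y - x) < r}" for x :: 'v
  using dist_diff by (auto simp: dist_commute[of x])

lemma schwartz_bruhat_iff:
  "schwartz_bruhat f \<longleftrightarrow> (\<forall>x. \<forall>\<^sub>F y in nhds x. f y = f x) \<and> compact (closure {x::'v. f x \<noteq> 0})"
  using finite_place by (simp add: schwartz_bruhat_def)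

lemma locally_constant_continuous:
  fixes f :: "'v \<Rightarrow> 'c::topological_space"
  assumes "\<And>x. \<forall>\<^sub>F y in nhds x. f y = f x"
  shows "continuous_on UNIV f"
  unfolding continuous_on_def
proof (intro ballI tendsto_eventually)
  fix x show "\<forall>\<^sub>F y in at x. f y = f x"
    using assms[of x] by (auto simp: eventually_at_filter elim: eventually_mono)
qed

lemma eventually_nhds_ball: "0 < r \<Longrightarrow> \<forall>\<^sub>F y in nhds x. vn (y - x) < r" for x :: 'v
  unfolding eventually_nhds_metric using dist_diff by auto

lemma schwartz_bruhat_bounded:
  assumes "schwartz_bruhat (f :: 'v \<Rightarrow> complex)"
  shows "f \<in> borel_measurable borel" "\<exists>K R. \<forall>x. cmod (f x) \<le> K \<and> (f x \<noteq> 0 \<longrightarrow> vn x \<le> R)"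
proof -
  have f: "\<And>x. \<forall>\<^sub>F y in nhds x. f y = f x" "compact (closure {x. f x \<noteq> 0})"
    using assms unfolding schwartz_bruhat_iff by auto
  have cont: "continuous_on UNIV f" by (rule locally_constant_continuous[OF f(1)])
  then show "f \<in> borel_measurable borel" by (rule borel_measurable_continuous_onI)
  have "bounded (f ` closure {x. f x \<noteq> 0})"
    by (intro compact_imp_bounded compact_continuous_image continuous_on_subset[OF cont] f) auto
  then have "\<exists>K. \<forall>z\<in>f ` closure {x. f x \<noteq> 0}. cmod z \<le> K" by (simp only: bounded_iff)
  then obtain K where K: "\<And>x. x \<in> closure {x. f x \<noteq> 0} \<Longrightarrow> cmod (f x) \<le> K" by blast
  have "bounded (closure {x. f x \<noteq> 0})" using f(2) by (rule compact_imp_bounded)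
  then have "\<exists>R. \<forall>x\<in>closure {x. f x \<noteq> 0}. dist 0 x \<le> R"
    by (rule bounded_any_center[THEN iffD1])
  then obtain R where R: "\<And>x. x \<in> closure {x. f x \<noteq> 0} \<Longrightarrow> dist 0 x \<le> R" by blast
  have "cmod (f x) \<le> \<bar>K\<bar> \<and> (f x \<noteq> 0 \<longrightarrow> vn x \<le> R)" for x
  proof (cases "f x = 0")
    case False
    then have "x \<in> closure {x. f x \<noteq> 0}" using closure_subset[of "{x. f x \<noteq> 0}"] by auto
    then have "cmod (f x) \<le> K" "dist 0 x \<le> R" by (rule K, rule R)
    then show ?thesis by (auto simp: dist_commute)
  qed auto
  then show "\<exists>K R. \<forall>x. cmod (f x) \<le> K \<and> (f x \<noteq> 0 \<longrightarrow> vn x \<le> R)" by blast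
qed

text \<open>A Lebesgue number for the cover of the compact support by balls of constancy handles
  points where \<open>f\<close> does not vanish. If only \<open>f (a + x)\<close> is nonzero, the
  same is applied at \<open>a + x\<close> with the shift \<open>- a\<close>.\<close>

lemma schwartz_bruhat_uniformly_locally_constant:
  assumes "schwartz_bruhat (f :: 'v \<Rightarrow> complex)"
  shows "\<exists>\<delta>>0. \<forall>x a. vn a < \<delta> \<longrightarrow> f (a + x) = f x"
proof -
  have f: "\<And>x. \<forall>\<^sub>F y in nhds x. f y = f x" "compact (closure {x. f x \<noteq> 0})"
    using assms unfolding schwartz_bruhat_iff by auto
  have "\<forall>x. \<exists>r>0. \<forall>y. dist y x < r \<longrightarrow> f y = f x"
    using f(1) by (simp add: eventually_nhds_metric)
  then obtain r where r: "\<And>x. r x > 0" "\<And>x y. dist y x < r x \<Longrightarrow> f y = f x" by metis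
  obtain \<delta> where \<delta>: "\<delta> > 0"
    "\<forall>x\<in>closure {x. f x \<noteq> 0}. \<exists>G\<in>(\<lambda>x. ball x (r x)) ` UNIV. ball x \<delta> \<subseteq> G"
  proof (rule Heine_Borel_lemma[OF f(2), of "(\<lambda>x. ball x (r x)) ` UNIV"])
    show "closure {x. f x \<noteq> 0} \<subseteq> \<Union>((\<lambda>x. ball x (r x)) ` UNIV)"
    proof
      fix x
      have "x \<in> ball x (r x)" using r(1) by simp
      then show "x \<in> \<Union>((\<lambda>x. ball x (r x)) ` UNIV)" by blast
    qed
  qed auto
  have near: "f (a + x) = f x" if "f x \<noteq> 0" "vn a < \<delta>" for x a
  proof -
    have "x \<in> closure {x. f x \<noteq> 0}" using that(1) closure_subset[of "{x. f x \<noteq> 0}"] by auto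
    then obtain z where z: "ball x \<delta> \<subseteq> ball z (r z)" using \<delta>(2) by blast
    have "a + x \<in> ball x \<delta>" "x \<in> ball x \<delta>" using that(2) \<delta>(1) by (simp_all add: ball_vn)
    then have "a + x \<in> ball z (r z)" "x \<in> ball z (r z)" using z by blast+
    then have "f (a + x) = f z" "f x = f z" using r(2)[of _ z] by (auto simp: dist_commute)
    then show ?thesis by simp
  qed
  have "f (a + x) = f x" if "vn a < \<delta>" for x a
  proof (cases "f x = 0 \<and> f (a + x) \<noteq> 0")
    case True
    then have "f (- a + (a + x)) = f (a + x)" using that by (intro near) (auto simp: vn_minus)
    then show ?thesis by simp
  next
    case False
    then show ?thesis using near[OF _ that] by (cases "f x = 0") auto
  qed
  then show ?thesis using \<delta>(1) by blast
qed

lemma vball_locally_constant: "\<forall>\<^sub>F y in nhds x. (y \<in> vball n) = (x \<in> vball n)"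
proof -
  have "0 < \<rho> powi n" using rho by simp
  then show ?thesis
  proof (rule eventually_mono[OF eventually_nhds_ball])
    fix y assume y: "vn (y - x) < \<rho> powi n"
    then show "(y \<in> vball n) = (x \<in> vball n)"
      using ultra[of "y - x" x] ultra_diff[of y "y - x"] by (auto simp: vball_def)
  qed
qed

lemma schwartz_bruhat_cutoff:
  assumes "schwartz_bruhat (f :: 'v \<Rightarrow> complex)"
  shows "schwartz_bruhat (\<lambda>y. complex_of_real (indicator (vball n) y) * f y)"
proof -
  have f: "\<And>x. \<forall>\<^sub>F y in nhds x. f y = f x" "compact (closure {x. f x \<noteq> 0})"
    using assms unfolding schwartz_bruhat_iff by auto
  have "\<forall>\<^sub>F y in nhds x. complex_of_real (indicator (vball n) y) * f y = complex_of_real (indicator (vball n) x) * f x" for x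
    using f(1)[of x] vball_locally_constant[of n x] by eventually_elim (simp add: indicator_def)
  moreover have "compact (closure {x. complex_of_real (indicator (vball n) x) * f x \<noteq> 0})" (is "compact ?S")
  proof -
    have "?S \<subseteq> closure {x. f x \<noteq> 0}" by (intro closure_mono) auto
    then have "closure {x. f x \<noteq> 0} \<inter> ?S = ?S" by (simp only: Int_absorb1)
    moreover have "compact (closure {x. f x \<noteq> 0} \<inter> ?S)" using f(2) by (intro compact_Int_closed) auto
    ultimately show ?thesis by (simp only:)
  qed
  ultimately show ?thesis unfolding schwartz_bruhat_iff by blast
qed

lemma schwartz_bruhat_indicator: "schwartz_bruhat (\<lambda>y. complex_of_real (indicator (vball n) y))"
proof -
  have "\<forall>\<^sub>F y in nhds x. complex_of_real (indicator (vball n) y) = complex_of_real (indicator (vball n) x)" for x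
    using vball_locally_constant[of n x] by eventually_elim (simp add: indicator_def)
  moreover have "{x. complex_of_real (indicator (vball n) x) \<noteq> 0} = vball n" by (auto simp: indicator_def)
  ultimately show ?thesis unfolding schwartz_bruhat_iff
    using compact_vball'[of n] by (simp add: compact_imp_closed)
qed

lemma nabs_nonneg: "0 \<le> nabs x" for x :: 'v
  by (simp add: nabs_eq)

section \<open>Transforms of Schwartz--Bruhat functions at finite places\<close>

text \<open>With a trivial character every inverse transform is constant, but inversion would have
  to return the indicator of \<open>vball 0\<close>, which differs at \<open>0\<close> and at the
  inverse of the uniformizer.\<close>

lemma add_char_nontrivial:
  assumes sd: "self_dual_haar (\<mu> :: 'v measure)"
  shows "\<exists>z::'v. add_char z \<noteq> 1"
proof (rule ccontr)
  assume "\<nexists>z::'v. add_char z \<noteq> 1"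
  then have one: "add_char z = 1" for z :: 'v by blast
  let ?f = "\<lambda>y. complex_of_real (indicator (vball 0) y)"
  have "inverse_fourier \<mu> (fourier \<mu> ?f) = ?f"
    using sd schwartz_bruhat_indicator unfolding self_dual_haar_def by blast
  then have eq: "inverse_fourier \<mu> (fourier \<mu> ?f) y = ?f y" for y by (rule fun_cong)
  have "inverse_fourier \<mu> (fourier \<mu> ?f) 0 = inverse_fourier \<mu> (fourier \<mu> ?f) (inverse pi_v)"
    by (simp add: inverse_fourier_def one)
  then have "?f 0 = ?f (inverse pi_v)" unfolding eq .
  moreover have "0 \<in> vball 0" by (simp add: vball_def)
  moreover have "inverse pi_v \<notin> vball 0"
    using rho by (simp add: vball_def vn_inverse \<rho>_def[symmetric] not_le one_less_inverse_iff)
  ultimately show False by simp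
qed

text \<open>Choose \<open>z\<close> with \<open>add_char z\<close> different from 1. For
  \<open>vn x > vn z / \<delta>\<close> the shift by \<open>- (z / x)\<close> is too small to change
  \<open>f\<close>, yet it multiplies the character by \<open>add_char z\<close>. Translation
  invariance then makes the transform at \<open>x\<close> equal to \<open>add_char z\<close> times
  itself, so it vanishes.\<close>

lemma fourier_bounded_support:
  assumes \<mu>: "self_dual_haar (\<mu> :: 'v measure)" and B: "\<exists>B. finite_basis_over BF B"
    and f: "schwartz_bruhat (f :: 'v \<Rightarrow> complex)"
    and char_meas: "\<And>x. (\<lambda>y. add_char (x * y)) \<in> borel_measurable (borel :: 'v measure)"
  shows "\<exists>R. \<forall>x. fourier \<mu> f x \<noteq> 0 \<longrightarrow> vn x \<le> R"
proof -
  have haar: "haar_measure \<mu>" using \<mu> by (simp add: self_dual_haar_def)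
  obtain \<delta> where \<delta>: "\<delta> > 0" "\<And>x a. vn a < \<delta> \<Longrightarrow> f (a + x) = f x"
    using schwartz_bruhat_uniformly_locally_constant[OF f] by blast
  obtain z :: 'v where z: "add_char z \<noteq> 1" using add_char_nontrivial[OF \<mu>] by blast
  have [measurable]: "f \<in> borel_measurable borel" by (rule schwartz_bruhat_bounded[OF f])
  have meas: "(\<lambda>y. f y * add_char (- (x * y))) \<in> borel_measurable borel" for x
    using char_meas[of "- x"] by simp
  have "vn x \<le> vn z / \<delta>" if "fourier \<mu> f x \<noteq> 0" for x
  proof (rule ccontr)
    assume "\<not> vn x \<le> vn z / \<delta>"
    then have x: "vn z / \<delta> < vn x" by simp
    moreover have "0 \<le> vn z / \<delta>" using \<delta>(1) by simp
    ultimately have "x \<noteq> 0" by auto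
    define a where "a = - (z / x)"
    have "vn a < \<delta>" using x \<delta>(1) \<open>x \<noteq> 0\<close> by (simp add: a_def vn_minus vn_divide field_simps)
    have "fourier \<mu> f x = (LINT y|\<mu>. f (a + y) * add_char (- (x * (a + y))))"
      unfolding fourier_def by (rule haar_integral_translate[OF haar meas[of x], symmetric])
    also have "\<dots> = (LINT y|\<mu>. add_char z * (f y * add_char (- (x * y))))"
    proof (intro Bochner_Integration.integral_cong refl)
      fix y
      have "- (x * (a + y)) = z + - (x * y)" using \<open>x \<noteq> 0\<close> by (simp add: a_def ring_distribs)
      then have "add_char (- (x * (a + y))) = add_char z * add_char (- (x * y))"
        by (simp only: add_char_nonarch(1)[OF B])
      then show "f (a + y) * add_char (- (x * (a + y))) = add_char z * (f y * add_char (- (x * y)))"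
        using \<delta>(2)[OF \<open>vn a < \<delta>\<close>] by simp
    qed
    also have "\<dots> = add_char z * fourier \<mu> f x" by (simp add: fourier_def)
    finally show False using z that by simp
  qed
  then show ?thesis by blast
qed

theorem conductor_bounded_below_nonarch:
  fixes \<mu> :: "'v measure"
  assumes sd: "self_dual_haar \<mu>" and B: "\<exists>B. finite_basis_over BF B"
    and D: "countable (D :: 'v set)" "closure D = UNIV"
  shows "\<exists>c::real. \<forall>f. schwartz_bruhat f \<longrightarrow>
           l2_inner \<mu> (conductor_op \<mu> f) f \<in> \<real> \<and>
           Re (l2_inner \<mu> (conductor_op \<mu> f) f) \<ge> c * (l2_norm \<mu> f)\<^sup>2"
proof -
  have haar: "haar_measure \<mu>" using sd by (simp add: self_dual_haar_def)
  have sets: "sets \<mu> = sets borel" using haar by (simp add: haar_measure_def)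
  \<comment> \<open>The scales of the abstract inequality are powers of \<open>b^2\<close>, and the
    balls at this place have radii that are powers of \<open>q\<close>.\<close>
  define b where "b = sqrt (real q)"
  have b: "1 < b" using q_ge_2 by (simp add: b_def)
  have b_powr: "b powr (2 * real_of_int k) = real q powi k" for k
  proof -
    have "b powr (2 * real_of_int k) = (b powr 2) powr real_of_int k" by (simp add: powr_powr)
    also have "b powr 2 = real q" using b powr_realpow[of b 2] by (simp add: b_def)
    finally show ?thesis using q_ge_2 by (simp add: powr_real_of_int')
  qed
  have zero: "add_char (0 :: 'v) = 1" using add_char_nonarch(3)[OF B] by force
  have char: "add_char (- x) = cnj (add_char x)" for x :: 'v
  proof -
    have "add_char x * add_char (- x) = 1"
      using add_char_nonarch(1)[OF B, of x "- x"] zero by simp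
    moreover have "add_char x * cnj (add_char x) = 1"
      using complex_norm_square[of "add_char x"] add_char_nonarch(2)[OF B, of x] by simp
    moreover have "add_char x \<noteq> 0" using add_char_nonarch(2)[OF B, of x] by auto
    ultimately show ?thesis using mult_left_cancel[of "add_char x" "add_char (- x)" "cnj (add_char x)"] by simp
  qed
  have "\<forall>\<^sub>F y in nhds x. add_char y = add_char x" for x :: 'v
  proof -
    obtain \<delta> where \<delta>: "\<delta> > 0" "\<And>x::'v. vn x \<le> \<delta> \<Longrightarrow> add_char x = 1"
      using add_char_nonarch(3)[OF B] by blast
    show ?thesis
    proof (rule eventually_mono[OF eventually_nhds_ball[OF \<delta>(1)]])
      fix y assume "vn (y - x) < \<delta>"
      then show "add_char y = add_char x"
        using add_char_nonarch(1)[OF B, of "y - x" x] \<delta>(2)[of "y - x"] by simp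
    qed
  qed
  then have cont: "continuous_on UNIV (add_char :: 'v \<Rightarrow> complex)" by (rule locally_constant_continuous)
  have char_meas: "(\<lambda>y. add_char (x * y)) \<in> borel_measurable (borel :: 'v measure)" for x
    using continuous_on_compose2[OF cont continuous_vmult] by (intro borel_measurable_continuous_onI) simp
  have lf: "log_fourier \<mu> nabs (\<lambda>x y. add_char (x * y)) b (measure \<mu> (vball 0))"
  proof (rule log_fourier_haar[OF haar D nabs_measurable nabs_nonneg b _ cont add_char_nonarch(2)[OF B]])
    fix k
    have "{x. nabs x \<le> b powr (2 * real_of_int k)} = vball (- k)"
      unfolding b_powr using nabs_le_iff by blast
    then show "emeasure \<mu> {x. nabs x \<le> b powr (2 * real_of_int k)} \<le> ennreal (measure \<mu> (vball 0) * b powr (2 * real_of_int k))"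
      using emeasure_vball[OF haar, of "- k"] by (simp add: b_powr)
  qed
  interpret log_fourier \<mu> nabs "\<lambda>x y. add_char (x * y)" b "measure \<mu> (vball 0)" by (rule lf)
  have Fo: "Fo f = fourier \<mu> f" for f by (simp add: fun_eq_iff Fo_def fourier_def char)
  obtain s where s: "s > 0" "\<And>x::'v. nabs x = vn x powr s" using nabs_powr by blast
  have bounded_support: "integrable \<mu> g \<and> integrable \<mu> (\<lambda>x. complex_of_real (ln (nabs x)) * g x)"
    if "g \<in> borel_measurable \<mu>" "\<And>x. cmod (g x) \<le> K" "\<And>x. g x \<noteq> 0 \<Longrightarrow> vn x \<le> R" for g K R
  proof -
    \<comment> \<open>A bounded function of bounded support satisfies the decay condition with the
      largest value of \<open>(1 + nabs x)^3\<close> on the support absorbed into the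
      constant.\<close>
    have bound: "cmod (g x) \<le> (K * (1 + \<bar>R\<bar> powr s) ^ 3) / (1 + nabs x) ^ 3" for x
    proof (cases "g x = 0")
      case True
      have "0 \<le> K" using that(2)[of x] norm_ge_zero order_trans by blast
      then show ?thesis using True nabs_nonneg[of x] by simp
    next
      case False
      then have "nabs x \<le> \<bar>R\<bar> powr s"
        unfolding s(2) using that(3)[of x] s(1) by (intro powr_mono2) auto
      then have "(1 + nabs x) ^ 3 \<le> (1 + \<bar>R\<bar> powr s) ^ 3"
        using nabs_nonneg[of x] by (intro power_mono) auto
      moreover have "0 \<le> K" using that(2)[of x] norm_ge_zero order_trans by blast
      ultimately have "cmod (g x) * (1 + nabs x) ^ 3 \<le> K * (1 + \<bar>R\<bar> powr s) ^ 3"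
        using that(2)[of x] nabs_nonneg[of x] by (intro mult_mono) auto
      moreover have "0 < (1 + nabs x) ^ 3" using nabs_nonneg[of x] by simp
      ultimately show ?thesis by (simp only: pos_le_divide_eq)
    qed
    show ?thesis using integrable_decay[OF that(1) bound] by blast
  qed
  have m_meas: "(\<lambda>y. indicator (vball k) y) \<in> borel_measurable \<mu>" for k
    unfolding measurable_cong_sets[OF sets refl]
    by (intro borel_measurable_indicator borel_closed closed_vball)
  have sb: "integrable \<mu> f \<and> integrable \<mu> (\<lambda>x. complex_of_real (ln (nabs x)) * f x)"
    if f: "schwartz_bruhat f" for f
  proof -
    obtain K R where KR: "\<And>x. cmod (f x) \<le> K \<and> (f x \<noteq> 0 \<longrightarrow> vn x \<le> R)"
      using schwartz_bruhat_bounded(2)[OF f] by blast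
    have "f \<in> borel_measurable \<mu>"
      unfolding measurable_cong_sets[OF sets refl] by (rule schwartz_bruhat_bounded(1)[OF f])
    then show ?thesis by (rule bounded_support[of _ K R]) (use KR in auto)
  qed
  show ?thesis
  \<comment> \<open>\<open>vball k\<close> is the set of \<open>y\<close> with
    \<open>nabs y \<le> 1 / t\<close> for \<open>t = q powi k\<close>, so the two quantitative
    cutoff conditions just say on which side of \<open>1 / t\<close> the modulus lies.\<close>
  proof (rule conductor_bounded_below_criterion[OF sd lf char, where m = "\<lambda>k. indicator (vball k)"])
    fix f :: "'v \<Rightarrow> complex" assume f: "schwartz_bruhat f"
    show "integrable \<mu> f" "integrable \<mu> (\<lambda>x. complex_of_real (ln (nabs x)) * f x)" using sb[OF f] by auto
    obtain R where R: "\<And>x. fourier \<mu> f x \<noteq> 0 \<Longrightarrow> vn x \<le> R"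
      using fourier_bounded_support[OF sd B f char_meas] by blast
    have "Fo f \<in> borel_measurable \<mu>" using sb[OF f] by (intro Fo_measurable) auto
    then have "integrable \<mu> (Fo f) \<and> integrable \<mu> (\<lambda>x. complex_of_real (ln (nabs x)) * Fo f x)"
    proof (rule bounded_support)
      show "vn x \<le> R" if "Fo f x \<noteq> 0" for x using R[of x] that by (simp add: Fo)
    qed (rule norm_Fo_le)
    then show "integrable \<mu> (\<lambda>x. complex_of_real (ln (nabs x)) * fourier \<mu> f x)" by (simp add: Fo)
  next
    fix k y
    show "indicator (vball k) y * (b powr (2 * real_of_int k) * nabs y) \<le> 1"
    proof (cases "y \<in> vball k")
      case True
      then have "nabs y \<le> real q powi (- k)" using nabs_le_iff[of y "- k"] by simp
      then have "real q powi k * nabs y \<le> real q powi k * real q powi (- k)" by (intro mult_left_mono) auto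
      also have "\<dots> = 1" using q_ge_2 by (simp add: power_int_minus)
      finally show ?thesis using True by (simp add: b_powr)
    qed simp
    show "1 - indicator (vball k) y \<le> b powr (2 * real_of_int k) * nabs y"
    proof (cases "y \<in> vball k")
      case False
      then have "real q powi (- k) \<le> nabs y" using nabs_le_iff[of y "- k"] by simp
      then have "real q powi k * real q powi (- k) \<le> real q powi k * nabs y" by (intro mult_left_mono) auto
      moreover have "real q powi k * real q powi (- k) = 1" using q_ge_2 by (simp add: power_int_minus)
      ultimately show ?thesis using False by (simp add: b_powr)
    qed (simp add: nabs_nonneg)
  qed (rule m_meas, rule schwartz_bruhat_cutoff, simp_all add: indicator_def)
qed

end

section \<open>Archimedean places\<close>

text \<open>The definition asks for one coherent family of all iterated derivatives. A set of
  decaying functions closed under differentiation yields it: derivatives are chosen inside the set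
  and iterated along the list of directions.\<close>

lemma schwartz_if_closed_under_derivatives:
  fixes f :: "'a::euclidean_space \<Rightarrow> complex" and S :: "('a \<Rightarrow> complex) set"
  assumes f: "f \<in> S"
    and deriv: "\<And>g. g \<in> S \<Longrightarrow> \<exists>g'. (\<forall>x. (g has_derivative (\<lambda>h. g' h x)) (at x)) \<and> (\<forall>h. g' h \<in> S)"
    and decay: "\<And>g k. g \<in> S \<Longrightarrow> bounded (range (\<lambda>x. norm x ^ k *\<^sub>R g x))"
  shows "schwartz f"
proof -
  obtain d where d: "\<And>g x. g \<in> S \<Longrightarrow> (g has_derivative (\<lambda>h. d g h x)) (at x)"
    "\<And>g h. g \<in> S \<Longrightarrow> d g h \<in> S"
    using deriv by metis
  define D where "D hs = foldr (\<lambda>h g. d g h) hs f" for hs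
  have S: "D hs \<in> S" for hs by (induction hs) (simp_all add: D_def f d)
  have "D [] = f" by (simp add: D_def)
  moreover have "(D hs has_derivative (\<lambda>h. D (h # hs) x)) (at x)" for hs x
    using d(1)[OF S[of hs]] by (simp add: D_def)
  moreover have "bounded (range (\<lambda>x. norm x ^ k *\<^sub>R D hs x))" for hs k by (rule decay[OF S])
  ultimately show ?thesis unfolding schwartz_def by blast
qed

section \<open>Gaussian multiples of Schwartz functions\<close>

text \<open>Differentiating a Gaussian times \<open>f\<close> produces the Gaussian times sums of
  derivatives of \<open>f\<close> with polynomial coefficients. This is the smallest convenient
  class of such sums, the polynomials being generated by the linear forms
  \<open>x \<bullet> u\<close>.\<close>

inductive_set polynomial_multiples ::
  "('a::euclidean_space list \<Rightarrow> 'a \<Rightarrow> complex) \<Rightarrow> ('a \<Rightarrow> complex) set"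
  for D where
  base: "D hs \<in> polynomial_multiples D"
| add: "p \<in> polynomial_multiples D \<Longrightarrow> q \<in> polynomial_multiples D \<Longrightarrow>
    (\<lambda>x. p x + q x) \<in> polynomial_multiples D"
| const: "p \<in> polynomial_multiples D \<Longrightarrow> (\<lambda>x. complex_of_real r * p x) \<in> polynomial_multiples D"
| inner: "p \<in> polynomial_multiples D \<Longrightarrow> (\<lambda>x. complex_of_real (x \<bullet> u) * p x) \<in> polynomial_multiples D"

lemma polynomial_multiples_deriv:
  assumes D: "\<And>hs x. (D hs has_derivative (\<lambda>h. D (h # hs) x)) (at x)"
    and p: "p \<in> polynomial_multiples D"
  shows "\<exists>p'. (\<forall>x. (p has_derivative (\<lambda>h. p' h x)) (at x)) \<and> (\<forall>h. p' h \<in> polynomial_multiples D)"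
  using p
proof induction
  case (base hs)
  show ?case
    by (intro exI[of _ "\<lambda>h. D (h # hs)"] conjI allI D polynomial_multiples.base)
next
  case (add p q)
  then obtain p' q' where p': "\<And>x. (p has_derivative (\<lambda>h. p' h x)) (at x)" "\<And>h. p' h \<in> polynomial_multiples D"
    and q': "\<And>x. (q has_derivative (\<lambda>h. q' h x)) (at x)" "\<And>h. q' h \<in> polynomial_multiples D"
    by blast
  show ?case
    by (intro exI[of _ "\<lambda>h x. p' h x + q' h x"] conjI allI has_derivative_add
        polynomial_multiples.add p' q')
next
  case (const p r)
  then obtain p' where p': "\<And>x. (p has_derivative (\<lambda>h. p' h x)) (at x)" "\<And>h. p' h \<in> polynomial_multiples D"
    by blast
  show ?case
    by (intro exI[of _ "\<lambda>h x. complex_of_real r * p' h x"] conjI allI has_derivative_mult_right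
        polynomial_multiples.const p')
next
  case (inner p u)
  then obtain p' where p': "\<And>x. (p has_derivative (\<lambda>h. p' h x)) (at x)" "\<And>h. p' h \<in> polynomial_multiples D"
    by blast
  have "((\<lambda>x. complex_of_real (x \<bullet> u) * p x) has_derivative
      (\<lambda>h. complex_of_real (x \<bullet> u) * p' h x + complex_of_real (h \<bullet> u) * p x)) (at x)" for x
    by (intro has_derivative_mult p' has_derivative_of_real has_derivative_inner_left has_derivative_ident)
  then show ?case
    by (intro exI[of _ "\<lambda>h x. complex_of_real (x \<bullet> u) * p' h x + complex_of_real (h \<bullet> u) * p x"]
        conjI allI polynomial_multiples.add polynomial_multiples.const polynomial_multiples.inner inner p')
qed

text \<open>A linear factor uses up one power of the norm, so the induction must treat all
  \<open>k\<close> at once.\<close>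

lemma polynomial_multiples_decay:
  assumes D: "\<And>hs k. bounded (range (\<lambda>x. norm x ^ k *\<^sub>R D hs x))"
    and p: "p \<in> polynomial_multiples D"
  shows "bounded (range (\<lambda>x. norm x ^ k *\<^sub>R p x))"
  using p
proof (induction arbitrary: k)
  case (base hs) then show ?case by (rule D)
next
  case (add p q)
  obtain A B where "\<And>x. cmod (norm x ^ k *\<^sub>R p x) \<le> A" "\<And>x. cmod (norm x ^ k *\<^sub>R q x) \<le> B"
    using add.IH(1)[of k] add.IH(2)[of k] unfolding bounded_iff by auto
  then have "cmod (norm x ^ k *\<^sub>R (p x + q x)) \<le> A + B" for x
    unfolding scaleR_add_right by (intro order_trans[OF norm_triangle_ineq] add_mono)
  then show ?case unfolding bounded_iff by auto
next
  case (const p r)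
  obtain A where A: "\<And>x. cmod (norm x ^ k *\<^sub>R p x) \<le> A"
    using const.IH[of k] unfolding bounded_iff by auto
  have "cmod (norm x ^ k *\<^sub>R (complex_of_real r * p x)) \<le> \<bar>r\<bar> * A" for x
    using mult_left_mono[OF A[of x], of "\<bar>r\<bar>"] by (simp add: norm_mult ac_simps)
  then show ?case unfolding bounded_iff by auto
next
  case (inner p u)
  obtain A where A: "\<And>x. cmod (norm x ^ Suc k *\<^sub>R p x) \<le> A"
    using inner.IH[of "Suc k"] unfolding bounded_iff by auto
  have "cmod (norm x ^ k *\<^sub>R (complex_of_real (x \<bullet> u) * p x)) \<le> norm u * A" for x
  proof -
    have "cmod (norm x ^ k *\<^sub>R (complex_of_real (x \<bullet> u) * p x)) = \<bar>x \<bullet> u\<bar> * (norm x ^ k * cmod (p x))"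
      by (simp add: norm_mult)
    also have "\<dots> \<le> (norm x * norm u) * (norm x ^ k * cmod (p x))"
      by (intro mult_right_mono Cauchy_Schwarz_ineq2) auto
    also have "\<dots> = norm u * cmod (norm x ^ Suc k *\<^sub>R p x)" by simp
    also have "\<dots> \<le> norm u * A" by (intro mult_left_mono A) auto
    finally show ?thesis .
  qed
  then show ?case unfolding bounded_iff by auto
qed

text \<open>The Gaussian times \<open>polynomial_multiples D\<close> is closed under
  differentiation, the derivative of the Gaussian contributing a linear factor. Decay is inherited
  because the Gaussian is at most 1 for \<open>c \<ge> 0\<close>.\<close>

lemma schwartz_gaussian_mult:
  fixes f :: "'a::euclidean_space \<Rightarrow> complex"
  assumes f: "schwartz f" and c: "0 \<le> c"
  shows "schwartz (\<lambda>x. complex_of_real (exp (- c * (x \<bullet> x))) * f x)"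
proof -
  obtain D where D: "D [] = f" "\<And>hs x. (D hs has_derivative (\<lambda>h. D (h # hs) x)) (at x)"
    "\<And>hs k. bounded (range (\<lambda>x. norm x ^ k *\<^sub>R D hs x))"
    using f unfolding schwartz_def by blast
  define E :: "'a \<Rightarrow> real" where "E x = exp (- c * (x \<bullet> x))" for x
  have dE: "((\<lambda>x. complex_of_real (E x)) has_derivative (\<lambda>h. complex_of_real (E x * (- 2 * c * (x \<bullet> h))))) (at x)" for x
    unfolding E_def by (auto intro!: derivative_eq_intros simp: inner_commute algebra_simps)
  let ?S = "(\<lambda>p x. complex_of_real (E x) * p x) ` polynomial_multiples D"
  show ?thesis
  proof (rule schwartz_if_closed_under_derivatives[where S = ?S])
    show "(\<lambda>x. complex_of_real (exp (- c * (x \<bullet> x))) * f x) \<in> ?S"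
      using polynomial_multiples.base[of D "[]"] by (intro image_eqI[of _ _ f]) (auto simp: E_def D)
  next
    fix g assume "g \<in> ?S"
    then obtain p where p: "p \<in> polynomial_multiples D" "g = (\<lambda>x. complex_of_real (E x) * p x)" by blast
    obtain p' where p': "\<And>x. (p has_derivative (\<lambda>h. p' h x)) (at x)" "\<And>h. p' h \<in> polynomial_multiples D"
      using polynomial_multiples_deriv[OF D(2) p(1)] by blast
    let ?g' = "\<lambda>h x. complex_of_real (E x) * (p' h x + complex_of_real (- 2 * c) * (complex_of_real (x \<bullet> h) * p x))"
    have "(g has_derivative (\<lambda>h. ?g' h x)) (at x)" for x
    proof -
      have "(g has_derivative (\<lambda>h. complex_of_real (E x) * p' h x + complex_of_real (E x * (- 2 * c * (x \<bullet> h))) * p x)) (at x)"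
        unfolding p(2) by (intro has_derivative_mult dE p')
      then show ?thesis by (simp add: algebra_simps)
    qed
    moreover have "?g' h \<in> ?S" for h
      using p(1) p'(2)
      by (intro image_eqI[OF refl] polynomial_multiples.add polynomial_multiples.const
          polynomial_multiples.inner)
    ultimately show "\<exists>g'. (\<forall>x. (g has_derivative (\<lambda>h. g' h x)) (at x)) \<and> (\<forall>h. g' h \<in> ?S)"
      by (intro exI[of _ ?g'] conjI allI)
  next
    fix g k assume "g \<in> ?S"
    then obtain p where p: "p \<in> polynomial_multiples D" "g = (\<lambda>x. complex_of_real (E x) * p x)" by blast
    obtain A where A: "\<And>x. cmod (norm x ^ k *\<^sub>R p x) \<le> A"
      using polynomial_multiples_decay[OF D(3) p(1), of k] unfolding bounded_iff by auto
    have "cmod (norm x ^ k *\<^sub>R g x) \<le> A" for x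
    proof -
      have "cmod (norm x ^ k *\<^sub>R g x) = E x * cmod (norm x ^ k *\<^sub>R p x)"
        by (simp add: p(2) norm_mult E_def)
      also have "\<dots> \<le> cmod (norm x ^ k *\<^sub>R p x)"
        using c by (intro mult_left_le_one_le) (auto simp: E_def)
      finally show ?thesis using A[of x] by simp
    qed
    then show "bounded (range (\<lambda>x. norm x ^ k *\<^sub>R g x))" unfolding bounded_iff by auto
  qed
qed

section \<open>Directional derivatives and decay\<close>

lemma schwartz_directional_derivative:
  fixes f :: "'a::euclidean_space \<Rightarrow> complex"
  assumes "schwartz f"
  shows "\<exists>f'. schwartz f' \<and> (\<forall>x. ((\<lambda>s. f (x + s *\<^sub>R a)) has_vector_derivative f' x) (at 0))"
proof -
  obtain D where D: "D [] = f" "\<And>hs x. (D hs has_derivative (\<lambda>h. D (h # hs) x)) (at x)"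
    "\<And>hs k. bounded (range (\<lambda>x. norm x ^ k *\<^sub>R D hs x))"
    using assms unfolding schwartz_def by blast
  have "schwartz (D [a])"
    unfolding schwartz_def
    \<comment> \<open>The head of the list is the direction differentiated last, so \<open>a\<close>
      is appended at the end.\<close>
    by (intro exI[of _ "\<lambda>hs. D (hs @ [a])"] conjI allI) (use D in auto)
  moreover have "((\<lambda>s. f (x + s *\<^sub>R a)) has_vector_derivative D [a] x) (at 0)" for x
  proof -
    have lin: "linear (\<lambda>h. D [h] x)" using D(2)[of "[]" x] has_derivative_linear by blast
    have "(f has_derivative (\<lambda>h. D [h] x)) (at (x + 0 *\<^sub>R a))" using D(2)[of "[]" x] D(1) by simp
    then have "((\<lambda>s. f (x + s *\<^sub>R a)) has_derivative (\<lambda>s. D [s *\<^sub>R a] x)) (at 0)"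
      by (rule has_derivative_compose[rotated]) (auto intro!: derivative_eq_intros)
    then show ?thesis
      unfolding has_vector_derivative_def using linear_scale[OF lin] by simp
  qed
  ultimately show ?thesis by blast
qed

lemma schwartz_continuous:
  assumes "schwartz f" shows "continuous_on UNIV f"
proof -
  obtain D where D: "D [] = f" "\<And>hs x. (D hs has_derivative (\<lambda>h. D (h # hs) x)) (at x)"
    using assms unfolding schwartz_def by blast
  show ?thesis
    using D(2)[of "[]"] unfolding D(1) by (intro continuous_at_imp_continuous_on ballI has_derivative_continuous)
qed

lemma schwartz_decay:
  fixes f :: "'a::euclidean_space \<Rightarrow> complex"
  assumes "schwartz f" shows "\<exists>K. \<forall>x. cmod (f x) \<le> K / (1 + norm x) ^ k"
proof -
  obtain D where D: "D [] = f" "\<forall>hs x. (D hs has_derivative (\<lambda>h. D (h # hs) x)) (at x)"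
    "\<And>hs k. bounded (range (\<lambda>x. norm x ^ k *\<^sub>R D hs x))"
    using assms unfolding schwartz_def by blast
  obtain A B where A: "\<And>x. cmod (norm x ^ 0 *\<^sub>R f x) \<le> A" and B: "\<And>x. cmod (norm x ^ k *\<^sub>R f x) \<le> B"
    using D(3)[of 0 "[]"] D(3)[of k "[]"] unfolding D(1) bounded_iff by auto
  have "cmod (f x) \<le> (2 ^ k * (A + B)) / (1 + norm x) ^ k" for x
  proof -
    have "(1 + norm x) ^ k \<le> (2 * max 1 (norm x)) ^ k" by (intro power_mono) auto
    also have "\<dots> = 2 ^ k * max 1 (norm x) ^ k" by (rule power_mult_distrib)
    also have "max 1 (norm x) ^ k \<le> 1 + norm x ^ k" by (cases "norm x \<le> 1") (auto simp: max_def)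
    finally have "cmod (f x) * (1 + norm x) ^ k \<le> cmod (f x) * (2 ^ k * (1 + norm x ^ k))"
      by (intro mult_left_mono) auto
    also have "\<dots> = 2 ^ k * (cmod (norm x ^ 0 *\<^sub>R f x) + cmod (norm x ^ k *\<^sub>R f x))"
      by (simp add: algebra_simps)
    also have "\<dots> \<le> 2 ^ k * (A + B)" by (intro mult_left_mono add_mono A B) auto
    finally show ?thesis by (simp add: pos_le_divide_eq add_pos_nonneg)
  qed
  then show ?thesis by blast
qed

text \<open>The mean value inequality reduces this to the derivative at \<open>x + s a\<close>, and
  \<open>1 + norm x \<le> (1 + norm a) * (1 + norm (x + s a))\<close> transfers its decay to
  \<open>x\<close>. Uniformity in \<open>t\<close> provides the majorant for differentiating under
  the integral.\<close>

lemma schwartz_difference_quotient: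
  fixes f :: "'a::euclidean_space \<Rightarrow> complex"
  assumes "schwartz f"
  shows "\<exists>K. \<forall>x t. 0 < t \<longrightarrow> t \<le> 1 \<longrightarrow> cmod ((f (x + t *\<^sub>R a) - f x) /\<^sub>R t) \<le> K / (1 + norm x) ^ k"
proof -
  obtain f' where f': "schwartz f'" "\<And>x. ((\<lambda>s. f (x + s *\<^sub>R a)) has_vector_derivative f' x) (at 0)"
    using schwartz_directional_derivative[OF assms] by blast
  obtain K where K: "\<And>x. cmod (f' x) \<le> K / (1 + norm x) ^ k" using schwartz_decay[OF f'(1)] by blast
  have K0: "0 \<le> K" using K[of 0] norm_ge_zero[of "f' 0"] by (simp del: norm_ge_zero)
  have bound: "cmod (f' (x + s *\<^sub>R a)) \<le> K * (1 + norm a) ^ k / (1 + norm x) ^ k" if "0 \<le> s" "s \<le> 1" for x s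
  proof -
    have "norm x \<le> norm (x + s *\<^sub>R a) + norm (s *\<^sub>R a)"
      using norm_triangle_ineq4[of "x + s *\<^sub>R a" "s *\<^sub>R a"] by simp
    also have "norm (s *\<^sub>R a) \<le> norm a" using that by (simp add: mult_left_le_one_le)
    finally have "1 + norm x \<le> (1 + norm a) * (1 + norm (x + s *\<^sub>R a))"
      using mult_nonneg_nonneg[OF norm_ge_zero[of a] norm_ge_zero[of "x + s *\<^sub>R a"]]
      unfolding ring_distribs mult_1 mult_1_right by linarith
    then have "(1 + norm x) ^ k \<le> (1 + norm a) ^ k * (1 + norm (x + s *\<^sub>R a)) ^ k"
      unfolding power_mult_distrib[symmetric] by (intro power_mono) auto
    then have "K * (1 + norm x) ^ k \<le> K * (1 + norm a) ^ k * (1 + norm (x + s *\<^sub>R a)) ^ k"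
      using K0 by (simp add: mult.assoc mult_left_mono)
    then have "K / (1 + norm (x + s *\<^sub>R a)) ^ k \<le> K * (1 + norm a) ^ k / (1 + norm x) ^ k"
      by (simp add: field_simps add_pos_nonneg)
    then show ?thesis using K[of "x + s *\<^sub>R a"] by simp
  qed
  have "cmod ((f (x + t *\<^sub>R a) - f x) /\<^sub>R t) \<le> K * (1 + norm a) ^ k / (1 + norm x) ^ k"
    if t: "0 < t" "t \<le> 1" for x t
  proof -
    let ?B = "K * (1 + norm a) ^ k / (1 + norm x) ^ k"
    have deriv: "((\<lambda>s. f (x + s *\<^sub>R a)) has_vector_derivative f' (x + s *\<^sub>R a)) (at s)" for s
    proof -
      have "((\<lambda>r. f ((x + s *\<^sub>R a) + r *\<^sub>R a)) has_vector_derivative f' (x + s *\<^sub>R a)) (at (s - s))"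
        using f'(2)[of "x + s *\<^sub>R a"] by simp
      then have "(((\<lambda>r. f ((x + s *\<^sub>R a) + r *\<^sub>R a)) \<circ> (\<lambda>s'. s' - s)) has_vector_derivative (1 *\<^sub>R f' (x + s *\<^sub>R a))) (at s)"
        by (intro vector_diff_chain_at) (auto intro!: derivative_eq_intros)
      then show ?thesis by (simp add: o_def algebra_simps)
    qed
    have "cmod (f (x + t *\<^sub>R a) - f (x + 0 *\<^sub>R a)) \<le> ?B * norm (t - 0)"
    proof (rule differentiable_bound[of "{0..t}" "\<lambda>s. f (x + s *\<^sub>R a)" "\<lambda>s h. h *\<^sub>R f' (x + s *\<^sub>R a)"])
      show "((\<lambda>s. f (x + s *\<^sub>R a)) has_derivative (\<lambda>h. h *\<^sub>R f' (x + s *\<^sub>R a))) (at s within {0..t})" for s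
        using deriv[of s] unfolding has_vector_derivative_def by (rule has_derivative_at_withinI)
      show "onorm (\<lambda>h. h *\<^sub>R f' (x + s *\<^sub>R a)) \<le> ?B" if "s \<in> {0..t}" for s
      proof (rule onorm_le)
        fix h
        have "\<bar>h\<bar> * cmod (f' (x + s *\<^sub>R a)) \<le> \<bar>h\<bar> * ?B"
          using bound[of s x] that t by (intro mult_left_mono) auto
        then show "cmod (h *\<^sub>R f' (x + s *\<^sub>R a)) \<le> ?B * norm h"
          by (simp only: norm_scaleR real_norm_def mult.commute)
      qed
    qed (use t in auto)
    then have "cmod (f (x + t *\<^sub>R a) - f x) / t \<le> ?B" using t by (simp add: pos_divide_le_eq)
    moreover have "cmod ((f (x + t *\<^sub>R a) - f x) /\<^sub>R t) = cmod (f (x + t *\<^sub>R a) - f x) / t"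
      unfolding norm_scaleR using t by (simp add: divide_inverse mult.commute)
    ultimately show ?thesis by (simp only:)
  qed
  then show ?thesis by blast
qed

lemma vector_derivative_quotient:
  assumes "(g has_vector_derivative D) (at (0::real))"
  shows "((\<lambda>t. (g t - g 0) /\<^sub>R t) \<longlongrightarrow> D) (at 0)"
proof -
  have "((\<lambda>t. norm (g t - g 0 - t *\<^sub>R D) / norm t) \<longlongrightarrow> 0) (at 0)"
    using assms unfolding has_vector_derivative_def has_derivative_at by simp
  moreover have "norm (g t - g 0 - t *\<^sub>R D) / norm t = norm ((g t - g 0) /\<^sub>R t - D)" if "t \<noteq> 0" for t
  proof -
    have "(g t - g 0) /\<^sub>R t - D = (g t - g 0 - t *\<^sub>R D) /\<^sub>R t" using that by (simp add: scaleR_diff_right)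
    then show ?thesis by (simp add: divide_inverse mult.commute)
  qed
  then have "\<forall>\<^sub>F t in at 0. norm (g t - g 0 - t *\<^sub>R D) / norm t = norm ((g t - g 0) /\<^sub>R t - D)"
    by (auto simp: eventually_at_filter)
  ultimately have "((\<lambda>t. norm ((g t - g 0) /\<^sub>R t - D)) \<longlongrightarrow> 0) (at 0)"
    by (rule Lim_transform_eventually)
  then show ?thesis by (rule LIM_zero_cancel[OF tendsto_norm_zero_cancel])
qed

text \<open>Two identifications of the completion with the complex numbers may differ by
  conjugation; this makes the Schwartz class insensitive to the choice.\<close>

lemma schwartz_cnj:
  assumes "schwartz (f :: complex \<Rightarrow> complex)" shows "schwartz (f \<circ> cnj)"
proof -
  obtain D where D: "D [] = f" "\<And>hs x. (D hs has_derivative (\<lambda>h. D (h # hs) x)) (at x)"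
    "\<And>hs k. bounded (range (\<lambda>x. norm x ^ k *\<^sub>R D hs x))"
    using assms unfolding schwartz_def by blast
  let ?D = "\<lambda>hs x. D (map cnj hs) (cnj x)"
  have "(?D hs has_derivative (\<lambda>h. ?D (h # hs) x)) (at x)" for hs x
    using has_derivative_compose[OF has_derivative_cnj[OF has_derivative_ident[of "at x"]] D(2)[of "map cnj hs" "cnj x"]]
    by simp
  moreover have "bounded (range (\<lambda>x. norm x ^ k *\<^sub>R ?D hs x))" for hs k
    using D(3)[of k "map cnj hs"] unfolding bounded_iff by (auto) (metis complex_mod_cnj)
  ultimately show ?thesis
    unfolding schwartz_def using D(1) by (intro exI[of _ ?D]) (auto simp: o_def)
qed

section \<open>Archimedean fields transported to the real or complex numbers\<close>

text \<open>One locale for both kinds of archimedean place: \<open>'a\<close> will be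
  \<open>real\<close> or \<open>complex\<close>. The exponent \<open>DIM('a)\<close> yields the
  usual absolute value in the real case and its square in the complex case.\<close>

locale arch_field = valued_field ty for ty :: "'v::{field_char_0,complete_space} itself" +
  fixes \<psi> :: "'v \<Rightarrow> 'a::{real_normed_field,euclidean_space}"
  assumes iso: "topological_field_iso \<psi>"
    and not_finite: "\<not> finite_place TYPE('v)"
    and nabs_eq: "\<And>x. nabs x = norm (\<psi> x) ^ DIM('a)"
    and dim: "DIM('a) \<le> 2"
    and schwartz_bruhat_iff: "\<And>f. schwartz_bruhat f \<longleftrightarrow> schwartz (f \<circ> inv \<psi>)"
    and basis: "\<exists>B. finite_basis_over (base_field :: 'v set) B"
begin

abbreviation \<theta> :: "'a \<Rightarrow> 'v" where "\<theta> \<equiv> inv \<psi>"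

lemma bij: "bij \<psi>" and psi_add: "\<psi> (x + y) = \<psi> x + \<psi> y" and psi_mult: "\<psi> (x * y) = \<psi> x * \<psi> y"
  and homeo: "homeomorphism UNIV UNIV \<psi> \<theta>"
  using iso by (auto simp: topological_field_iso_def)

lemma psi_theta [simp]: "\<psi> (\<theta> z) = z" and theta_psi [simp]: "\<theta> (\<psi> x) = x"
  using homeo by (simp_all add: homeomorphism_def)

lemma psi_eqI: "\<psi> x = \<psi> y \<Longrightarrow> x = y"
  using theta_psi by metis

lemma theta_eq_iff: "\<theta> z = x \<longleftrightarrow> z = \<psi> x"
  by auto

lemma psi_0 [simp]: "\<psi> 0 = 0" using psi_add[of 0 0] by simp

lemma psi_1 [simp]: "\<psi> 1 = 1"
proof -
  have "\<psi> 1 \<noteq> 0" using psi_eqI[of 1 0] by auto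
  then show ?thesis using psi_mult[of 1 1] by simp
qed

lemma psi_minus: "\<psi> (- x) = - \<psi> x"
  using psi_add[of x "- x"] by (simp add: eq_neg_iff_add_eq_0 add.commute)

lemma psi_of_nat: "\<psi> (of_nat n) = of_nat n"
  by (induction n) (simp_all add: psi_add)

lemma psi_of_int: "\<psi> (of_int n) = of_int n"
  by (cases n rule: int_cases2) (simp_all add: psi_of_nat psi_minus)

lemma psi_of_rat: "\<psi> (of_rat r) = of_real (of_rat r)"
proof -
  obtain a b where r: "r = Fract a b" "b > 0" by (cases r) auto
  have "\<psi> (of_rat r) * of_int b = \<psi> (of_rat r * of_int b)" by (simp add: psi_mult psi_of_int)
  also have "of_rat r * of_int b = (of_int a :: 'v)" using r by (simp add: of_rat_rat)
  finally have "\<psi> (of_rat r) * of_int b = of_int a" by (simp add: psi_of_int)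
  moreover have "(of_int b :: 'a) \<noteq> 0" using r by simp
  ultimately have "\<psi> (of_rat r) = of_int a / of_int b" by (simp add: nonzero_eq_divide_eq)
  then show ?thesis using r by (simp add: of_rat_rat)
qed

lemma theta_of_rat: "\<theta> (of_real (of_rat r)) = of_rat r"
  by (simp add: theta_eq_iff psi_of_rat)

lemma theta_0 [simp]: "\<theta> 0 = 0" by (simp add: theta_eq_iff)

lemma theta_add: "\<theta> (z + w) = \<theta> z + \<theta> w" by (simp add: theta_eq_iff psi_add)

lemma theta_mult: "\<theta> (z * w) = \<theta> z * \<theta> w" by (simp add: theta_eq_iff psi_mult)

lemma psi_cont: "continuous_on UNIV \<psi>" and theta_cont: "continuous_on UNIV \<theta>"
  using homeo by (simp_all add: homeomorphism_def)

lemma psi_tendsto: "(s \<longlongrightarrow> x) F \<Longrightarrow> ((\<lambda>n. \<psi> (s n)) \<longlongrightarrow> \<psi> x) F"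
  using continuous_on_tendsto_compose[OF psi_cont] by auto

lemma theta_tendsto: "(s \<longlongrightarrow> x) F \<Longrightarrow> ((\<lambda>n. \<theta> (s n)) \<longlongrightarrow> \<theta> x) F"
  using continuous_on_tendsto_compose[OF theta_cont] by auto

text \<open>Rationals converging to \<open>x\<close> are carried by \<open>\<psi>\<close> to the
  same rationals in \<open>'a\<close>, where they are Cauchy as real numbers. Their real limit is
  the number described by \<open>base_to_real\<close>, and the image of \<open>x\<close> determines
  it uniquely.\<close>

lemma psi_base_field: assumes "x \<in> BF" shows "\<psi> x = of_real (base_to_real x)"
proof -
  have lim_eq: "\<psi> x = of_real t"
    if "(\<lambda>n. of_rat (r n) :: 'v) \<longlonglongrightarrow> x" "(\<lambda>n. of_rat (r n) :: real) \<longlonglongrightarrow> t" for r t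
  proof -
    have "(\<lambda>n. of_real (of_rat (r n)) :: 'a) \<longlonglongrightarrow> \<psi> x"
      using psi_tendsto[OF that(1)] by (simp add: psi_of_rat)
    moreover have "(\<lambda>n. of_real (of_rat (r n)) :: 'a) \<longlonglongrightarrow> of_real t"
      using that(2) by (rule tendsto_of_real)
    ultimately show ?thesis by (rule LIMSEQ_unique)
  qed
  obtain s where s: "\<forall>n. s n \<in> \<rat>" "s \<longlonglongrightarrow> x" using assms unfolding base_field_seq by blast
  then have "\<forall>n. \<exists>r. s n = of_rat r" by (auto elim: Rats_cases)
  then have "\<exists>r. \<forall>n. s n = of_rat (r n)" by (rule choice)
  then obtain r where "\<forall>n. s n = of_rat (r n)" ..
  then have "s = (\<lambda>n. of_rat (r n))" by auto
  then have sr: "(\<lambda>n. of_rat (r n) :: 'v) \<longlonglongrightarrow> x" using s(2) by (simp only:)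
  have "(\<lambda>n. of_real (of_rat (r n)) :: 'a) \<longlonglongrightarrow> \<psi> x"
    using psi_tendsto[OF sr] by (simp add: psi_of_rat)
  then have "Cauchy (\<lambda>n. of_real (of_rat (r n)) :: 'a)" by (rule LIMSEQ_imp_Cauchy)
  then have "Cauchy (\<lambda>n. of_rat (r n) :: real)"
    unfolding Cauchy_def dist_norm of_real_diff[symmetric] norm_of_real real_norm_def .
  then obtain t where t: "(\<lambda>n. of_rat (r n) :: real) \<longlonglongrightarrow> t"
    using Cauchy_convergent convergent_def by blast
  have "base_to_real x = t"
    unfolding base_to_real_def
  proof (rule the_equality)
    show "\<exists>r. (\<lambda>n. of_rat (r n) :: 'v) \<longlonglongrightarrow> x \<and> (\<lambda>n. of_rat (r n) :: real) \<longlonglongrightarrow> t"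
      using sr t by (intro exI[of _ r] conjI)
    fix t' assume "\<exists>r. (\<lambda>n. of_rat (r n) :: 'v) \<longlonglongrightarrow> x \<and> (\<lambda>n. of_rat (r n) :: real) \<longlonglongrightarrow> t'"
    then obtain r' where "(\<lambda>n. of_rat (r' n) :: 'v) \<longlonglongrightarrow> x" "(\<lambda>n. of_rat (r' n) :: real) \<longlonglongrightarrow> t'"
      by (elim exE conjE)
    then have "\<psi> x = of_real t'" by (rule lim_eq)
    moreover have "\<psi> x = of_real t" using lim_eq[OF sr t] .
    ultimately show "t' = t" by simp
  qed
  then show ?thesis using lim_eq[OF sr t] by simp
qed

lemma theta_of_real_base_field: "\<theta> (of_real t) \<in> BF"
proof -
  have "t \<in> closure \<rat>" using Rats_closure_real by simp
  then obtain s where s: "\<forall>n. s n \<in> \<rat>" "s \<longlonglongrightarrow> t" unfolding closure_sequential by (elim exE conjE)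
  have "(\<lambda>n. \<theta> (of_real (s n))) \<longlonglongrightarrow> \<theta> (of_real t)"
    by (intro theta_tendsto tendsto_of_real s)
  moreover have "\<theta> (of_real (s n)) \<in> \<rat>" for n
  proof -
    obtain r where "s n = of_rat r" using s(1) by (auto elim: Rats_cases)
    then show ?thesis by (simp add: theta_of_rat)
  qed
  ultimately show ?thesis
    unfolding base_field_seq by (intro exI[of _ "\<lambda>n. \<theta> (of_real (s n))"]) simp
qed

text \<open>The trace form read as a real functional on the model field; the character at
  \<open>x\<close> is the exponential of \<open>- 2 * pi * \<i> * L (\<psi> x)\<close>.\<close>

definition L :: "'a \<Rightarrow> real" where "L z = base_to_real (Tr (\<theta> z))"

lemma of_real_L: "of_real (L z) = \<psi> (Tr (\<theta> z))"
  unfolding L_def by (rule psi_base_field[symmetric]) (rule trace_properties(1)[OF basis])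

lemma L_linear: "linear L"
proof (rule linearI)
  fix z w :: 'a and c :: real
  have "(of_real (L (z + w)) :: 'a) = of_real (L z + L w)"
    by (simp add: of_real_L theta_add trace_properties(2)[OF basis] psi_add)
  then show "L (z + w) = L z + L w" by (simp only: of_real_eq_iff)
  have "(of_real (L (c *\<^sub>R z)) :: 'a) = of_real (c *\<^sub>R L z)"
    by (simp add: of_real_L scaleR_conv_of_real theta_mult psi_mult
        trace_properties(3)[OF basis theta_of_real_base_field])
  then show "L (c *\<^sub>R z) = c *\<^sub>R L z" by (simp only: of_real_eq_iff)
qed

lemma L_1: "L 1 \<noteq> 0"
proof
  assume "L 1 = 0"
  moreover have "\<theta> 1 = 1" by (simp add: theta_eq_iff)
  ultimately have "\<psi> (Tr 1) = \<psi> 0" using of_real_L[of 1] by simp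
  then show False using trace_properties(5)[OF basis] psi_eqI by blast
qed

text \<open>If \<open>L (z * a)\<close> vanished for all basis vectors with \<open>z\<close>
  nonzero, expanding the inverse of \<open>z\<close> in the basis would give \<open>L 1 = 0\<close>.
  An injective linear map in finite dimension is bounded below.\<close>

lemma L_nondegenerate: "\<exists>B>0. \<forall>z. B * norm z \<le> (\<Sum>a\<in>Basis. \<bar>L (z * a)\<bar>)"
proof -
  let ?g = "\<lambda>z::'a. \<Sum>a\<in>Basis. L (z * a) *\<^sub>R a"
  have "linear ?g"
    using linear_add[OF L_linear] linear_scale[OF L_linear]
    by (intro linearI) (simp_all add: distrib_right scaleR_add_left sum.distrib scaleR_sum_right)
  moreover have "inj ?g"
    unfolding linear_injective_0[OF \<open>linear ?g\<close>]
  proof (intro allI impI)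
    fix z :: 'a assume z: "?g z = 0"
    have La: "L (z * a) = 0" if "a \<in> Basis" for a
    proof -
      have "?g z \<bullet> a = L (z * a)" using that by (simp add: inner_sum_left inner_Basis if_distrib cong: if_cong)
      then show ?thesis using z by simp
    qed
    show "z = 0"
    proof (rule ccontr)
      assume "z \<noteq> 0"
      have "L (z * (\<Sum>a\<in>Basis. (inverse z \<bullet> a) *\<^sub>R a)) = (\<Sum>a\<in>Basis. (inverse z \<bullet> a) * L (z * a))"
        by (simp add: sum_distrib_left linear_sum[OF L_linear] linear_scale[OF L_linear])
      also have "\<dots> = 0" using La by simp
      finally have "L (z * inverse z) = 0" by (simp add: euclidean_representation)
      then show False using L_1 \<open>z \<noteq> 0\<close> by simp
    qed
  qed
  ultimately obtain B where B: "B > 0" "\<And>z. B * norm z \<le> norm (?g z)"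
    using linear_inj_bounded_below_pos by blast
  have "norm (?g z) \<le> (\<Sum>a\<in>Basis. \<bar>L (z * a)\<bar>)" for z
    by (rule order_trans[OF norm_sum]) simp
  then show ?thesis using B order_trans by blast
qed

lemma add_char_eq: "add_char x = exp (\<i> * complex_of_real (- 2 * pi * L (\<psi> x)))"
  using not_finite by (simp add: add_char_def Let_def L_def mult_ac)

lemma add_char_add: "add_char (x + y) = add_char x * add_char (y :: 'v)"
  by (simp add: add_char_eq psi_add linear_add[OF L_linear] exp_add[symmetric] ring_distribs)

lemma norm_add_char: "cmod (add_char (x :: 'v)) = 1"
  unfolding add_char_eq by (rule norm_exp_i_times)

lemma add_char_minus: "add_char (- x) = cnj (add_char (x :: 'v))"
  by (simp add: add_char_eq exp_cnj psi_minus linear_neg[OF L_linear])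

lemma add_char_cont: "continuous_on UNIV (add_char :: 'v \<Rightarrow> complex)"
proof -
  have "continuous_on UNIV (\<lambda>x. L (\<psi> x))"
    using L_linear unfolding linear_conv_bounded_linear
    by (rule continuous_on_compose2[OF linear_continuous_on psi_cont subset_UNIV])
  then have "continuous_on UNIV (\<lambda>x. exp (\<i> * complex_of_real (- 2 * pi * L (\<psi> x))))"
    by (intro continuous_intros)
  then show ?thesis by (simp only: add_char_eq[abs_def])
qed

lemma add_char_deriv:
  "((\<lambda>t. (add_char (x * \<theta> (t *\<^sub>R a)) - 1) /\<^sub>R t) \<longlongrightarrow> \<i> * complex_of_real (- 2 * pi * L (\<psi> x * a))) (at 0)"
proof -
  let ?l = "- 2 * pi * L (\<psi> x * a)"
  have eq: "add_char (x * \<theta> (t *\<^sub>R a)) = exp (\<i> * complex_of_real (?l * t))" for t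
    by (simp add: add_char_eq psi_mult linear_scale[OF L_linear] mult_ac)
  have "((\<lambda>z. exp (\<i> * complex_of_real ?l * z)) has_field_derivative \<i> * complex_of_real ?l) (at (of_real 0))"
    by (auto intro!: derivative_eq_intros)
  then have "((\<lambda>t. exp (\<i> * complex_of_real ?l * complex_of_real t)) has_vector_derivative (\<i> * complex_of_real ?l)) (at 0)"
    by (rule has_vector_derivative_real_field)
  from vector_derivative_quotient[OF this]
  have "((\<lambda>t. (exp (\<i> * complex_of_real (?l * t)) - 1) /\<^sub>R t) \<longlongrightarrow> \<i> * complex_of_real ?l) (at 0)"
    by (simp only: of_real_mult mult.assoc of_real_0 mult_zero_right exp_zero)
  then show ?thesis unfolding eq .
qed

end

section \<open>Haar measure of cubes\<close>

context arch_field
begin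

text \<open>The half-open cube of side \<open>2 powi k\<close> whose lower corner is
  \<open>2 powi k\<close> times the sum of the basis vectors in \<open>S\<close>. For
  \<open>S\<close> ranging over the sets of basis vectors these cubes tile the cube of twice the
  side, so the growth of Haar measure under scaling follows from translation invariance
  alone.\<close>

definition cell :: "int \<Rightarrow> 'a set \<Rightarrow> 'a set" where
  "cell k S = {z. \<forall>i\<in>Basis. (if i \<in> S then 2 powi k else 0) \<le> z \<bullet> i \<and>
                          z \<bullet> i < (if i \<in> S then 2 powi k else 0) + 2 powi k}"

definition vcell :: "int \<Rightarrow> 'a set \<Rightarrow> 'v set" where "vcell k S = \<psi> -` cell k S"

lemma vcell_sets: "vcell k S \<in> sets borel"
proof -
  have "cell k S = (\<Inter>i\<in>Basis. {z. (if i \<in> S then 2 powi k else 0) \<le> z \<bullet> i} \<inter>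
      {z. z \<bullet> i < (if i \<in> S then 2 powi k else 0) + 2 powi k})"
    unfolding cell_def by blast
  also have "\<dots> \<in> sets borel"
    by (intro sets.finite_INT sets.Int borel_closed borel_open closed_Collect_le open_Collect_less
        continuous_intros) auto
  finally have "cell k S \<in> sets borel" .
  then show ?thesis
    unfolding vcell_def using measurable_sets[OF borel_measurable_continuous_onI[OF psi_cont]] by simp
qed

lemma vcell_translate:
  assumes "S \<subseteq> Basis"
  shows "vcell k S = (\<lambda>x. \<theta> (\<Sum>i\<in>S. 2 powi k *\<^sub>R i) + x) ` vcell k {}"
proof -
  let ?a = "\<Sum>i\<in>S. 2 powi k *\<^sub>R i :: 'a"
  have inner: "?a \<bullet> j = (if j \<in> S then 2 powi k else 0)" if "j \<in> Basis" for j
  proof -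
    have "?a \<bullet> j = (\<Sum>i\<in>S. if i = j then 2 powi k else 0)"
      unfolding inner_sum_left
    proof (intro sum.cong refl)
      fix i assume "i \<in> S"
      then have "i \<in> Basis" using assms by blast
      then show "(2 powi k *\<^sub>R i) \<bullet> j = (if i = j then 2 powi k else 0)"
        using that by (simp add: inner_Basis)
    qed
    also have "\<dots> = (if j \<in> S then 2 powi k else 0)"
      using finite_subset[OF assms] by (simp add: sum.delta)
    finally show ?thesis .
  qed
  have shift: "x \<in> vcell k S \<longleftrightarrow> - \<theta> ?a + x \<in> vcell k {}" for x
    unfolding vcell_def cell_def vimage_def mem_Collect_eq
  proof (intro ball_cong refl)
    fix j :: 'a assume j: "j \<in> Basis"
    have "\<psi> (- \<theta> ?a + x) \<bullet> j = \<psi> x \<bullet> j - (if j \<in> S then 2 powi k else 0)"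
      by (simp only: psi_add psi_minus psi_theta inner_add_left inner_minus_left inner[OF j])
    moreover have "c \<le> p \<and> p < c + t \<longleftrightarrow> 0 \<le> p - c \<and> p - c < 0 + t" for c p t :: real by linarith
    ultimately show "((if j \<in> S then 2 powi k else 0) \<le> \<psi> x \<bullet> j \<and>
        \<psi> x \<bullet> j < (if j \<in> S then 2 powi k else 0) + 2 powi k) \<longleftrightarrow>
      ((if j \<in> {} then 2 powi k else 0) \<le> \<psi> (- \<theta> ?a + x) \<bullet> j \<and>
        \<psi> (- \<theta> ?a + x) \<bullet> j < (if j \<in> {} then 2 powi k else 0) + 2 powi k)"
      by (simp only: empty_iff if_False)
  qed
  show ?thesis
  proof (intro set_eqI iffI)
    fix x assume "x \<in> vcell k S"
    then show "x \<in> (\<lambda>x. \<theta> ?a + x) ` vcell k {}"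
      unfolding shift by (intro image_eqI[of _ _ "- \<theta> ?a + x"]) auto
  next
    fix x assume "x \<in> (\<lambda>x. \<theta> ?a + x) ` vcell k {}"
    then obtain w where "w \<in> vcell k {}" "x = \<theta> ?a + w" by blast
    then show "x \<in> vcell k S" unfolding shift by simp
  qed
qed

lemma two_powi_Suc: "(2::real) powi (k + 1) = 2 powi k + 2 powi k"
  by (simp add: power_int_add)

lemma vcell_halving: "vcell (k + 1) {} = (\<Union>S\<in>Pow Basis. vcell k S)"
proof (intro set_eqI iffI)
  fix x assume x: "x \<in> vcell (k + 1) {}"
  let ?S = "{i \<in> Basis. 2 powi k \<le> \<psi> x \<bullet> i}"
  have "x \<in> vcell k ?S" using x two_powi_Suc[of k] by (auto simp: vcell_def cell_def)
  then show "x \<in> (\<Union>S\<in>Pow Basis. vcell k S)" by (intro UN_I[of ?S]) auto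
next
  fix x assume "x \<in> (\<Union>S\<in>Pow Basis. vcell k S)"
  then obtain S where S: "x \<in> vcell k S" by blast
  have pos: "0 < (2::real) powi k" by simp
  show "x \<in> vcell (k + 1) {}"
    unfolding vcell_def cell_def vimage_def mem_Collect_eq two_powi_Suc
  proof
    fix i :: 'a assume "i \<in> Basis"
    then have "(if i \<in> S then 2 powi k else 0) \<le> \<psi> x \<bullet> i \<and> \<psi> x \<bullet> i < (if i \<in> S then 2 powi k else 0) + 2 powi k"
      using S by (simp add: vcell_def cell_def)
    then show "(if i \<in> {} then 2 powi k + 2 powi k else 0) \<le> \<psi> x \<bullet> i \<and>
        \<psi> x \<bullet> i < (if i \<in> {} then 2 powi k + 2 powi k else 0) + (2 powi k + 2 powi k)"
      using pos by (cases "i \<in> S") auto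
  qed
qed

lemma vcell_disjoint: "disjoint_family_on (vcell k) (Pow Basis)"
  unfolding disjoint_family_on_def
proof (intro ballI impI)
  fix S T :: "'a set" assume ST: "S \<in> Pow Basis" "T \<in> Pow Basis" "S \<noteq> T"
  from ST(3) obtain i where "(i \<in> S) \<noteq> (i \<in> T)" unfolding set_eq_iff by blast
  then have i: "i \<in> Basis" "(i \<in> S) \<noteq> (i \<in> T)" using ST(1,2) by auto
  have False if "x \<in> vcell k S" "x \<in> vcell k T" for x
  proof -
    have "(if i \<in> S then 2 powi k else 0) \<le> \<psi> x \<bullet> i \<and> \<psi> x \<bullet> i < (if i \<in> S then 2 powi k else 0) + 2 powi k"
      "(if i \<in> T then 2 powi k else 0) \<le> \<psi> x \<bullet> i \<and> \<psi> x \<bullet> i < (if i \<in> T then 2 powi k else 0) + 2 powi k"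
      using that i(1) by (simp_all add: vcell_def cell_def)
    then show False using i(2) by (cases "i \<in> S") auto
  qed
  then show "vcell k S \<inter> vcell k T = {}" by blast
qed

lemma emeasure_vcell_step:
  assumes \<mu>: "haar_measure \<mu>"
  shows "emeasure \<mu> (vcell (k + 1) {}) = of_nat (2 ^ DIM('a)) * emeasure \<mu> (vcell k {})"
proof -
  have sets: "sets \<mu> = sets borel" using \<mu> by (simp add: haar_measure_def)
  have "emeasure \<mu> (vcell (k + 1) {}) = (\<Sum>S\<in>Pow Basis. emeasure \<mu> (vcell k S))"
    unfolding vcell_halving using vcell_disjoint
    by (intro sum_emeasure[symmetric]) (auto simp: sets vcell_sets)
  also have "\<dots> = (\<Sum>S\<in>Pow (Basis::'a set). emeasure \<mu> (vcell k {}))"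
  proof (intro sum.cong refl)
    fix S :: "'a set" assume "S \<in> Pow Basis"
    then show "emeasure \<mu> (vcell k S) = emeasure \<mu> (vcell k {})"
      using haar_translate[OF \<mu> vcell_sets] by (subst vcell_translate) auto
  qed
  also have "\<dots> = of_nat (card (Pow (Basis::'a set))) * emeasure \<mu> (vcell k {})" by simp
  finally show ?thesis by (simp add: card_Pow)
qed

text \<open>The modulus of 2, by which the measure of a cube grows when its side doubles; it plays
  the role of the residue cardinality \<open>q\<close>.\<close>

definition Q :: real where "Q = 2 ^ DIM('a)"

lemma Q_ge_2: "2 \<le> Q"
  unfolding Q_def using power_increasing[of 1 "DIM('a)" "2::real"] DIM_positive[where 'a = 'a] by simp

lemma emeasure_vcell:
  assumes \<mu>: "haar_measure \<mu>"
  shows "emeasure \<mu> (vcell k {}) = ennreal (measure \<mu> (vcell 0 {}) * Q powi k)"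
proof -
  have sets: "sets \<mu> = sets borel" using \<mu> by (simp add: haar_measure_def)
  have fin: "emeasure \<mu> (vcell k {}) \<noteq> \<infinity>" for k
  proof -
    let ?R = "real DIM('a) * 2 powi k"
    have sub: "vcell k {} \<subseteq> \<theta> ` cball 0 ?R"
    proof
      fix x assume x: "x \<in> vcell k {}"
      have "norm (\<psi> x) \<le> (\<Sum>i\<in>Basis. \<bar>\<psi> x \<bullet> i\<bar>)" by (rule norm_le_l1)
      also have "\<dots> \<le> (\<Sum>i\<in>(Basis::'a set). 2 powi k)"
        using x by (intro sum_mono) (auto simp: vcell_def cell_def intro: less_imp_le)
      finally have "\<psi> x \<in> cball 0 ?R" by simp
      then show "x \<in> \<theta> ` cball 0 ?R" by (intro image_eqI[of _ _ "\<psi> x"]) auto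
    qed
    have comp: "compact (\<theta> ` cball 0 ?R)"
      by (intro compact_continuous_image continuous_on_subset[OF theta_cont]) auto
    then have "\<theta> ` cball 0 ?R \<in> sets \<mu>" unfolding sets by (intro borel_closed compact_imp_closed)
    then have "emeasure \<mu> (vcell k {}) \<le> emeasure \<mu> (\<theta> ` cball 0 ?R)" by (intro emeasure_mono sub)
    also have "\<dots> < \<infinity>" using \<mu> comp by (simp add: haar_measure_def)
    finally show ?thesis by simp
  qed
  have step: "measure \<mu> (vcell (k + 1) {}) = Q * measure \<mu> (vcell k {})" for k
  proof -
    have "enn2real (of_nat n * z) = real n * enn2real z" for n z by (simp add: enn2real_mult)
    from this[of "2 ^ DIM('a)" "emeasure \<mu> (vcell k {})"] show ?thesis
      unfolding measure_def emeasure_vcell_step[OF \<mu>, of k]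
      by (simp only: Q_def of_nat_power of_nat_numeral)
  qed
  have Q0: "Q \<noteq> 0" using Q_ge_2 by simp
  have "measure \<mu> (vcell k {}) = measure \<mu> (vcell 0 {}) * Q powi k"
  proof (induction k rule: int_induct[where k = 0])
    case base then show ?case by simp
  next
    case (step1 i)
    then show ?case using step[of i] Q0 by (simp add: power_int_add)
  next
    case (step2 i)
    then show ?case using step[of "i - 1"] Q0 by (simp add: power_int_diff field_simps)
  qed
  then show ?thesis using fin[of k] emeasure_eq_ennreal_measure[of \<mu> "vcell k {}"] by simp
qed

lemma Q_powi: "Q powi k = (2 powi k) ^ DIM('a)"
proof -
  have "Q powi k = (2 powi int DIM('a)) powi k" by (simp add: Q_def)
  also have "\<dots> = (2 powi k) powi int DIM('a)"
    unfolding power_int_mult[symmetric] by (simp add: mult.commute)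
  finally show ?thesis by simp
qed

lemma emeasure_nabs_ball:
  assumes \<mu>: "haar_measure \<mu>"
  shows "emeasure \<mu> {x::'v. nabs x \<le> Q powi k} \<le> ennreal (measure \<mu> (vcell 0 {}) * Q\<^sup>2 * Q powi k)"
proof -
  have sets: "sets \<mu> = sets borel" using \<mu> by (simp add: haar_measure_def)
  let ?a = "\<theta> (\<Sum>i\<in>Basis. 2 powi k *\<^sub>R i)"
  \<comment> \<open>After shifting every coordinate by \<open>2 powi k\<close>, all coordinates lie
    between 0 and twice this number, endpoints included. As the cubes are half-open, the side is
    taken as four times this number, which accounts for \<open>k + 2\<close> and the factor
    \<open>Q^2\<close>.\<close>
  have sub: "{x. nabs x \<le> Q powi k} \<subseteq> (\<lambda>x. - ?a + x) ` vcell (k + 2) {}"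
  proof clarify
    fix x :: 'v assume "nabs x \<le> Q powi k"
    then have "norm (\<psi> x) ^ DIM('a) \<le> (2 powi k) ^ DIM('a)" by (simp add: nabs_eq Q_powi)
    then have n: "norm (\<psi> x) \<le> 2 powi k" by (subst (asm) power_mono_iff) auto
    have pos: "0 < (2::real) powi k" by simp
    have four: "(2::real) powi (k + 2) = 2 powi k + 2 powi k + 2 powi k + 2 powi k"
      by (simp add: power_int_add)
    have "?a + x \<in> vcell (k + 2) {}"
      unfolding vcell_def cell_def vimage_def mem_Collect_eq psi_add psi_theta inner_add_left four
    proof
      fix i :: 'a assume i: "i \<in> Basis"
      have "(\<Sum>j\<in>Basis. 2 powi k *\<^sub>R j) \<bullet> i = 2 powi k"
        using i by (simp add: inner_sum_left inner_Basis if_distrib cong: if_cong)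
      moreover have "\<bar>\<psi> x \<bullet> i\<bar> \<le> 2 powi k" using Basis_le_norm[OF i, of "\<psi> x"] n by simp
      ultimately show "(if i \<in> {} then 2 powi k + 2 powi k + 2 powi k + 2 powi k else 0)
          \<le> (\<Sum>j\<in>Basis. 2 powi k *\<^sub>R j) \<bullet> i + \<psi> x \<bullet> i \<and>
        (\<Sum>j\<in>Basis. 2 powi k *\<^sub>R j) \<bullet> i + \<psi> x \<bullet> i
        < (if i \<in> {} then 2 powi k + 2 powi k + 2 powi k + 2 powi k else 0) +
          (2 powi k + 2 powi k + 2 powi k + 2 powi k)"
        unfolding empty_iff if_False using pos by (intro conjI; linarith)
    qed
    then show "x \<in> (\<lambda>x. - ?a + x) ` vcell (k + 2) {}" by (intro image_eqI[of _ _ "?a + x"]) auto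
  qed
  have im_sets: "(\<lambda>x. - ?a + x) ` vcell (k + 2) {} \<in> sets \<mu>"
  proof -
    have "(\<lambda>x. - ?a + x) ` vcell (k + 2) {} = (\<lambda>x. ?a + x) -` vcell (k + 2) {}"
    proof (intro set_eqI iffI)
      fix x assume "x \<in> (\<lambda>x. ?a + x) -` vcell (k + 2) {}"
      then show "x \<in> (\<lambda>x. - ?a + x) ` vcell (k + 2) {}" by (intro image_eqI[of _ _ "?a + x"]) auto
    qed auto
    then show ?thesis
      unfolding sets using measurable_sets[OF borel_measurable_continuous_onI[OF continuous_vadd[of ?a]] vcell_sets] by simp
  qed
  have "emeasure \<mu> {x. nabs x \<le> Q powi k} \<le> emeasure \<mu> ((\<lambda>x. - ?a + x) ` vcell (k + 2) {})"
    by (intro emeasure_mono sub im_sets)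
  also have "\<dots> = emeasure \<mu> (vcell (k + 2) {})" by (rule haar_translate[OF \<mu> vcell_sets])
  also have "\<dots> = ennreal (measure \<mu> (vcell 0 {}) * Q\<^sup>2 * Q powi k)"
    unfolding emeasure_vcell[OF \<mu>] using Q_ge_2 by (simp add: power_int_add mult_ac)
  finally show ?thesis .
qed

section \<open>Fourier transforms and the bound at archimedean places\<close>

lemma schwartz_bruhat_psi: "schwartz g \<Longrightarrow> schwartz_bruhat (\<lambda>x. g (\<psi> x))"
  by (simp add: schwartz_bruhat_iff o_def)

text \<open>Decay in the norm becomes decay in the modulus, so that \<open>integrable_decay\<close>
  applies. Each power of the modulus costs \<open>DIM('a)\<close> powers of the norm.\<close>

lemma decay_nabs:
  assumes "0 \<le> K"
  shows "K / (1 + norm (\<psi> x)) ^ (DIM('a) * n) \<le> K / (1 + nabs x) ^ n"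
proof -
  have "1 + norm (\<psi> x) ^ DIM('a) \<le> (1 + norm (\<psi> x)) ^ DIM('a)"
  proof -
    consider "DIM('a) = 1" | "DIM('a) = 2" using dim DIM_positive[where 'a = 'a] by linarith
    then show ?thesis by cases (simp_all add: power2_eq_square algebra_simps)
  qed
  then have "(1 + nabs x) ^ n \<le> (1 + norm (\<psi> x)) ^ (DIM('a) * n)"
    unfolding nabs_eq power_mult by (intro power_mono) auto
  then show ?thesis
    using assms by (intro divide_left_mono mult_pos_pos zero_less_power) (auto simp: nabs_eq add_pos_nonneg)
qed

lemma decay_const_nonneg:
  assumes "\<And>x. cmod (g x) \<le> K / (1 + norm x) ^ n" shows "0 \<le> K"
  using order_trans[OF norm_ge_zero assms[of 0]] by simp

lemma nabs_cont: "continuous_on UNIV (nabs :: 'v \<Rightarrow> real)"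
proof -
  have "continuous_on UNIV (\<lambda>x. norm (\<psi> x) ^ DIM('a))"
    by (intro continuous_intros psi_cont)
  then show ?thesis by (simp add: nabs_eq[abs_def])
qed

lemma nabs_nonneg: "0 \<le> nabs (x :: 'v)"
  by (simp add: nabs_eq)

definition bQ :: real where "bQ = sqrt Q"

lemma bQ_powr: "bQ powr (2 * real_of_int k) = Q powi k"
proof -
  have "bQ powr (2 * real_of_int k) = (bQ powr 2) powr real_of_int k" by (simp add: powr_powr)
  also have "bQ powr 2 = Q" using Q_ge_2 powr_realpow[of bQ 2] by (simp add: bQ_def)
  finally show ?thesis using Q_ge_2 by (simp add: powr_real_of_int')
qed

lemma bQ_gt_1: "1 < bQ"
  using Q_ge_2 by (simp add: bQ_def)

lemma log_fourier_arch:
  assumes \<mu>: "haar_measure \<mu>" and D: "countable (D :: 'v set)" "closure D = UNIV"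
  shows "log_fourier \<mu> nabs (\<lambda>x y. add_char (x * y)) bQ (measure \<mu> (vcell 0 {}) * Q\<^sup>2)"
proof (rule log_fourier_haar[OF \<mu> D _ nabs_nonneg bQ_gt_1 _ add_char_cont norm_add_char])
  show "(nabs :: 'v \<Rightarrow> real) \<in> borel_measurable borel"
    by (rule borel_measurable_continuous_onI[OF nabs_cont])
  show "emeasure \<mu> {x. nabs x \<le> bQ powr (2 * real_of_int k)}
      \<le> ennreal (measure \<mu> (vcell 0 {}) * Q\<^sup>2 * bQ powr (2 * real_of_int k))" for k
    unfolding bQ_powr by (rule emeasure_nabs_ball[OF \<mu>])
qed

lemma char_measurable: "(\<lambda>y. add_char (x * y)) \<in> borel_measurable (borel :: 'v measure)"
  using continuous_on_compose2[OF add_char_cont continuous_vmult subset_UNIV, of x]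
  by (rule borel_measurable_continuous_onI)

text \<open>Translation invariance turns the transform of a difference quotient of \<open>g\<close>
  into a difference quotient of the character times the transform of \<open>g\<close>. Letting the
  step tend to 0 replaces integration by parts, so no coordinates on the measure are
  required.\<close>

lemma fourier_directional_derivative:
  fixes \<mu> :: "'v measure"
  assumes haar: "haar_measure \<mu>" and D: "countable (D :: 'v set)" "closure D = UNIV"
    and g: "schwartz g" "schwartz g'"
    and deriv: "\<And>z. ((\<lambda>s. g (z + s *\<^sub>R a)) has_vector_derivative g' z) (at 0)"
  shows "fourier \<mu> (\<lambda>x. g' (\<psi> x)) x = \<i> * complex_of_real (- 2 * pi * L (\<psi> x * a)) * fourier \<mu> (\<lambda>x. g (\<psi> x)) x"
proof -
  have sets: "sets \<mu> = sets borel" using haar by (simp add: haar_measure_def)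
  interpret log_fourier \<mu> nabs "\<lambda>x y. add_char (x * y)" bQ "measure \<mu> (vcell 0 {}) * Q\<^sup>2"
    by (rule log_fourier_arch[OF haar D])
  let ?f = "\<lambda>y. g (\<psi> y)"
  let ?e = "\<lambda>y. add_char (- (x * y))"
  let ?t = "\<lambda>n. inverse (real (Suc n))"
  let ?h = "\<lambda>t y. ((g (\<psi> y + t *\<^sub>R a) - g (\<psi> y)) /\<^sub>R t) * ?e y"
  have gm: "(\<lambda>y. h (\<psi> y)) \<in> borel_measurable borel" if "schwartz h" for h
    by (intro borel_measurable_continuous_onI continuous_on_compose2[OF schwartz_continuous[OF that] psi_cont]) auto
  have em: "?e \<in> borel_measurable borel" using char_measurable[of "- x"] by simp
  have fe_meas: "(\<lambda>y. ?f y * ?e y) \<in> borel_measurable borel" using gm[OF g(1)] em by measurable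
  have shift_meas: "(\<lambda>y. g (\<psi> y + v)) \<in> borel_measurable borel" for v
    by (intro borel_measurable_continuous_onI continuous_on_compose2[OF schwartz_continuous[OF g(1)]]
        continuous_intros psi_cont) auto
  obtain K where K: "\<And>z. cmod (g z) \<le> K / (1 + norm z) ^ (DIM('a) * 3)"
    using schwartz_decay[OF g(1)] by blast
  have f_int: "integrable \<mu> ?f"
  proof (rule integrable_decay(1))
    show "?f \<in> borel_measurable \<mu>" unfolding measurable_cong_sets[OF sets refl] by (rule gm[OF g(1)])
    show "cmod (?f y) \<le> K / (1 + nabs y) ^ 3" for y
      using K[of "\<psi> y"] decay_nabs[OF decay_const_nonneg[OF K], of y 3] by linarith
  qed
  have fe_int: "integrable \<mu> (\<lambda>y. ?f y * ?e y)"
    using integrable_mult_cnj_e[OF f_int, of x] by (simp add: add_char_minus)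
  have shift: "g (\<psi> y + t *\<^sub>R a) * ?e y = add_char (x * \<theta> (t *\<^sub>R a)) * (?f (\<theta> (t *\<^sub>R a) + y) * ?e (\<theta> (t *\<^sub>R a) + y))" for t y
  proof -
    have "x * \<theta> (t *\<^sub>R a) + - (x * (\<theta> (t *\<^sub>R a) + y)) = - (x * y)" by (simp add: distrib_left)
    then have "?e y = add_char (x * \<theta> (t *\<^sub>R a)) * ?e (\<theta> (t *\<^sub>R a) + y)"
      by (simp only: add_char_add[symmetric])
    then show ?thesis by (simp add: psi_add add.commute)
  qed
  have translate_int: "integrable \<mu> (\<lambda>y. ?f (v + y) * ?e (v + y))" for v
  proof -
    have "(\<lambda>y. v + y) \<in> measurable \<mu> borel"
      unfolding measurable_cong_sets[OF sets refl]
      by (rule borel_measurable_continuous_onI[OF continuous_vadd])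
    then have "integrable (distr \<mu> borel (\<lambda>y. v + y)) (\<lambda>y. ?f y * ?e y) \<longleftrightarrow> integrable \<mu> (\<lambda>y. ?f (v + y) * ?e (v + y))"
      using fe_meas by (rule integrable_distr_eq)
    moreover have "distr \<mu> borel (\<lambda>y. v + y) = \<mu>" using haar unfolding haar_measure_def by blast
    ultimately show ?thesis using fe_int by simp
  qed
  have quotient: "(LINT y|\<mu>. ?h t y) = ((add_char (x * \<theta> (t *\<^sub>R a)) - 1) /\<^sub>R t) * fourier \<mu> ?f x" for t
  proof -
    have "?h t y = (add_char (x * \<theta> (t *\<^sub>R a)) * (?f (\<theta> (t *\<^sub>R a) + y) * ?e (\<theta> (t *\<^sub>R a) + y)) - ?f y * ?e y) /\<^sub>R t" for y
      unfolding shift[symmetric] by (simp add: left_diff_distrib)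
    then have "(LINT y|\<mu>. ?h t y) = (LINT y|\<mu>. (add_char (x * \<theta> (t *\<^sub>R a)) * (?f (\<theta> (t *\<^sub>R a) + y) * ?e (\<theta> (t *\<^sub>R a) + y)) - ?f y * ?e y) /\<^sub>R t)"
      by (simp only:)
    also have "\<dots> = (add_char (x * \<theta> (t *\<^sub>R a)) * (LINT y|\<mu>. ?f (\<theta> (t *\<^sub>R a) + y) * ?e (\<theta> (t *\<^sub>R a) + y)) - fourier \<mu> ?f x) /\<^sub>R t"
      using translate_int[of "\<theta> (t *\<^sub>R a)"] fe_int
      by (subst integral_scaleR_right, subst Bochner_Integration.integral_diff) (auto simp: fourier_def)
    also have "(LINT y|\<mu>. ?f (\<theta> (t *\<^sub>R a) + y) * ?e (\<theta> (t *\<^sub>R a) + y)) = fourier \<mu> ?f x"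
      unfolding fourier_def by (rule haar_integral_translate[OF haar fe_meas])
    finally show ?thesis by (simp add: algebra_simps)
  qed
  obtain C where C: "\<And>z t. 0 < t \<Longrightarrow> t \<le> 1 \<Longrightarrow> cmod ((g (z + t *\<^sub>R a) - g z) /\<^sub>R t) \<le> C / (1 + norm z) ^ (DIM('a) * 2)"
    using schwartz_difference_quotient[OF g(1)] by blast
  have C0: "0 \<le> C" using decay_const_nonneg[OF C[of 1]] by simp
  \<comment> \<open>The limit is taken along the steps \<open>1 / (n + 1)\<close>, because dominated
    convergence is applied to a sequence; these steps also stay in the range of the uniform bound
    \<open>C\<close>.\<close>
  have t_lim: "filterlim ?t (at 0) sequentially"
    unfolding filterlim_at using LIMSEQ_inverse_real_of_nat by auto
  have "(\<lambda>n. LINT y|\<mu>. ?h (?t n) y) \<longlonglongrightarrow> (LINT y|\<mu>. g' (\<psi> y) * ?e y)"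
  proof (rule integral_dominated_convergence[of _ _ _ "\<lambda>y. C / (1 + nabs y)\<^sup>2"])
    show "(\<lambda>y. g' (\<psi> y) * ?e y) \<in> borel_measurable \<mu>"
      unfolding measurable_cong_sets[OF sets refl] using gm[OF g(2)] em by measurable
    show "(\<lambda>y. ?h (?t n) y) \<in> borel_measurable \<mu>" for n
      unfolding measurable_cong_sets[OF sets refl] using gm[OF g(1)] em shift_meas by measurable
    show "integrable \<mu> (\<lambda>y. C / (1 + nabs y)\<^sup>2)"
      by (rule integrable_decay_sq[of _ C]) (use C0 in auto)
    show "AE y in \<mu>. (\<lambda>n. ?h (?t n) y) \<longlonglongrightarrow> g' (\<psi> y) * ?e y"
    proof (intro AE_I2 tendsto_mult tendsto_const)
      fix y
      have "((\<lambda>t. (g (\<psi> y + t *\<^sub>R a) - g (\<psi> y)) /\<^sub>R t) \<longlongrightarrow> g' (\<psi> y)) (at 0)"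
        using vector_derivative_quotient[OF deriv[of "\<psi> y"]] by simp
      then show "(\<lambda>n. (g (\<psi> y + ?t n *\<^sub>R a) - g (\<psi> y)) /\<^sub>R ?t n) \<longlonglongrightarrow> g' (\<psi> y)"
        using t_lim by (rule filterlim_compose)
    qed
    show "AE y in \<mu>. cmod (?h (?t n) y) \<le> C / (1 + nabs y)\<^sup>2" for n
    proof (rule AE_I2)
      fix y
      have "0 < ?t n" "?t n \<le> 1" by (simp_all add: inverse_le_1_iff)
      then have "cmod ((g (\<psi> y + ?t n *\<^sub>R a) - g (\<psi> y)) /\<^sub>R ?t n) \<le> C / (1 + norm (\<psi> y)) ^ (DIM('a) * 2)"
        by (rule C)
      also have "\<dots> \<le> C / (1 + nabs y)\<^sup>2" by (rule decay_nabs[OF C0])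
      finally show "cmod (?h (?t n) y) \<le> C / (1 + nabs y)\<^sup>2"
        unfolding norm_mult by (simp only: norm_add_char mult_1_right)
    qed
  qed
  moreover have "(\<lambda>n. ((add_char (x * \<theta> (?t n *\<^sub>R a)) - 1) /\<^sub>R ?t n) * fourier \<mu> ?f x)
      \<longlonglongrightarrow> \<i> * complex_of_real (- 2 * pi * L (\<psi> x * a)) * fourier \<mu> ?f x"
    by (intro tendsto_mult tendsto_const filterlim_compose[OF add_char_deriv t_lim])
  ultimately show ?thesis
    unfolding quotient fourier_def[of \<mu> "\<lambda>x. g' (\<psi> x)"] by (rule LIMSEQ_unique)
qed

theorem conductor_bounded_below_arch:
  fixes \<mu> :: "'v measure"
  assumes sd: "self_dual_haar \<mu>" and D: "countable (D :: 'v set)" "closure D = UNIV"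
  shows "\<exists>c::real. \<forall>f. schwartz_bruhat f \<longrightarrow>
           l2_inner \<mu> (conductor_op \<mu> f) f \<in> \<real> \<and>
           Re (l2_inner \<mu> (conductor_op \<mu> f) f) \<ge> c * (l2_norm \<mu> f)\<^sup>2"
proof -
  have haar: "haar_measure \<mu>" using sd by (simp add: self_dual_haar_def)
  have sets: "sets \<mu> = sets borel" using haar by (simp add: haar_measure_def)
  have lf: "log_fourier \<mu> nabs (\<lambda>x y. add_char (x * y)) bQ (measure \<mu> (vcell 0 {}) * Q\<^sup>2)"
    by (rule log_fourier_arch[OF haar D])
  interpret log_fourier \<mu> nabs "\<lambda>x y. add_char (x * y)" bQ "measure \<mu> (vcell 0 {}) * Q\<^sup>2"
    by (rule lf)
  have Fo: "Fo f = fourier \<mu> f" for f by (simp add: fun_eq_iff Fo_def fourier_def add_char_minus)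
  have Fi: "Fi f = inverse_fourier \<mu> f" for f by (simp add: fun_eq_iff Fi_def inverse_fourier_def)
  have sb: "integrable \<mu> f \<and> integrable \<mu> (\<lambda>x. complex_of_real (ln (nabs x)) * f x)"
    if f: "schwartz_bruhat f" for f
  proof -
    have g: "schwartz (f \<circ> \<theta>)" using f by (simp add: schwartz_bruhat_iff)
    obtain K where K: "\<And>z. cmod ((f \<circ> \<theta>) z) \<le> K / (1 + norm z) ^ (DIM('a) * 3)"
      using schwartz_decay[OF g] by blast
    have "continuous_on UNIV (\<lambda>x. (f \<circ> \<theta>) (\<psi> x))"
      by (rule continuous_on_compose2[OF schwartz_continuous[OF g] psi_cont subset_UNIV])
    then have "f \<in> borel_measurable \<mu>"
      unfolding measurable_cong_sets[OF sets refl] by (intro borel_measurable_continuous_onI) (simp add: o_def)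
    moreover have "cmod (f y) \<le> K / (1 + nabs y) ^ 3" for y
      using K[of "\<psi> y"] decay_nabs[OF decay_const_nonneg[OF K], of y 3] by simp
    ultimately show ?thesis using integrable_decay[of f K] by blast
  qed
  have inv: "invertible_fn f" if "schwartz_bruhat f" for f
    using sd sb[OF that] that by (auto simp: invertible_fn_def Fo Fi self_dual_haar_def)
  have norm_psi_meas [measurable]: "(\<lambda>x. norm (\<psi> x)) \<in> borel_measurable \<mu>"
    unfolding measurable_cong_sets[OF sets refl]
    by (intro borel_measurable_continuous_onI continuous_intros psi_cont)
  \<comment> \<open>No decay of the transform is computed. A directional derivative of
    \<open>f\<close> is again a Schwartz--Bruhat function, hence invertible, hence has an integrable
    transform, which is a multiple of \<open>L (\<psi> x * a)\<close> times the transform of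
    \<open>f\<close>. Nondegeneracy of \<open>L\<close> combines these directions into the first
    moment.\<close>
  have moment: "integrable \<mu> (\<lambda>x. norm (\<psi> x) * cmod (fourier \<mu> f x))" if f: "schwartz_bruhat f" for f
  proof -
    have g: "schwartz (f \<circ> \<theta>)" using f by (simp add: schwartz_bruhat_iff)
    have f_eq: "(\<lambda>x. (f \<circ> \<theta>) (\<psi> x)) = f" by simp
    have [measurable]: "fourier \<mu> f \<in> borel_measurable \<mu>"
      unfolding Fo[symmetric] using sb[OF f] by (intro Fo_measurable) auto
    have L_int: "integrable \<mu> (\<lambda>x. \<bar>L (\<psi> x * a)\<bar> * cmod (fourier \<mu> f x))" for a
    proof -
      obtain g' where g': "schwartz g'" "\<And>z. ((\<lambda>s. (f \<circ> \<theta>) (z + s *\<^sub>R a)) has_vector_derivative g' z) (at 0)"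
        using schwartz_directional_derivative[OF g] by blast
      have "integrable \<mu> (Fo (\<lambda>x. g' (\<psi> x)))"
        by (intro invertible_fn_integrable_Fo inv schwartz_bruhat_psi g')
      then have "integrable \<mu> (\<lambda>x. cmod (Fo (\<lambda>x. g' (\<psi> x)) x))" by (rule integrable_norm)
      also have "(\<lambda>x. cmod (Fo (\<lambda>x. g' (\<psi> x)) x)) = (\<lambda>x. (2 * pi) * (\<bar>L (\<psi> x * a)\<bar> * cmod (fourier \<mu> f x)))"
        unfolding Fo fourier_directional_derivative[OF haar D g g'] f_eq
        by (simp add: norm_mult abs_mult fun_eq_iff)
      finally show ?thesis by (subst (asm) integrable_mult_left_iff) simp
    qed
    obtain B where B: "B > 0" "\<And>z. B * norm z \<le> (\<Sum>a\<in>Basis. \<bar>L (z * a)\<bar>)"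
      using L_nondegenerate by blast
    show ?thesis
    proof (rule Bochner_Integration.integrable_bound)
      show "integrable \<mu> (\<lambda>x. (\<Sum>a\<in>Basis. \<bar>L (\<psi> x * a)\<bar> * cmod (fourier \<mu> f x)) / B)"
        by (intro integrable_divide Bochner_Integration.integrable_sum L_int)
      show "AE x in \<mu>. norm (norm (\<psi> x) * cmod (fourier \<mu> f x)) \<le> norm ((\<Sum>a\<in>Basis. \<bar>L (\<psi> x * a)\<bar> * cmod (fourier \<mu> f x)) / B)"
      proof (rule AE_I2)
        fix x
        have "norm (\<psi> x) \<le> (\<Sum>a\<in>Basis. \<bar>L (\<psi> x * a)\<bar>) / B"
          using B(2)[of "\<psi> x"] B(1) by (simp add: pos_le_divide_eq mult.commute)
        then have "norm (\<psi> x) * cmod (fourier \<mu> f x) \<le> (\<Sum>a\<in>Basis. \<bar>L (\<psi> x * a)\<bar>) / B * cmod (fourier \<mu> f x)"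
          by (intro mult_right_mono) auto
        also have "\<dots> = (\<Sum>a\<in>Basis. \<bar>L (\<psi> x * a)\<bar> * cmod (fourier \<mu> f x)) / B"
          by (simp add: sum_distrib_right)
        also have "\<dots> \<le> norm ((\<Sum>a\<in>Basis. \<bar>L (\<psi> x * a)\<bar> * cmod (fourier \<mu> f x)) / B)"
          unfolding real_norm_def by (rule abs_ge_self)
        finally show "norm (norm (\<psi> x) * cmod (fourier \<mu> f x)) \<le> norm ((\<Sum>a\<in>Basis. \<bar>L (\<psi> x * a)\<bar> * cmod (fourier \<mu> f x)) / B)"
          by (simp add: abs_mult)
      qed
    qed measurable
  qed
  \<comment> \<open>With \<open>u = 2 powi k * norm (\<psi> x)\<close>, the scaled modulus is
    \<open>u ^ DIM('a)\<close>. Both cutoff conditions hold for \<open>exp (- u^2)\<close> because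
    the dimension is at most 2: comparing \<open>u ^ DIM('a)\<close> with \<open>u^2\<close> goes in
    the direction required for large \<open>u\<close> in the first condition and for small
    \<open>u\<close> in the second.\<close>
  define m :: "int \<Rightarrow> 'v \<Rightarrow> real" where "m k x = exp (- (2 powi k * norm (\<psi> x))\<^sup>2)" for k x
  have scale: "bQ powr (2 * real_of_int k) * nabs x = (2 powi k * norm (\<psi> x)) ^ DIM('a)" for k x
    unfolding bQ_powr Q_powi nabs_eq by (simp only: power_mult_distrib)
  show ?thesis
  proof (rule conductor_bounded_below_criterion[OF sd lf add_char_minus, where m = m])
    fix f :: "'v \<Rightarrow> complex" assume f: "schwartz_bruhat f"
    show "integrable \<mu> f" "integrable \<mu> (\<lambda>x. complex_of_real (ln (nabs x)) * f x)" using sb[OF f] by auto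
    let ?C = "LINT y|\<mu>. cmod (f y)"
    have [measurable]: "fourier \<mu> f \<in> borel_measurable \<mu>"
      unfolding Fo[symmetric] using sb[OF f] by (intro Fo_measurable) auto
    show "integrable \<mu> (\<lambda>x. complex_of_real (ln (nabs x)) * fourier \<mu> f x)"
    proof (rule Bochner_Integration.integrable_bound)
      show "integrable \<mu> (\<lambda>x. 2 * ?C * V (ell x) + 2 * (norm (\<psi> x) * cmod (fourier \<mu> f x)))"
        using integrable_V0 moment[OF f] by simp
      show "AE x in \<mu>. norm (complex_of_real (ln (nabs x)) * fourier \<mu> f x)
          \<le> norm (2 * ?C * V (ell x) + 2 * (norm (\<psi> x) * cmod (fourier \<mu> f x)))"
        using AE_N_pos
      proof eventually_elim
        case (elim x)
        have C: "cmod (fourier \<mu> f x) \<le> ?C" using norm_Fo_le[of f x] by (simp add: Fo)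
        have "0 \<le> ?C" by simp
        have nonneg: "0 \<le> 2 * ?C * V (ell x)" using V_nonneg[of "ell x"] by simp
        \<comment> \<open>Near the origin the transform is bounded and \<open>V\<close> dominates
          the logarithm; elsewhere the logarithm is at most linear in the norm, and the first moment
          is integrable.\<close>
        have "\<bar>ln (nabs x)\<bar> * cmod (fourier \<mu> f x) \<le> 2 * ?C * V (ell x) + 2 * (norm (\<psi> x) * cmod (fourier \<mu> f x))"
        proof (cases "nabs x \<le> 1")
          case True
          have "\<bar>ln (nabs x)\<bar> * cmod (fourier \<mu> f x) \<le> (2 * V (ell x)) * ?C"
            using V_nonneg[of "ell x"] by (intro mult_mono abs_ln_le_V[OF elim True] C) auto
          also have "\<dots> = 2 * ?C * V (ell x)" by simp
          finally have "\<bar>ln (nabs x)\<bar> * cmod (fourier \<mu> f x) \<le> 2 * ?C * V (ell x)" .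
          moreover have "0 \<le> 2 * (norm (\<psi> x) * cmod (fourier \<mu> f x))" by simp
          ultimately show ?thesis by linarith
        next
          case False
          have pos: "0 < norm (\<psi> x)" using elim by (auto simp: nabs_eq zero_power)
          have "\<bar>ln (nabs x)\<bar> = ln (nabs x)" using False by simp
          also have "\<dots> = real DIM('a) * ln (norm (\<psi> x))" using pos by (simp add: nabs_eq ln_realpow)
          also have "\<dots> \<le> real DIM('a) * norm (\<psi> x)"
            using ln_le_minus_one[OF pos] by (intro mult_left_mono) auto
          also have "\<dots> \<le> 2 * norm (\<psi> x)" using dim by (intro mult_right_mono) auto
          finally have "\<bar>ln (nabs x)\<bar> * cmod (fourier \<mu> f x) \<le> 2 * norm (\<psi> x) * cmod (fourier \<mu> f x)"
            by (intro mult_right_mono) auto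
          then show ?thesis using nonneg by simp
        qed
        moreover have "0 \<le> 2 * (norm (\<psi> x) * cmod (fourier \<mu> f x))" by simp
        ultimately show ?case using nonneg by (simp only: norm_mult norm_of_real real_norm_def abs_of_nonneg add_nonneg_nonneg)
      qed
    qed measurable
  next
    fix k show "m k \<in> borel_measurable \<mu>" unfolding m_def by measurable
  next
    fix k and f :: "'v \<Rightarrow> complex" assume "schwartz_bruhat f"
    then have "schwartz (f \<circ> \<theta>)" by (simp add: schwartz_bruhat_iff)
    then have "schwartz (\<lambda>z. complex_of_real (exp (- ((2 powi k)\<^sup>2) * (z \<bullet> z))) * (f \<circ> \<theta>) z)"
      by (rule schwartz_gaussian_mult) simp
    also have "(\<lambda>z. complex_of_real (exp (- ((2 powi k)\<^sup>2) * (z \<bullet> z))) * (f \<circ> \<theta>) z) = (\<lambda>y. complex_of_real (m k y) * f y) \<circ> \<theta>"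
      by (simp add: m_def fun_eq_iff power_mult_distrib power2_norm_eq_inner)
    finally show "schwartz_bruhat (\<lambda>y. complex_of_real (m k y) * f y)" by (simp only: schwartz_bruhat_iff)
  next
    fix k and y :: 'v
    let ?u = "2 powi k * norm (\<psi> y)"
    have u: "0 \<le> ?u" by simp
    show "0 \<le> m k y" "m k y \<le> 1" by (simp_all add: m_def)
    have m: "m k y = exp (- (?u\<^sup>2))" by (simp add: m_def)
    show "m k y * (bQ powr (2 * real_of_int k) * nabs y) \<le> 1"
    proof -
      have "?u ^ DIM('a) \<le> exp (?u\<^sup>2)"
      proof (cases "?u \<le> 1")
        case True
        have "?u ^ DIM('a) \<le> 1" using u True by (rule power_le_one)
        also have "1 \<le> exp (?u\<^sup>2)" by simp
        finally show ?thesis .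
      next
        case False
        have "?u ^ DIM('a) \<le> ?u\<^sup>2" using dim False by (intro power_increasing) auto
        also have "\<dots> \<le> exp (?u\<^sup>2)" using exp_ge_add_one_self[of "?u\<^sup>2"] by linarith
        finally show ?thesis .
      qed
      then have "m k y * ?u ^ DIM('a) \<le> exp (- (?u\<^sup>2)) * exp (?u\<^sup>2)"
        unfolding m by (intro mult_left_mono) auto
      then show ?thesis unfolding scale by (simp add: exp_minus_inverse exp_add[symmetric])
    qed
    show "1 - m k y \<le> bQ powr (2 * real_of_int k) * nabs y"
    proof (cases "?u \<le> 1")
      case True
      have "1 - m k y \<le> ?u\<^sup>2" unfolding m using exp_ge_add_one_self[of "- (?u\<^sup>2)"] by linarith
      also have "\<dots> \<le> ?u ^ DIM('a)" using dim u True by (intro power_decreasing)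
      finally show ?thesis unfolding scale .
    next
      case False
      have "1 - m k y \<le> 1" by (simp add: m_def)
      also have "1 \<le> ?u ^ DIM('a)" using False by (intro one_le_power) simp
      finally show ?thesis unfolding scale .
    qed
  qed
qed

end

section \<open>The two kinds of places\<close>

context valued_field
begin

text \<open>\<open>\<alpha>\<close> is the change between two models of the completion. It sends 1
  to a nonzero idempotent, hence to 1.\<close>

lemma iso_compose_inv:
  fixes \<psi> :: "'v \<Rightarrow> 'a::{field,topological_space}" and \<psi>' :: "'v \<Rightarrow> 'b::{field,topological_space}"
  assumes "topological_field_iso \<psi>" "topological_field_iso \<psi>'"
  defines "\<alpha> \<equiv> \<psi>' \<circ> inv \<psi>"
  shows "\<alpha> (x + y) = \<alpha> x + \<alpha> y" "\<alpha> (x * y) = \<alpha> x * \<alpha> y" "continuous_on UNIV \<alpha>"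
    "\<alpha> 1 = 1" "\<psi>' = \<alpha> \<circ> \<psi>"
proof -
  have bij: "bij \<psi>" "bij \<psi>'" and add: "\<And>x y. \<psi> (x + y) = \<psi> x + \<psi> y" "\<And>x y. \<psi>' (x + y) = \<psi>' x + \<psi>' y"
    and mult: "\<And>x y. \<psi> (x * y) = \<psi> x * \<psi> y" "\<And>x y. \<psi>' (x * y) = \<psi>' x * \<psi>' y"
    and cont: "continuous_on UNIV (inv \<psi>)" "continuous_on UNIV \<psi>'"
    using assms(1,2) by (auto simp: topological_field_iso_def homeomorphism_def)
  have inv: "\<psi> (inv \<psi> z) = z" "inv \<psi> (\<psi> w) = w" for z w
    using bij(1) by (simp_all add: bij_is_surj surj_f_inv_f bij_is_inj)
  have inv_add: "inv \<psi> (x + y) = inv \<psi> x + inv \<psi> y" for x y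
  proof -
    have "inv \<psi> (\<psi> (inv \<psi> x + inv \<psi> y)) = inv \<psi> (x + y)" by (simp only: add inv)
    then show ?thesis by (simp only: inv)
  qed
  have inv_mult: "inv \<psi> (x * y) = inv \<psi> x * inv \<psi> y" for x y
  proof -
    have "inv \<psi> (\<psi> (inv \<psi> x * inv \<psi> y)) = inv \<psi> (x * y)" by (simp only: mult inv)
    then show ?thesis by (simp only: inv)
  qed
  show "\<alpha> (x + y) = \<alpha> x + \<alpha> y" by (simp add: \<alpha>_def inv_add add)
  show a_mult: "\<alpha> (x * y) = \<alpha> x * \<alpha> y" for x y by (simp add: \<alpha>_def inv_mult mult)
  show "continuous_on UNIV \<alpha>"
    unfolding \<alpha>_def by (intro continuous_on_compose cont continuous_on_subset[OF cont(2)]) auto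
  show eq: "\<psi>' = \<alpha> \<circ> \<psi>" by (simp add: \<alpha>_def fun_eq_iff inv)
  show "\<alpha> 1 = 1"
  proof -
    have "\<psi>' 0 + \<psi>' 0 = \<psi>' 0 + 0" unfolding add(2)[symmetric] by simp
    then have z: "\<psi>' 0 = 0" by (rule add_left_imp_eq)
    have "\<alpha> 1 \<noteq> 0"
    proof
      assume "\<alpha> 1 = 0"
      then have "\<psi>' (inv \<psi> 1) = \<psi>' 0" by (simp add: \<alpha>_def z)
      then have "inv \<psi> 1 = 0" using bij(2) by (simp add: bij_is_inj inj_eq)
      then have "\<psi> 0 = 1" using inv(1)[of 1] by simp
      moreover have "\<psi> 0 + \<psi> 0 = \<psi> 0 + 0" unfolding add(1)[symmetric] by simp
      then have "\<psi> 0 = 0" by (rule add_left_imp_eq)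
      ultimately show False by simp
    qed
    then show ?thesis using a_mult[of 1 1] by simp
  qed
qed

end

text \<open>Additivity gives compatibility with rational scalars, and continuity extends it to their
  real limits.\<close>

lemma continuous_additive_imp_linear:
  fixes \<alpha> :: "'a::real_normed_vector \<Rightarrow> 'b::real_normed_vector"
  assumes add: "\<And>x y. \<alpha> (x + y) = \<alpha> x + \<alpha> y" and cont: "continuous_on UNIV \<alpha>"
  shows "\<alpha> (r *\<^sub>R x) = r *\<^sub>R \<alpha> x"
proof -
  have zero: "\<alpha> 0 = 0" using add[of 0 0] by simp
  have minus: "\<alpha> (- x) = - \<alpha> x" for x using add[of x "- x"] by (simp add: zero eq_neg_iff_add_eq_0 add.commute)
  have nat: "\<alpha> (real n *\<^sub>R x) = real n *\<^sub>R \<alpha> x" for n x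
    by (induction n) (simp_all add: zero add scaleR_add_left)
  have int: "\<alpha> (real_of_int n *\<^sub>R x) = real_of_int n *\<^sub>R \<alpha> x" for n x
    by (cases n rule: int_cases2) (simp_all add: nat minus)
  have rat: "\<alpha> (q *\<^sub>R x) = q *\<^sub>R \<alpha> x" if q: "q \<in> \<rat>" for q
  proof -
    obtain a b where ab: "q = real_of_int a / real_of_int b" "b \<noteq> 0"
      using q by (auto elim!: Rats_cases')
    have "real_of_int b *\<^sub>R \<alpha> (q *\<^sub>R x) = \<alpha> (real_of_int b *\<^sub>R (q *\<^sub>R x))" by (rule int[symmetric])
    also have "\<dots> = \<alpha> (real_of_int a *\<^sub>R x)" using ab by simp
    also have "\<dots> = real_of_int a *\<^sub>R \<alpha> x" by (rule int)
    also have "\<dots> = real_of_int b *\<^sub>R (q *\<^sub>R \<alpha> x)" using ab by simp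
    finally have "real_of_int b *\<^sub>R \<alpha> (q *\<^sub>R x) = real_of_int b *\<^sub>R (q *\<^sub>R \<alpha> x)" .
    then show ?thesis using ab(2) unfolding scaleR_cancel_left by simp
  qed
  have "r \<in> closure \<rat>" by (simp add: Rats_closure_real)
  then obtain s where s: "\<forall>n. s n \<in> \<rat>" "s \<longlonglongrightarrow> r" unfolding closure_sequential by (elim exE conjE)
  have "(\<lambda>n. s n *\<^sub>R x) \<longlonglongrightarrow> r *\<^sub>R x" by (intro tendsto_scaleR s tendsto_const)
  then have "(\<lambda>n. \<alpha> (s n *\<^sub>R x)) \<longlonglongrightarrow> \<alpha> (r *\<^sub>R x)"
    by (intro continuous_on_tendsto_compose[OF cont]) auto
  moreover have "(\<lambda>n. \<alpha> (s n *\<^sub>R x)) = (\<lambda>n. s n *\<^sub>R \<alpha> x)" using rat s(1) by simp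
  moreover have "(\<lambda>n. s n *\<^sub>R \<alpha> x) \<longlonglongrightarrow> r *\<^sub>R \<alpha> x" by (intro tendsto_scaleR s tendsto_const)
  ultimately show ?thesis by (intro LIMSEQ_unique[of "\<lambda>n. s n *\<^sub>R \<alpha> x"]) (simp_all only:)
qed

context valued_field
begin

lemma real_iso_unique:
  fixes \<psi> \<psi>' :: "'v \<Rightarrow> real"
  assumes "topological_field_iso \<psi>" "topological_field_iso \<psi>'"
  shows "\<psi>' = \<psi>"
proof -
  note \<alpha> = iso_compose_inv[OF assms]
  have "(\<psi>' \<circ> inv \<psi>) x = x" for x
    using continuous_additive_imp_linear[OF \<alpha>(1,3), of x 1] \<alpha>(4) by simp
  then have "\<psi>' \<circ> inv \<psi> = id" by (simp add: fun_eq_iff)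
  then show ?thesis using \<alpha>(5) by (simp only: id_comp)
qed

text \<open>The change of model is real linear and fixes 1, so it is determined by the image of
  \<open>\<i>\<close>, which is a square root of -1.\<close>

lemma complex_iso_unique:
  fixes \<psi> \<psi>' :: "'v \<Rightarrow> complex"
  assumes "topological_field_iso \<psi>" "topological_field_iso \<psi>'"
  shows "\<psi>' = \<psi> \<or> \<psi>' = cnj \<circ> \<psi>"
proof -
  note \<alpha>' = iso_compose_inv[OF assms]
  define \<alpha> where "\<alpha> = \<psi>' \<circ> inv \<psi>"
  note \<alpha> = \<alpha>'[folded \<alpha>_def]
  have form: "\<alpha> z = complex_of_real (Re z) + complex_of_real (Im z) * \<alpha> \<i>" for z
  proof -
    have "z = Re z *\<^sub>R 1 + Im z *\<^sub>R \<i>" by (simp add: complex_eq_iff)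
    then have "\<alpha> z = \<alpha> (Re z *\<^sub>R 1 + Im z *\<^sub>R \<i>)" by (rule arg_cong)
    also have "\<dots> = Re z *\<^sub>R \<alpha> 1 + Im z *\<^sub>R \<alpha> \<i>"
      by (simp only: \<alpha>(1) continuous_additive_imp_linear[OF \<alpha>(1,3)])
    finally show ?thesis by (simp add: \<alpha>(4) scaleR_conv_of_real)
  qed
  have "\<alpha> \<i> * \<alpha> \<i> = \<alpha> (- 1)" by (simp add: \<alpha>(2)[symmetric])
  also have "\<dots> = - 1" using form[of "- 1"] by simp
  finally have "(\<alpha> \<i> - \<i>) * (\<alpha> \<i> + \<i>) = 0" by (simp add: algebra_simps)
  then have "\<alpha> \<i> = \<i> \<or> \<alpha> \<i> = - \<i>" by (auto simp: eq_neg_iff_add_eq_0)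
  then have "\<alpha> = id \<or> \<alpha> = cnj"
  proof
    assume "\<alpha> \<i> = \<i>"
    then have "\<alpha> z = z" for z using form[of z] by (simp add: complex_eq_iff)
    then show ?thesis by (simp add: fun_eq_iff)
  next
    assume "\<alpha> \<i> = - \<i>"
    then have "\<alpha> z = cnj z" for z using form[of z] by (simp add: complex_eq_iff)
    then show ?thesis by (simp add: fun_eq_iff)
  qed
  then show ?thesis using \<alpha>(5) by (auto simp: fun_eq_iff)
qed

text \<open>A change of model from the complex to the real numbers would produce a real square root
  of -1.\<close>

lemma not_real_and_complex:
  fixes \<psi> :: "'v \<Rightarrow> real" and \<psi>' :: "'v \<Rightarrow> complex"
  assumes "topological_field_iso \<psi>" "topological_field_iso \<psi>'"
  shows False
proof -
  note \<alpha>' = iso_compose_inv[OF assms(2,1)]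
  define \<alpha> where "\<alpha> = \<psi> \<circ> inv \<psi>'"
  note \<alpha> = \<alpha>'[folded \<alpha>_def]
  have "\<alpha> (- 1) = - 1" using continuous_additive_imp_linear[OF \<alpha>(1,3), of "- 1" 1] \<alpha>(4) by simp
  moreover have "\<alpha> \<i> * \<alpha> \<i> = \<alpha> (- 1)" by (simp add: \<alpha>(2)[symmetric])
  ultimately have "\<alpha> \<i> * \<alpha> \<i> < 0" by simp
  then show False using zero_le_square[of "\<alpha> \<i>"] by linarith
qed

text \<open>There is only one real model and no complex one, so the description in
  \<open>nabs\<close> and the disjunction in \<open>schwartz_bruhat\<close> both reduce to
  \<open>\<psi>\<close>.\<close>

lemma arch_field_real:
  fixes \<psi> :: "'v \<Rightarrow> real"
  assumes iso: "topological_field_iso \<psi>" and nf: "\<not> finite_place TYPE('v)"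
    and basis: "\<exists>B. finite_basis_over BF B"
  shows "arch_field \<psi>"
proof
  show "topological_field_iso \<psi>" "\<not> finite_place TYPE('v)" "\<exists>B. finite_basis_over BF B" by fact+
  show "DIM(real) \<le> 2" by simp
  have "nabs x = \<bar>\<psi> x\<bar>" for x
  proof -
    have "nabs x = (THE r. (\<exists>\<phi>::'v \<Rightarrow> real. topological_field_iso \<phi> \<and> r = \<bar>\<phi> x\<bar>) \<or>
                   (\<exists>\<phi>::'v \<Rightarrow> complex. topological_field_iso \<phi> \<and>
                      complex_of_real r = \<phi> x * cnj (\<phi> x)))"
      using nf by (simp add: nabs_def)
    also have "\<dots> = \<bar>\<psi> x\<bar>"
    proof (rule the_equality, goal_cases)
      case 1
      show ?case using iso by (intro disjI1 exI[of _ \<psi>]) simp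
    next
      case (2 r)
      then show ?case
      proof (elim disjE exE conjE)
        fix \<phi> :: "'v \<Rightarrow> real" assume "topological_field_iso \<phi>" "r = \<bar>\<phi> x\<bar>"
        then show ?thesis using real_iso_unique[OF iso] by simp
      next
        fix \<phi> :: "'v \<Rightarrow> complex" assume "topological_field_iso \<phi>"
        from not_real_and_complex[OF iso this] show ?thesis ..
      qed
    qed
    finally show ?thesis .
  qed
  then show "nabs x = norm (\<psi> x) ^ DIM(real)" for x by simp
  show "schwartz_bruhat f \<longleftrightarrow> schwartz (f \<circ> inv \<psi>)" for f
  proof
    assume "schwartz_bruhat f"
    then have "(\<exists>\<phi>::'v \<Rightarrow> real. topological_field_iso \<phi> \<and> schwartz (f \<circ> inv \<phi>)) \<or>
        (\<exists>\<phi>::'v \<Rightarrow> complex. topological_field_iso \<phi> \<and> schwartz (f \<circ> inv \<phi>))"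
      using nf by (simp add: schwartz_bruhat_def)
    then show "schwartz (f \<circ> inv \<psi>)"
    proof (elim disjE exE conjE)
      fix \<phi> :: "'v \<Rightarrow> real" assume "topological_field_iso \<phi>" "schwartz (f \<circ> inv \<phi>)"
      then show ?thesis using real_iso_unique[OF iso] by simp
    next
      fix \<phi> :: "'v \<Rightarrow> complex" assume "topological_field_iso \<phi>"
      from not_real_and_complex[OF iso this] show ?thesis ..
    qed
  next
    assume "schwartz (f \<circ> inv \<psi>)"
    then show "schwartz_bruhat f" unfolding schwartz_bruhat_def using nf iso by simp blast
  qed
qed

text \<open>Any other complex model differs from \<open>\<psi>\<close> by conjugation at most, which
  alters neither \<open>\<phi> x * cnj (\<phi> x)\<close> nor the Schwartz class.\<close>

lemma arch_field_complex:
  fixes \<psi> :: "'v \<Rightarrow> complex"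
  assumes iso: "topological_field_iso \<psi>" and nf: "\<not> finite_place TYPE('v)"
    and basis: "\<exists>B. finite_basis_over BF B"
  shows "arch_field \<psi>"
proof
  show "topological_field_iso \<psi>" "\<not> finite_place TYPE('v)" "\<exists>B. finite_basis_over BF B" by fact+
  show "DIM(complex) \<le> 2" by simp
  have sq: "\<phi> x * cnj (\<phi> x) = complex_of_real ((norm (\<psi> x))\<^sup>2)" if "topological_field_iso \<phi>" for \<phi> :: "'v \<Rightarrow> complex" and x
  proof -
    have "\<phi> x = \<psi> x \<or> \<phi> x = cnj (\<psi> x)" using complex_iso_unique[OF iso that] by auto
    then show ?thesis using complex_norm_square[of "\<psi> x"] by (auto simp: mult.commute)
  qed
  have "nabs x = (norm (\<psi> x))\<^sup>2" for x
  proof -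
    have "nabs x = (THE r. (\<exists>\<phi>::'v \<Rightarrow> real. topological_field_iso \<phi> \<and> r = \<bar>\<phi> x\<bar>) \<or>
                   (\<exists>\<phi>::'v \<Rightarrow> complex. topological_field_iso \<phi> \<and>
                      complex_of_real r = \<phi> x * cnj (\<phi> x)))"
      using nf by (simp add: nabs_def)
    also have "\<dots> = (norm (\<psi> x))\<^sup>2"
    proof (rule the_equality)
      show "(\<exists>\<phi>::'v \<Rightarrow> real. topological_field_iso \<phi> \<and> (norm (\<psi> x))\<^sup>2 = \<bar>\<phi> x\<bar>) \<or>
                   (\<exists>\<phi>::'v \<Rightarrow> complex. topological_field_iso \<phi> \<and>
                      complex_of_real ((norm (\<psi> x))\<^sup>2) = \<phi> x * cnj (\<phi> x))"
        using iso sq[OF iso] by (intro disjI2 exI[of _ \<psi>]) simp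
      fix r assume "(\<exists>\<phi>::'v \<Rightarrow> real. topological_field_iso \<phi> \<and> r = \<bar>\<phi> x\<bar>) \<or>
                   (\<exists>\<phi>::'v \<Rightarrow> complex. topological_field_iso \<phi> \<and>
                      complex_of_real r = \<phi> x * cnj (\<phi> x))"
      then have "\<exists>\<phi>::'v \<Rightarrow> complex. topological_field_iso \<phi> \<and> complex_of_real r = \<phi> x * cnj (\<phi> x)"
      proof (elim disjE)
        assume "\<exists>\<phi>::'v \<Rightarrow> real. topological_field_iso \<phi> \<and> r = \<bar>\<phi> x\<bar>"
        then obtain \<phi> :: "'v \<Rightarrow> real" where "topological_field_iso \<phi>" by (elim exE conjE)
        from not_real_and_complex[OF this iso] show ?thesis ..
      qed
      then obtain \<phi> :: "'v \<Rightarrow> complex" where "topological_field_iso \<phi>" "complex_of_real r = \<phi> x * cnj (\<phi> x)"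
        by (elim exE conjE)
      then have "complex_of_real r = complex_of_real ((norm (\<psi> x))\<^sup>2)" using sq by simp
      then show "r = (norm (\<psi> x))\<^sup>2" by (simp only: of_real_eq_iff)
    qed
    finally show ?thesis .
  qed
  then show "nabs x = norm (\<psi> x) ^ DIM(complex)" for x by simp
  have cnj_case: "schwartz (f \<circ> inv \<psi>)" if "topological_field_iso \<phi>" "schwartz (f \<circ> inv \<phi>)" "\<phi> = cnj \<circ> \<psi>" for f \<phi>
  proof -
    have bij: "bij \<psi>" using iso by (simp add: topological_field_iso_def)
    have inv_phi: "inv \<phi> z = inv \<psi> (cnj z)" for z
    proof (rule inv_f_eq)
      show "inj \<phi>" using that(1) by (simp add: topological_field_iso_def bij_is_inj)
      show "\<phi> (inv \<psi> (cnj z)) = z" using bij by (simp add: that(3) bij_is_surj surj_f_inv_f)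
    qed
    have "f \<circ> inv \<psi> = (f \<circ> inv \<phi>) \<circ> cnj" by (simp add: fun_eq_iff inv_phi)
    then show ?thesis using schwartz_cnj[OF that(2)] by simp
  qed
  show "schwartz_bruhat f \<longleftrightarrow> schwartz (f \<circ> inv \<psi>)" for f
  proof
    assume "schwartz_bruhat f"
    then have "(\<exists>\<phi>::'v \<Rightarrow> real. topological_field_iso \<phi> \<and> schwartz (f \<circ> inv \<phi>)) \<or>
        (\<exists>\<phi>::'v \<Rightarrow> complex. topological_field_iso \<phi> \<and> schwartz (f \<circ> inv \<phi>))"
      using nf by (simp add: schwartz_bruhat_def)
    then have "\<exists>\<phi>::'v \<Rightarrow> complex. topological_field_iso \<phi> \<and> schwartz (f \<circ> inv \<phi>)"
    proof (elim disjE)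
      assume "\<exists>\<phi>::'v \<Rightarrow> real. topological_field_iso \<phi> \<and> schwartz (f \<circ> inv \<phi>)"
      then obtain \<phi> :: "'v \<Rightarrow> real" where "topological_field_iso \<phi>" by (elim exE conjE)
      from not_real_and_complex[OF this iso] show ?thesis ..
    qed
    then obtain \<phi> :: "'v \<Rightarrow> complex" where \<phi>: "topological_field_iso \<phi>" "schwartz (f \<circ> inv \<phi>)"
      by (elim exE conjE)
    then show "schwartz (f \<circ> inv \<psi>)"
      using complex_iso_unique[OF iso \<phi>(1)] cnj_case[OF \<phi>] by (elim disjE) simp_all
  next
    assume "schwartz (f \<circ> inv \<psi>)"
    then show "schwartz_bruhat f" unfolding schwartz_bruhat_def using nf iso by simp blast
  qed
qed

end

section \<open>Assembly of the cases\<close>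

lemma completion_nontrivial:
  fixes v :: "'k::field_char_0 \<Rightarrow> real" and \<iota> :: "'k \<Rightarrow> 'v::{field_char_0,complete_space}"
  assumes "represents_place v" "is_completion v \<iota>"
  shows "\<exists>x::'v. x \<noteq> 0 \<and> dist x 0 \<noteq> 1"
proof -
  obtain x where x: "x \<noteq> 0" "v x \<noteq> 1" "absolute_value v" using assms(1) unfolding represents_place_def by blast
  have "dist (\<iota> x) 0 = v x" using assms(2) unfolding is_completion_def by blast
  moreover have "v x \<noteq> 0" using x unfolding absolute_value_def by blast
  ultimately show ?thesis using x by (intro exI[of _ "\<iota> x"]) auto
qed

text \<open>A nonzero Schwartz--Bruhat function at a finite place has an open set inside its compact
  support, so its existence makes the completion locally compact.\<close>

lemma nonarch_field_if_schwartz_bruhat: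
  fixes f :: "'v::{field_char_0,complete_space} \<Rightarrow> complex"
  assumes "valued_field TYPE('v)" "finite_place TYPE('v)" "\<exists>x::'v. x \<noteq> 0 \<and> dist x 0 \<noteq> 1"
    and f: "schwartz_bruhat f" "f x0 \<noteq> 0"
  shows "nonarch_field TYPE('v)"
proof -
  have sb: "\<forall>x. \<forall>\<^sub>F y in nhds x. f y = f x" "compact (closure {x. f x \<noteq> 0})"
    using f(1) assms(2) by (simp_all add: schwartz_bruhat_def)
  have "\<forall>\<^sub>F y in nhds x0. f y = f x0" using sb(1) by blast
  then obtain r where r: "r > 0" "\<And>y. dist y x0 < r \<Longrightarrow> f y = f x0"
    unfolding eventually_nhds_metric by blast
  have "cball x0 (r / 2) \<subseteq> closure {x. f x \<noteq> 0}"
  proof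
    fix y assume "y \<in> cball x0 (r / 2)"
    then have "dist y x0 < r" using r(1) by (simp add: dist_commute)
    then have "y \<in> {x. f x \<noteq> 0}" using r(2)[of y] f(2) by simp
    then show "y \<in> closure {x. f x \<noteq> 0}" using closure_subset by (rule subsetD[rotated])
  qed
  then have "closure {x. f x \<noteq> 0} \<inter> cball x0 (r / 2) = cball x0 (r / 2)" by (simp only: Int_absorb1)
  moreover have "compact (closure {x. f x \<noteq> 0} \<inter> cball x0 (r / 2))"
    using sb(2) by (intro compact_Int_closed) auto
  ultimately have "compact (cball x0 (r / 2))" by (simp only:)
  then have "\<exists>(a::'v) r. 0 < r \<and> compact (cball a r)" using r(1) by (intro exI[of _ x0] exI[of _ "r / 2"]) simp
  then show ?thesis
    using assms(1-3) by (intro nonarch_field.intro nonarch_field_axioms.intro) (auto simp: finite_place_def)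
qed

text \<open>A nonzero Schwartz--Bruhat function gives access to the structure of the completion: at
  a finite place it forces local compactness, and at an archimedean place the definition of the
  class itself supplies an isomorphism with the real or complex numbers. If there is none, only the
  zero function has to be considered.\<close>

theorem mainTheorem3:
  fixes v :: "'k::field_char_0 \<Rightarrow> real"
    and \<iota> :: "'k \<Rightarrow> 'v::{field_char_0,complete_space}"
    and \<mu> :: "'v measure"
  assumes "number_field TYPE('k)"
    and "represents_place v"
    and "is_completion v \<iota>"
    and "self_dual_haar \<mu>"
  shows "\<exists>c::real. \<forall>f. schwartz_bruhat f \<longrightarrow>
           l2_inner \<mu> (conductor_op \<mu> f) f \<in> \<real> \<and>
           Re (l2_inner \<mu> (conductor_op \<mu> f) f) \<ge> c * (l2_norm \<mu> f)\<^sup>2"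
proof -
  interpret valued_field "TYPE('v)" by (rule completion_valued_field[OF assms(3)])
  have basis: "\<exists>B. finite_basis_over BF B" by (rule completion_finite_basis[OF assms(1,3)])
  have dense: "countable (range \<iota>)" "closure (range \<iota>) = UNIV"
    using countable_number_field(1)[OF assms(1)] assms(3) by (auto simp: is_completion_def)
  show ?thesis
  proof (cases "\<exists>f x. schwartz_bruhat f \<and> f (x::'v) \<noteq> 0")
    case False
    then have zero: "schwartz_bruhat f \<Longrightarrow> f = (\<lambda>_. 0)" for f :: "'v \<Rightarrow> complex" by blast
    show ?thesis
    proof (intro exI[of _ 0] allI impI)
      fix f :: "'v \<Rightarrow> complex" assume "schwartz_bruhat f"
      then have "f = (\<lambda>_. 0)" by (rule zero)
      then show "l2_inner \<mu> (conductor_op \<mu> f) f \<in> \<real> \<and> Re (l2_inner \<mu> (conductor_op \<mu> f) f) \<ge> 0 * (l2_norm \<mu> f)\<^sup>2"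
        by (simp add: l2_inner_def)
    qed
  next
    case True
    then obtain f0 and x0 :: 'v where f0: "schwartz_bruhat f0" "f0 x0 \<noteq> 0" by blast
    show ?thesis
    proof (cases "finite_place TYPE('v)")
      case True
      then interpret nonarch_field "TYPE('v)"
        by (intro nonarch_field_if_schwartz_bruhat[OF valued_field_axioms _ completion_nontrivial[OF assms(2,3)] f0])
      show ?thesis by (rule conductor_bounded_below_nonarch[OF assms(4) basis dense])
    next
      case False
      then consider \<psi> :: "'v \<Rightarrow> real" where "topological_field_iso \<psi>"
        | \<psi> :: "'v \<Rightarrow> complex" where "topological_field_iso \<psi>"
        using f0(1) unfolding schwartz_bruhat_def by auto
      then show ?thesis
      proof cases
        case 1
        show ?thesis
          by (rule arch_field.conductor_bounded_below_arch[OF arch_field_real[OF 1 False basis] assms(4) dense])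
      next
        case 2
        show ?thesis
          by (rule arch_field.conductor_bounded_below_arch[OF arch_field_complex[OF 2 False basis] assms(4) dense])
      qed
    qed
  qed
qed

end
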